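(* There exists an Orlicz function $M$ such that the Orlicz sequence space $h_M$ is $c_0$-saturated but not isomorphically polyhedral. In particular, a $c_0$-saturated Banach space with a separable dual is not necessarily isomorphically polyhedral, i.e., there exists a $c_0$-saturated Banach space with separable dual which is not isomorphically polyhedral.
   Context: All Banach spaces are real. A Banach space is polyhedral if the closed unit ball of each of its finite dimensional subspaces is a polyhedron (i.e., the convex hull of finitely many points). A Banach space is isomorphically polyhedral if it is (linearly) isomorphic to a polyhedral Banach space. A Banach space is $c_0$-saturated if each of its closed infinite dimensional subspaces contains an isomorph of $c_0$ (a closed subspace linearly isomorphic to $c_0$). An Orlicz function $M$ is a continuous non-decreasing convex function defined for $t\ge 0$ such that $M(0)=0$ and $\lim_{t\to\infty}M(t)=\infty$. The Orlicz sequence space $\ell_M$ is the space of all real sequences $(a_n)$ such that $\sum_n M(|a_n|/\rho)<\infty$ for some $\rho>0$, with the norm $\|(a_n)\|=\inf\{\rho>0:\sum_n M(|a_n|/\rho)\le 1\}$. Let $e_n$ be the sequence whose only nonzero coordinate is a $1$ in the $n$-th position. The space $h_M$ is the closed linear span of $\{e_n\}$ in $\ell_M$; equivalently, it is the set of all real sequences $(a_n)$ with $\sum_n M(|a_n|/\rho)<\infty$ for every $\rho>0$. *)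

theory Defs
  imports "HOL-Analysis.Analysis" "HOL-Library.Function_Algebras"
begin

section \<open>Sequences as a real vector space\<close>

instantiation "fun" :: (type, real_vector) real_vector
begin

definition scaleR_fun :: "real \<Rightarrow> ('a \<Rightarrow> 'b) \<Rightarrow> 'a \<Rightarrow> 'b"
  where "scaleR_fun c f = (\<lambda>x. c *\<^sub>R f x)"

instance
  by standard
    (simp_all add: scaleR_fun_def fun_eq_iff scaleR_add_right scaleR_add_left)

end

lemma scaleR_fun_apply [simp]: "(c *\<^sub>R f) x = c *\<^sub>R f x"
  by (simp add: scaleR_fun_def)

section \<open>Banach spaces carried by linear subspaces\<close>

text \<open>
  The spaces considered here depend on parameters, so a real normed space is not modelled by a
  type of class \<^class>\<open>real_normed_vector\<close>, but as a pair \<open>V\<close>, \<open>N\<close> of a linear subspace \<open>V\<close> of some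
  real vector space and a function \<open>N\<close> whose restriction to \<open>V\<close> is a norm. The values of \<open>N\<close>
  outside of \<open>V\<close> are irrelevant.
\<close>

definition normed_on :: "'a::real_vector set \<Rightarrow> ('a \<Rightarrow> real) \<Rightarrow> bool"
  where "normed_on V N \<longleftrightarrow> subspace V \<and>
    (\<forall>x\<in>V. 0 \<le> N x) \<and>
    (\<forall>x\<in>V. N x = 0 \<longleftrightarrow> x = 0) \<and>
    (\<forall>c. \<forall>x\<in>V. N (c *\<^sub>R x) = \<bar>c\<bar> * N x) \<and>
    (\<forall>x\<in>V. \<forall>y\<in>V. N (x + y) \<le> N x + N y)"

text \<open>
  The locale \<^locale>\<open>Metric_space\<close> requires a distance to be nonnegative and symmetric also outside of
  the carrier, hence the case distinction.
\<close>

definition norm_dist :: "'a::real_vector set \<Rightarrow> ('a \<Rightarrow> real) \<Rightarrow> 'a \<Rightarrow> 'a \<Rightarrow> real"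
  where "norm_dist V N x y = (if x \<in> V \<and> y \<in> V then N (x - y) else 0)"

lemma Metric_space_norm_dist:
  assumes "normed_on V N"
  shows "Metric_space V (norm_dist V N)"
proof
  have V: "subspace V" using assms by (simp add: normed_on_def)
  have sub: "x - y \<in> V" if "x \<in> V" "y \<in> V" for x y
    using V that by (rule subspace_diff)
  fix x y z
  show "0 \<le> norm_dist V N x y"
    using assms sub by (simp add: norm_dist_def normed_on_def)
  have "N (x - y) = N (y - x)" if "x \<in> V" "y \<in> V"
  proof -
    have "N ((-1) *\<^sub>R (y - x)) = \<bar>-1\<bar> * N (y - x)"
      using assms sub[OF that(2,1)] unfolding normed_on_def by blast
    thus ?thesis by simp
  qed
  thus "norm_dist V N x y = norm_dist V N y x"
    by (auto simp: norm_dist_def)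
  show "norm_dist V N x y = 0 \<longleftrightarrow> x = y" if "x \<in> V" "y \<in> V"
    using assms sub[OF that] that by (simp add: norm_dist_def normed_on_def)
  show "norm_dist V N x z \<le> norm_dist V N x y + norm_dist V N y z"
    if "x \<in> V" "y \<in> V" "z \<in> V"
  proof -
    have "\<forall>u\<in>V. \<forall>v\<in>V. N (u + v) \<le> N u + N v"
      using assms by (simp add: normed_on_def)
    hence "N ((x - y) + (y - z)) \<le> N (x - y) + N (y - z)"
      using sub[OF that(1,2)] sub[OF that(2,3)] by fast
    thus ?thesis using that by (simp add: norm_dist_def)
  qed
qed

definition norm_topology :: "'a::real_vector set \<Rightarrow> ('a \<Rightarrow> real) \<Rightarrow> 'a topology"
  where "norm_topology V N = Metric_space.mtopology V (norm_dist V N)"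

definition banach_on :: "'a::real_vector set \<Rightarrow> ('a \<Rightarrow> real) \<Rightarrow> bool"
  where "banach_on V N \<longleftrightarrow> normed_on V N \<and> Metric_space.mcomplete V (norm_dist V N)"

definition finite_dim :: "'a::real_vector set \<Rightarrow> bool"
  where "finite_dim V \<longleftrightarrow> (\<exists>B. finite B \<and> V = span B)"

definition linear_on :: "'a::real_vector set \<Rightarrow> ('a \<Rightarrow> 'b::real_vector) \<Rightarrow> bool"
  where "linear_on V T \<longleftrightarrow>
    (\<forall>x\<in>V. \<forall>y\<in>V. T (x + y) = T x + T y) \<and> (\<forall>c. \<forall>x\<in>V. T (c *\<^sub>R x) = c *\<^sub>R T x)"

definition isomorphic_on ::
    "'a::real_vector set \<Rightarrow> ('a \<Rightarrow> real) \<Rightarrow> 'b::real_vector set \<Rightarrow> ('b \<Rightarrow> real) \<Rightarrow> bool"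
  where "isomorphic_on V N W K \<longleftrightarrow>
    (\<exists>T. linear_on V T \<and> bij_betw T V W \<and>
      (\<exists>C. \<forall>x\<in>V. K (T x) \<le> C * N x) \<and> (\<exists>C. \<forall>x\<in>V. N x \<le> C * K (T x)))"

definition polyhedral_on :: "'a::real_vector set \<Rightarrow> ('a \<Rightarrow> real) \<Rightarrow> bool"
  where "polyhedral_on V N \<longleftrightarrow>
    (\<forall>F. subspace F \<and> F \<subseteq> V \<and> finite_dim F \<longrightarrow> polytope {x \<in> F. N x \<le> 1})"

text \<open>
  A definition cannot quantify over the type carrying the polyhedral space, so that space is taken
  inside the type carrying \<open>V\<close>. Lemma \<open>isomorphically_polyhedral_onI\<close> below shows that
  spaces carried by other types yield nothing new.
\<close>

definition isomorphically_polyhedral_on :: "'a::real_vector set \<Rightarrow> ('a \<Rightarrow> real) \<Rightarrow> bool"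
  where "isomorphically_polyhedral_on V N \<longleftrightarrow>
    (\<exists>(W::'a set) K. banach_on W K \<and> polyhedral_on W K \<and> isomorphic_on V N W K)"

definition c0 :: "(nat \<Rightarrow> real) set"
  where "c0 = {a. a \<longlonglongrightarrow> 0}"

definition sup_norm :: "(nat \<Rightarrow> real) \<Rightarrow> real"
  where "sup_norm a = (SUP n. \<bar>a n\<bar>)"

definition c0_saturated_on :: "'a::real_vector set \<Rightarrow> ('a \<Rightarrow> real) \<Rightarrow> bool"
  where "c0_saturated_on V N \<longleftrightarrow>
    (\<forall>W. subspace W \<and> closedin (norm_topology V N) W \<and> \<not> finite_dim W \<longrightarrow>
      (\<exists>Z. subspace Z \<and> Z \<subseteq> W \<and> closedin (norm_topology V N) Z \<and> isomorphic_on Z N c0 sup_norm))"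

text \<open>Functionals on \<open>V\<close> are represented by their extension by \<open>0\<close> to the whole type.\<close>

definition dual_on :: "'a::real_vector set \<Rightarrow> ('a \<Rightarrow> real) \<Rightarrow> ('a \<Rightarrow> real) set"
  where "dual_on V N =
    {f. linear_on V f \<and> (\<exists>C. \<forall>x\<in>V. \<bar>f x\<bar> \<le> C * N x) \<and> (\<forall>x. x \<notin> V \<longrightarrow> f x = 0)}"

definition dual_norm :: "'a::real_vector set \<Rightarrow> ('a \<Rightarrow> real) \<Rightarrow> ('a \<Rightarrow> real) \<Rightarrow> real"
  where "dual_norm V N f = (SUP x\<in>{x\<in>V. N x \<le> 1}. \<bar>f x\<bar>)"

definition separable_dual_on :: "'a::real_vector set \<Rightarrow> ('a \<Rightarrow> real) \<Rightarrow> bool"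
  where "separable_dual_on V N \<longleftrightarrow>
    separable_space (norm_topology (dual_on V N) (dual_norm V N))"

section \<open>Orlicz sequence spaces\<close>

text \<open>The values of an Orlicz function at negative arguments are irrelevant.\<close>

definition orlicz_function :: "(real \<Rightarrow> real) \<Rightarrow> bool"
  where "orlicz_function M \<longleftrightarrow>
    continuous_on {0..} M \<and> mono_on {0..} M \<and> convex_on {0..} M \<and>
    M 0 = 0 \<and> filterlim M at_top at_top"

definition orlicz_space :: "(real \<Rightarrow> real) \<Rightarrow> (nat \<Rightarrow> real) set"
  where "orlicz_space M = {a. \<exists>\<rho>>0. summable (\<lambda>n. M (\<bar>a n\<bar> / \<rho>))}"

definition orlicz_norm :: "(real \<Rightarrow> real) \<Rightarrow> (nat \<Rightarrow> real) \<Rightarrow> real"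
  where "orlicz_norm M a =
    Inf {\<rho>. 0 < \<rho> \<and> summable (\<lambda>n. M (\<bar>a n\<bar> / \<rho>)) \<and> (\<Sum>n. M (\<bar>a n\<bar> / \<rho>)) \<le> 1}"

definition unit_seq :: "nat \<Rightarrow> nat \<Rightarrow> real"
  where "unit_seq n = (\<lambda>k. if k = n then 1 else 0)"

definition orlicz_h :: "(real \<Rightarrow> real) \<Rightarrow> (nat \<Rightarrow> real) set"
  where "orlicz_h M =
    norm_topology (orlicz_space M) (orlicz_norm M) closure_of span (range unit_seq)"

section \<open>Independence of the carrier type\<close>

lemma linear_on_extend:
  assumes V: "subspace V" and T: "linear_on V T"
  obtains g where "linear g" "\<And>x. x \<in> V \<Longrightarrow> g x = T x"
proof -
  obtain B where B: "B \<subseteq> V" "independent B" "V \<subseteq> span B"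
    using basis_exists[of V] by metis
  obtain g where g: "linear g" "\<forall>x\<in>B. g x = T x"
    using linear_independent_extend[OF B(2)] by metis
  have sp: "span B \<subseteq> V" using B(1) V by (rule span_minimal)
  have T0: "T 0 = 0"
  proof -
    have "T (0 *\<^sub>R 0) = 0 *\<^sub>R T 0"
      using T subspace_0[OF V] unfolding linear_on_def by blast
    thus ?thesis by simp
  qed
  have "x \<in> V \<and> g x = T x" if "x \<in> span B" for x
    using that
  proof (induction rule: span_induct_alt)
    case base
    show ?case using T0 subspace_0[OF V] linear_0[OF g(1)] by simp
  next
    case (step c x y)
    have x: "x \<in> V" "c *\<^sub>R x \<in> V" using step B(1) V by (auto intro: subspace_scale)
    have "T (c *\<^sub>R x + y) = c *\<^sub>R T x + T y"
      using T x step by (simp add: linear_on_def)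
    moreover have "g (c *\<^sub>R x + y) = c *\<^sub>R g x + g y"
      by (simp add: linear_add[OF g(1)] linear_scale[OF g(1)])
    ultimately show ?case using step g(2) x V by (auto intro: subspace_add)
  qed
  thus ?thesis using that g(1) B(3) by blast
qed

lemma isomorphically_polyhedral_onI:
  fixes V :: "'a::real_vector set" and W :: "'b::real_vector set"
  assumes V: "normed_on V N" and W: "banach_on W K" "polyhedral_on W K"
    and iso: "isomorphic_on V N W K"
  shows "isomorphically_polyhedral_on V N"
proof -
  have sV: "subspace V" using V by (simp add: normed_on_def)
  have nW: "normed_on W K" using W(1) by (simp add: banach_on_def)
  obtain T0 where T0: "linear_on V T0" "bij_betw T0 V W"
    "\<exists>C. \<forall>x\<in>V. K (T0 x) \<le> C * N x" "\<exists>C. \<forall>x\<in>V. N x \<le> C * K (T0 x)"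
    using iso unfolding isomorphic_on_def by blast
  obtain T where T: "linear T" and eq: "\<And>x. x \<in> V \<Longrightarrow> T x = T0 x"
    using linear_on_extend[OF sV T0(1)] by metis
  have bij: "bij_betw T V W" using T0(2) eq bij_betw_cong by blast
  have TW: "T x \<in> W" if "x \<in> V" for x using bij that by (auto simp: bij_betw_def)
  have inj: "inj_on T V" using bij by (simp add: bij_betw_def)
  have T00: "T x = 0 \<longleftrightarrow> x = 0" if "x \<in> V" for x
    using inj that subspace_0[OF sV] linear_0[OF T] by (metis inj_onD)
  define L where "L = (\<lambda>x. K (T x))"
  have nL: "normed_on V L"
    unfolding normed_on_def L_def linear_scale[OF T] linear_add[OF T]
    using sV nW TW T00 by (simp add: normed_on_def)
  have dist: "norm_dist V L x y = norm_dist W K (T x) (T y)" if "x \<in> V" "y \<in> V" for x y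
    using that TW by (simp add: norm_dist_def L_def linear_diff[OF T])
  interpret mV: Metric_space V "norm_dist V L" by (rule Metric_space_norm_dist[OF nL])
  interpret mW: Metric_space W "norm_dist W K" by (rule Metric_space_norm_dist[OF nW])
  have compl: "mV.mcomplete"
    unfolding mV.mcomplete_def
  proof (intro allI impI)
    fix s assume s: "mV.MCauchy s"
    hence sV': "s n \<in> V" for n by (auto simp: mV.MCauchy_def)
    have "mW.MCauchy (T \<circ> s)"
      using s sV' TW dist by (auto simp: mV.MCauchy_def mW.MCauchy_def)
    then obtain y where y: "limitin mW.mtopology (T \<circ> s) y sequentially"
      using W(1) by (auto simp: banach_on_def mW.mcomplete_def)
    hence "y \<in> W" using mW.limitin_mspace by blast
    then obtain x where x: "x \<in> V" "y = T x" using bij by (auto simp: bij_betw_def)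
    have "limitin mV.mtopology s x sequentially"
      using y x sV' by (auto simp: mV.limit_metric_sequentially mW.limit_metric_sequentially dist) metis
    thus "\<exists>x. limitin mV.mtopology s x sequentially" ..
  qed
  have poly: "polyhedral_on V L"
    unfolding polyhedral_on_def
  proof (intro allI impI)
    fix F assume F: "subspace F \<and> F \<subseteq> V \<and> finite_dim F"
    then obtain B where B: "finite B" "F = span B" by (auto simp: finite_dim_def)
    have TF: "T ` F = span (T ` B)" using B T by (simp add: linear_span_image)
    have "polytope {y \<in> T ` F. K y \<le> 1}"
    proof -
      have "T ` F \<subseteq> W" using F TW by blast
      moreover have "finite_dim (T ` F)" using TF B(1) by (auto simp: finite_dim_def)
      moreover have "subspace (T ` F)" using TF by (simp add: subspace_span)
      ultimately show ?thesis using W(2) by (simp add: polyhedral_on_def)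
    qed
    then obtain S where S: "finite S" "{y \<in> T ` F. K y \<le> 1} = convex hull S"
      by (auto simp: polytope_def)
    have "S \<subseteq> T ` F" using S(2) hull_subset[of S convex] by blast
    then obtain S' where S': "S' \<subseteq> F" "finite S'" "S = T ` S'"
      using S(1) by (meson finite_subset_image)
    have hF: "convex hull S' \<subseteq> F"
      using S'(1) F by (simp add: subspace_imp_convex hull_minimal)
    have "T ` {x \<in> F. L x \<le> 1} = T ` (convex hull S')"
    proof -
      have "T ` {x \<in> F. L x \<le> 1} = {y \<in> T ` F. K y \<le> 1}" by (auto simp: L_def)
      also have "\<dots> = T ` (convex hull S')"
        using S(2) S'(3) convex_hull_linear_image[OF T] by simp
      finally show ?thesis .
    qed
    hence "{x \<in> F. L x \<le> 1} = convex hull S'"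
      using inj hF F by (subst (asm) inj_on_image_eq_iff[of T V]) auto
    thus "polytope {x \<in> F. L x \<le> 1}" using S'(2) by (auto simp: polytope_def)
  qed
  have "isomorphic_on V N V L"
    unfolding isomorphic_on_def
    using T0(3,4) eq
    by (intro exI[of _ id]) (auto simp: linear_on_def L_def)
  thus ?thesis
    using nL compl poly by (auto simp: isomorphically_polyhedral_on_def banach_on_def)
qed

end

theory Submission
  imports Defs "HOL-Real_Asymp.Real_Asymp"
begin

text \<open>
  In a separable polyhedral space the norm is smooth at generic points, and it coincides with its
  derivative at such a point on a cone with nonempty interior. Hence there are only countably many
  of these derivatives, and they suffice to attain the norm of every vector (Fonf). Inflating them
  slightly gives an equivalent norm \<open>P\<close> that is flat: \<open>P (x + t e\<^sub>j) \<rightarrow> P x\<close> as \<open>j \<rightarrow> \<infinity>\<close>, for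
  \<open>x \<noteq> 0\<close> and small \<open>t\<close>. Such a norm cannot exist on \<open>h\<^sub>M\<close> if there are \<open>\<tau>\<^sub>n \<rightarrow> 0\<close> with
  \<open>sup\<^sub>n M(c \<tau>\<^sub>n) / M(\<tau>\<^sub>n) < \<infinity>\<close> for all \<open>c\<close>: sequences in \<open>\<ell>\<^sub>M\<close> with coordinates among the \<open>\<tau>\<^sub>n\<close>
  belong to \<open>h\<^sub>M\<close>, so that a greedy construction converges to a point at which \<open>P\<close> is not flat. On the
  other hand, \<open>h\<^sub>M\<close> is \<open>c\<^sub>0\<close>-saturated if for all \<open>q\<close> there is \<open>C\<close> with \<open>M(t x) \<le> C t\<^sup>q M(x)\<close> for
  \<open>0 \<le> t \<le> 1\<close>, and the case \<open>q = 2\<close> makes the dual separable. Both conditions hold for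
  \<open>M(t) = \<Sum>\<^sub>n a\<^sub>n g(n! t)\<close> with \<open>g\<close> growing faster than any power and vanishing on \<open>[0,1]\<close>, and with
  \<open>a\<^sub>n\<close> decreasing fast enough.
\<close>

section \<open>Normed spaces carried by subspaces\<close>

text \<open>In every separable space countably many functionals compute the norm as a supremum; what
  polyhedrality adds is that the supremum is attained. Only then does an inflation by factors that
  decrease with the index leave a definite gap between the attaining functional and all late ones,
  so that just the finitely many early ones have to be small on far coordinates. The two
  requirements on \<open>M\<close> pull against each other. The power estimate with
  \<open>t = 1/c\<close> and \<open>x = c \<tau>\<close> forces the ratio of
  \<open>M(c \<tau>)\<close> to \<open>M(\<tau>)\<close> to be at least \<open>c^q / C\<close> for
  every \<open>q\<close>, whereas for each fixed \<open>c\<close> this ratio has to stay bounded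
  along the sequence. The bound must therefore grow in \<open>c\<close> faster than any power, which
  suggests an exponential building block. The scales must not interfere either: consecutive
  factorials have ratios tending to infinity, so any fixed factor \<open>c\<close> eventually fits
  into the gap between two scales, and the vanishing of the building block on [0,1] keeps the terms
  of smaller index out.\<close>

locale normed_subspace =
  fixes V :: "'a::real_vector set" and N :: "'a \<Rightarrow> real"
  assumes normed: "normed_on V N"
begin

lemma subspace_V: "subspace V"
  using normed by (simp add: normed_on_def)

lemma mem [simp, intro]:
  "0 \<in> V" "x \<in> V \<Longrightarrow> y \<in> V \<Longrightarrow> x + y \<in> V" "x \<in> V \<Longrightarrow> y \<in> V \<Longrightarrow> x - y \<in> V"
  "x \<in> V \<Longrightarrow> c *\<^sub>R x \<in> V" "x \<in> V \<Longrightarrow> - x \<in> V"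
  using subspace_V by (simp_all add: subspace_0 subspace_add subspace_diff subspace_scale subspace_neg)

lemma sum_mem: "(\<And>i. i \<in> I \<Longrightarrow> f i \<in> V) \<Longrightarrow> sum f I \<in> V"
  using subspace_sum[OF subspace_V] by blast

lemma norm_ge_0: "x \<in> V \<Longrightarrow> 0 \<le> N x"
  using normed by (simp add: normed_on_def)

lemma norm_eq_0: "x \<in> V \<Longrightarrow> N x = 0 \<longleftrightarrow> x = 0"
  using normed by (simp add: normed_on_def)

lemma norm_scale: "x \<in> V \<Longrightarrow> N (c *\<^sub>R x) = \<bar>c\<bar> * N x"
  using normed by (simp add: normed_on_def)

lemma norm_triangle: "x \<in> V \<Longrightarrow> y \<in> V \<Longrightarrow> N (x + y) \<le> N x + N y"
  using normed by (simp add: normed_on_def)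

lemma norm_0 [simp]: "N 0 = 0"
  using norm_eq_0 by simp

lemma norm_minus: "x \<in> V \<Longrightarrow> N (- x) = N x"
  using norm_scale[of x "-1"] by simp

lemma norm_diff_commute: "x \<in> V \<Longrightarrow> y \<in> V \<Longrightarrow> N (x - y) = N (y - x)"
  using norm_minus[of "x - y"] by simp

lemma norm_triangle_diff: "x \<in> V \<Longrightarrow> y \<in> V \<Longrightarrow> N x - N y \<le> N (x - y)"
  using norm_triangle[of "x - y" y] by simp

lemma norm_sum: "(\<And>i. i \<in> I \<Longrightarrow> f i \<in> V) \<Longrightarrow> N (sum f I) \<le> (\<Sum>i\<in>I. N (f i))"
proof (induction I rule: infinite_finite_induct)
  case (insert i I)
  thus ?case using norm_triangle[of "f i" "sum f I"] sum_mem[of I f] by simp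
qed auto

sublocale Metric_space V "norm_dist V N"
  by (rule Metric_space_norm_dist[OF normed])

lemma dist_eq [simp]: "x \<in> V \<Longrightarrow> y \<in> V \<Longrightarrow> norm_dist V N x y = N (x - y)"
  by (simp add: norm_dist_def)

lemma norm_topology_eq: "norm_topology V N = mtopology"
  by (simp add: norm_topology_def)

lemma limitin_iff:
  "limitin mtopology s x sequentially \<longleftrightarrow>
    x \<in> V \<and> (\<forall>\<epsilon>>0. \<exists>n0. \<forall>n\<ge>n0. s n \<in> V \<and> N (s n - x) < \<epsilon>)"
  unfolding limit_metric_sequentially by (rule conj_cong) (simp_all cong: conj_cong)

lemma closed_limit:
  assumes "closedin mtopology W" "\<And>n. s n \<in> W" "limitin mtopology s x sequentially"
  shows "x \<in> W"
  using assms unfolding metric_closedin_iff_sequentially_closed by blast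

lemma linear_on_simps:
  assumes "linear_on V f" "x \<in> V" "y \<in> V"
  shows "f (x + y) = f x + f y" "f (c *\<^sub>R x) = c *\<^sub>R f x" "f (x - y) = f x - f y" "f 0 = 0"
    "f (- x) = - f x"
proof -
  show *: "f (x + y) = f x + f y" "\<And>c. f (c *\<^sub>R x) = c *\<^sub>R f x"
    using assms by (auto simp: linear_on_def)
  have m: "f (- z) = - f z" if "z \<in> V" for z
  proof -
    have "f ((-1) *\<^sub>R z) = (-1) *\<^sub>R f z" using assms(1) that unfolding linear_on_def by blast
    thus ?thesis by simp
  qed
  show "f (- x) = - f x" using m assms by simp
  have "f (x + - y) = f x + f (- y)"
    using assms unfolding linear_on_def by blast
  thus "f (x - y) = f x - f y" using m assms by simp
  show "f 0 = 0" using *(2)[of 0] by simp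
qed

lemma linear_on_sum:
  assumes f: "linear_on V f" and "\<And>i. i \<in> I \<Longrightarrow> x i \<in> V"
  shows "f (sum x I) = (\<Sum>i\<in>I. f (x i))"
  using assms(2)
proof (induction I rule: infinite_finite_induct)
  case (insert i I)
  thus ?case using linear_on_simps(1)[OF f, of "x i" "sum x I"] sum_mem[of I x] by simp
qed (use linear_on_simps(4)[OF f] in auto)

end

section \<open>Completeness and Baire category\<close>

locale banach_subspace = normed_subspace +
  assumes complete: "mcomplete"
begin

lemma Cauchy_limit:
  assumes "\<And>n. s n \<in> V" "\<And>\<epsilon>. \<epsilon> > 0 \<Longrightarrow> \<exists>n0. \<forall>m\<ge>n0. \<forall>n\<ge>m. N (s n - s m) < \<epsilon>"
  shows "\<exists>x. limitin mtopology s x sequentially"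
proof -
  have "MCauchy s"
    unfolding MCauchy_def
  proof (intro conjI allI impI)
    fix \<epsilon> :: real assume "\<epsilon> > 0"
    then obtain n0 where n0: "\<forall>m\<ge>n0. \<forall>n\<ge>m. N (s n - s m) < \<epsilon>" using assms(2) by blast
    have "N (s n - s m) < \<epsilon>" if "n \<ge> n0" "m \<ge> n0" for n m
      using n0 that norm_diff_commute[of "s n" "s m"] assms(1)
      by (cases "m \<le> n") (metis, metis nat_le_linear)
    thus "\<exists>n0. \<forall>n n'. n0 \<le> n \<longrightarrow> n0 \<le> n' \<longrightarrow> norm_dist V N (s n) (s n') < \<epsilon>"
      using assms(1) by auto
  qed (use assms(1) in auto)
  thus ?thesis using complete by (simp add: mcomplete_def)
qed

lemma Baire_dense:
  assumes "countable \<G>"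
    and "\<And>T x. T \<in> \<G> \<Longrightarrow> x \<in> T \<Longrightarrow> x \<in> V \<and> (\<exists>r>0. \<forall>y\<in>V. N (x - y) < r \<longrightarrow> y \<in> T)"
    and "\<And>T x r. T \<in> \<G> \<Longrightarrow> x \<in> V \<Longrightarrow> r > 0 \<Longrightarrow> \<exists>y\<in>T. N (x - y) < r"
  shows "\<exists>x\<in>V. \<forall>T\<in>\<G>. x \<in> T"
proof -
  have "mtopology closure_of \<Inter>\<G> = V"
  proof (rule metric_Baire_category[OF complete assms(1)])
    fix T assume T: "T \<in> \<G>"
    have "openin mtopology T"
      unfolding openin_mtopology
    proof (intro conjI allI impI subsetI)
      fix x assume "x \<in> T"
      thus "x \<in> V" using assms(2)[OF T] by blast
    next
      fix x assume "x \<in> T"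
      then obtain r where r: "r > 0" "\<forall>y\<in>V. N (x - y) < r \<longrightarrow> y \<in> T" using assms(2)[OF T] by blast
      have "mball x r \<subseteq> T" using r(2) by auto
      thus "\<exists>r>0. mball x r \<subseteq> T" using r(1) by blast
    qed
    moreover have "mtopology closure_of T = V"
      unfolding metric_closure_of
    proof (intro Collect_eqI[of _ "\<lambda>x. x \<in> V", unfolded Collect_mem_eq] iffI conjI allI impI)
      fix x and r :: real assume x: "x \<in> V" "r > 0"
      then obtain y where "y \<in> T" "N (x - y) < r" using assms(3)[OF T] by blast
      thus "\<exists>y\<in>T. y \<in> mball x r" using assms(2)[OF T] x by (intro bexI[of _ y]) auto
    qed auto
    ultimately show "openin mtopology T \<and> mtopology closure_of T = V" ..
  qed
  \<comment> \<open>A dense intersection is nonempty because \<open>V\<close> contains 0; the radius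
    1 used below is arbitrary.\<close>
  hence "0 \<in> mtopology closure_of \<Inter>\<G>" by simp
  thus ?thesis
    unfolding metric_closure_of by (auto dest!: spec[of _ 1])
qed

text \<open>If no \<open>F k\<close> contained a ball, the complements would be countably many dense
  open sets, and a common point would escape the cover.\<close>

lemma Baire_union:
  fixes F :: "nat \<Rightarrow> 'a set"
  assumes "V \<subseteq> (\<Union>k. F k)"
    and "\<And>k x. x \<in> V \<Longrightarrow> x \<notin> F k \<Longrightarrow> \<exists>r>0. \<forall>y\<in>V. N (x - y) < r \<longrightarrow> y \<notin> F k"
  shows "\<exists>k. \<exists>x\<in>V. \<exists>r>0. \<forall>y\<in>V. N (x - y) < r \<longrightarrow> y \<in> F k"
proof (rule ccontr)
  assume no: "\<not> ?thesis"
  have "\<exists>x\<in>V. \<forall>T\<in>range (\<lambda>k. V - F k). x \<in> T"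
  proof (rule Baire_dense)
    fix T x assume "T \<in> range (\<lambda>k. V - F k)" "x \<in> T"
    thus "x \<in> V \<and> (\<exists>r>0. \<forall>y\<in>V. N (x - y) < r \<longrightarrow> y \<in> T)"
      using assms(2) by blast
  next
    fix T x r assume "T \<in> range (\<lambda>k. V - F k)" "x \<in> V" "0 < (r::real)"
    thus "\<exists>y\<in>T. N (x - y) < r" using no by blast
  qed simp
  then obtain x where x: "x \<in> V" "\<And>k. x \<notin> F k" by auto
  thus False using assms(1) by (meson UN_E in_mono)
qed

end

section \<open>Countable boundaries of separable polyhedral spaces\<close>

context normed_subspace
begin

lemma norm_line_convex:
  assumes "x \<in> V" "h \<in> V"
  shows "convex_on UNIV (\<lambda>s. N (x + s *\<^sub>R h))"
proof (rule convex_onI)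
  fix t s s' :: real assume t: "0 < t" "t < 1"
  have "N (x + ((1 - t) *\<^sub>R s + t *\<^sub>R s') *\<^sub>R h)
      = N ((1 - t) *\<^sub>R (x + s *\<^sub>R h) + t *\<^sub>R (x + s' *\<^sub>R h))"
    by (rule arg_cong[of _ _ N]) (simp add: algebra_simps)
  also have "\<dots> \<le> N ((1 - t) *\<^sub>R (x + s *\<^sub>R h)) + N (t *\<^sub>R (x + s' *\<^sub>R h))"
    using assms by (intro norm_triangle) auto
  also have "\<dots> = (1 - t) * N (x + s *\<^sub>R h) + t * N (x + s' *\<^sub>R h)"
    using assms t by (simp add: norm_scale)
  finally show "N (x + ((1 - t) *\<^sub>R s + t *\<^sub>R s') *\<^sub>R h) \<le> \<dots>" .
qed auto

text \<open>
  Write \<open>x + s h\<close> as a nonnegative combination, with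
  coefficients of sum \<open>N (x + s h)\<close>, of the finitely many vertices of the ball of the span of
  \<open>x\<close>, \<open>h\<close>. Infinitely many \<open>s = 1/(j+1)\<close> use the same set of vertices. Between two of
  them the norm is affine, since the combination can be extrapolated slightly.
\<close>

lemma polyhedral_affine:
  assumes poly: "polyhedral_on V N" and x: "x \<in> V" and h: "h \<in> V"
  shows "\<exists>s0>0. \<exists>a. \<forall>s\<in>{0..s0}. N (x + s *\<^sub>R h) = N x + s * a"
proof -
  define F where "F = span {x, h}"
  define \<phi> where "\<phi> = (\<lambda>s. N (x + s *\<^sub>R h))"
  have FV: "F \<subseteq> V" unfolding F_def using x h subspace_V by (simp add: span_minimal)
  have "polytope {z \<in> F. N z \<le> 1}"
    using poly FV unfolding polyhedral_on_def F_def finite_dim_def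
    by (metis finite.emptyI finite.insertI subspace_span)
  then obtain S where S: "finite S" "{z \<in> F. N z \<le> 1} = convex hull S"
    by (auto simp: polytope_def)
  have SV: "v \<in> V" "N v \<le> 1" if "v \<in> S" for v
    using that S(2) hull_subset[of S convex] FV by blast+
  have inF: "x + s *\<^sub>R h \<in> F" for s
    unfolding F_def by (intro span_add span_scale span_base) auto
  have \<phi>0: "\<phi> s \<ge> 0" for s unfolding \<phi>_def using inF FV norm_ge_0 by blast
  have rep: "\<exists>l. (\<forall>v\<in>S. 0 \<le> l v) \<and> sum l S = \<phi> s \<and> (\<Sum>v\<in>S. l v *\<^sub>R v) = x + s *\<^sub>R h" for s
  proof (cases "\<phi> s = 0")
    case True
    hence "x + s *\<^sub>R h = 0" using inF FV norm_eq_0 unfolding \<phi>_def by blast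
    thus ?thesis using True by (intro exI[of _ "\<lambda>_. 0"]) simp
  next
    case False
    define b where "b = (1 / \<phi> s) *\<^sub>R (x + s *\<^sub>R h)"
    have "b \<in> F" unfolding b_def F_def by (intro span_scale span_add span_base) auto
    moreover have "N b = 1"
      using False \<phi>0[of s] x h unfolding b_def \<phi>_def by (simp add: norm_scale)
    ultimately have "b \<in> convex hull S" unfolding S(2)[symmetric] by simp
    then obtain u where u: "\<forall>v\<in>S. 0 \<le> u v" "sum u S = 1" "(\<Sum>v\<in>S. u v *\<^sub>R v) = b"
      unfolding convex_hull_finite[OF S(1)] by auto
    have "(\<Sum>v\<in>S. (\<phi> s * u v) *\<^sub>R v) = \<phi> s *\<^sub>R b"
      unfolding u(3)[symmetric] by (simp add: scaleR_sum_right)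
    also have "\<dots> = x + s *\<^sub>R h" using False by (simp add: b_def)
    finally show ?thesis
      using u \<phi>0[of s] by (intro exI[of _ "\<lambda>v. \<phi> s * u v"]) (auto simp: sum_distrib_left[symmetric])
  qed
  then obtain l where l: "\<And>s v. v \<in> S \<Longrightarrow> 0 \<le> l s v" "\<And>s. sum (l s) S = \<phi> s"
    "\<And>s. (\<Sum>v\<in>S. l s v *\<^sub>R v) = x + s *\<^sub>R h" by metis
  \<comment> \<open>The vertices have norm at most 1, so every nonnegative representation bounds the
    norm from above by its total weight; the chosen \<open>l s\<close> gives equality.\<close>
  have upper: "\<phi> s \<le> sum c S" if "\<forall>v\<in>S. 0 \<le> c v" "(\<Sum>v\<in>S. c v *\<^sub>R v) = x + s *\<^sub>R h" for s c
  proof -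
    have "\<phi> s \<le> (\<Sum>v\<in>S. N (c v *\<^sub>R v))"
      unfolding \<phi>_def that(2)[symmetric] using SV by (intro norm_sum) auto
    also have "\<dots> \<le> sum c S"
      using that SV by (intro sum_mono) (simp add: norm_scale mult_left_le)
    finally show ?thesis .
  qed
  define A where "A = (\<lambda>j::nat. {v\<in>S. l (1 / real (Suc j)) v > 0})"
  have "finite (range A)"
    by (rule finite_subset[of _ "Pow S"]) (use S(1) in \<open>auto simp: A_def\<close>)
  then obtain j0 where j0: "infinite {j. A j = A j0}"
    using pigeonhole_infinite[of "UNIV::nat set" A] by auto
  have conv: "convex_on UNIV \<phi>" unfolding \<phi>_def using norm_line_convex[OF x h] .
  have aff: "\<phi> \<sigma> = \<phi> s + (\<sigma> - s) * ((\<phi> s' - \<phi> s) / (s' - s))"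
    if ss: "s < s'" "s \<le> \<sigma>" "\<sigma> \<le> s'" "{v\<in>S. l s v > 0} = {v\<in>S. l s' v > 0}" for s s' \<sigma>
  proof -
    define d where "d = s' - s"
    have d: "d > 0" using ss d_def by simp
    define b where "b = (\<phi> s' - \<phi> s) / d"
    have "\<exists>e>0. \<forall>v\<in>S. 0 \<le> l s v - e * (l s' v - l s v)"
    proof -
      have "\<exists>e>0. 0 \<le> l s v - e * (l s' v - l s v) \<and> (\<forall>e'. 0 < e' \<and> e' \<le> e \<longrightarrow>
              0 \<le> l s v - e' * (l s' v - l s v))" if v: "v \<in> S" for v
      proof (cases "l s v > 0")
        case True
        define e where "e = l s v / (1 + \<bar>l s' v - l s v\<bar>)"
        have "e > 0" unfolding e_def using True by simp
        moreover have "0 \<le> l s v - e' * (l s' v - l s v)" if "0 < e'" "e' \<le> e" for e'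
        proof -
          have "e' * (l s' v - l s v) \<le> e' * (1 + \<bar>l s' v - l s v\<bar>)"
            using that by (intro mult_left_mono) auto
          also have "\<dots> \<le> e * (1 + \<bar>l s' v - l s v\<bar>)"
            using that by (intro mult_right_mono) auto
          also have "\<dots> = l s v" unfolding e_def by simp
          finally show ?thesis by simp
        qed
        ultimately show ?thesis by blast
      next
        case False
        hence "l s v = 0" "l s' v = 0" using l(1)[OF v, of s] l(1)[OF v, of s'] ss(4) v by fastforce+
        thus ?thesis by (intro exI[of _ 1]) simp
      qed
      then obtain e where e: "\<And>v. v \<in> S \<Longrightarrow> e v > 0"
        "\<And>v e'. v \<in> S \<Longrightarrow> 0 < e' \<Longrightarrow> e' \<le> e v \<Longrightarrow> 0 \<le> l s v - e' * (l s' v - l s v)" by metis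
      show ?thesis
      proof (cases "S = {}")
        case False
        have "Min (e ` S) > 0" using e(1) S(1) False by (subst Min_gr_iff) auto
        moreover have "Min (e ` S) \<le> e v" if "v \<in> S" for v using that S(1) by auto
        ultimately show ?thesis using e(2) by blast
      qed (auto intro: exI[of _ 1])
    qed
    then obtain e where e: "e > 0" "\<forall>v\<in>S. 0 \<le> l s v - e * (l s' v - l s v)" by blast
    have "(\<Sum>v\<in>S. (l s v - e * (l s' v - l s v)) *\<^sub>R v)
        = (x + s *\<^sub>R h) - e *\<^sub>R ((x + s' *\<^sub>R h) - (x + s *\<^sub>R h))"
      unfolding l(3)[symmetric]
      by (simp add: scaleR_diff_left sum_subtractf scaleR_diff_right scaleR_sum_right
          right_diff_distrib)
    also have "\<dots> = x + (s - e * d) *\<^sub>R h" by (simp add: d_def algebra_simps)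
    finally have "\<phi> (s - e * d) \<le> sum (\<lambda>v. l s v - e * (l s' v - l s v)) S"
      by (rule upper[OF e(2)])
    also have "\<dots> = \<phi> s - e * (\<phi> s' - \<phi> s)"
      by (simp add: sum_subtractf l(2) sum_distrib_left[symmetric])
    finally have ext: "\<phi> (s - e * d) \<le> \<phi> s - e * d * b" using d by (simp add: b_def)
    have b: "\<phi> s' = \<phi> s + d * b" using d by (simp add: b_def)
    define r where "r = \<sigma> - s"
    have r: "0 \<le> r" "r \<le> d" "\<sigma> = s + r" using ss by (auto simp: r_def d_def)
    have "\<phi> \<sigma> \<le> \<phi> s + r * b"
    proof -
      have "\<phi> ((1 - r / d) *\<^sub>R s + (r / d) *\<^sub>R s') \<le> (1 - r / d) * \<phi> s + (r / d) * \<phi> s'"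
        using r d by (intro convex_onD[OF conv]) auto
      moreover have "(1 - r / d) *\<^sub>R s + (r / d) *\<^sub>R s' = \<sigma>"
      proof -
        have "(1 - r / d) *\<^sub>R s + (r / d) *\<^sub>R s' = s + (r / d) * (s' - s)"
          unfolding real_scaleR_def by algebra
        thus ?thesis using d r by (simp add: d_def)
      qed
      moreover have "(1 - r / d) * \<phi> s + (r / d) * \<phi> s' = \<phi> s + r * b"
        unfolding b using d by (simp add: field_simps)
      ultimately show ?thesis by simp
    qed
    \<comment> \<open>The point \<open>s\<close> lies between \<open>s - e * d\<close> and
      \<open>\<sigma>\<close>, with weight \<open>t\<close> at \<open>\<sigma>\<close>. A value at
      \<open>\<sigma>\<close> below the chord would, together with \<open>ext\<close> and convexity,
      push the value at \<open>s\<close> below itself.\<close>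
    moreover have "\<phi> \<sigma> \<ge> \<phi> s + r * b"
    proof -
      define t where "t = e * d / (e * d + r)"
      have pos: "e * d + r > 0" using e d r by (simp add: add_pos_nonneg)
      have t: "0 < t" "t \<le> 1" "t * (e * d + r) = e * d"
        using e d r pos by (auto simp: t_def)
      have t3: "(1 - t) * (e * d) = t * r" using t(3) by algebra
      have cv: "\<phi> ((1 - t) *\<^sub>R (s - e * d) + t *\<^sub>R \<sigma>) \<le> (1 - t) * \<phi> (s - e * d) + t * \<phi> \<sigma>"
        using t by (intro convex_onD[OF conv]) auto
      have st: "(1 - t) *\<^sub>R (s - e * d) + t *\<^sub>R \<sigma> = s"
        using t3 unfolding r(3) real_scaleR_def by algebra
      have "(1 - t) * \<phi> (s - e * d) \<le> (1 - t) * (\<phi> s - e * d * b)"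
        using ext t by (intro mult_left_mono) auto
      hence "\<phi> s \<le> (1 - t) * (\<phi> s - e * d * b) + t * \<phi> \<sigma>"
        using cv[unfolded st] by linarith
      also have "\<dots> = \<phi> s - t * \<phi> s - ((1 - t) * (e * d)) * b + t * \<phi> \<sigma>" by (simp add: algebra_simps)
      finally have "t * (\<phi> s + r * b) \<le> t * \<phi> \<sigma>" unfolding t3 by (simp add: algebra_simps)
      thus ?thesis using t(1) by simp
    qed
    ultimately show ?thesis by (simp add: b_def r_def d_def)
  qed
  define s0 where "s0 = 1 / real (Suc j0)"
  have s0: "s0 > 0" by (simp add: s0_def)
  obtain j1 where j1: "A j1 = A j0" "j1 > j0"
    using j0 unfolding infinite_nat_iff_unbounded by auto
  define s1 where "s1 = 1 / real (Suc j1)"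
  have s1: "0 < s1" "s1 < s0" using j1(2) by (auto simp: s1_def s0_def frac_less2)
  define a where "a = (\<phi> s0 - \<phi> s1) / (s0 - s1)"
  \<comment> \<open>Below \<open>s\<close> and \<open>s1\<close> there is a parameter
    \<open>r\<close> with the same vertex set as \<open>s0\<close>. The norm is affine on
    \<open>[r, s0]\<close>, and since \<open>s1\<close> lies in this interval the slope is always
    \<open>a\<close>, whatever \<open>r\<close> is.\<close>
  have main: "\<phi> s = \<phi> s0 + (s - s0) * a" if s: "0 < s" "s \<le> s0" for s
  proof -
    obtain n where n: "1 / real (Suc n) < min s s1"
      using reals_Archimedean[of "min s s1"] s s1 by (auto simp: inverse_eq_divide)
    obtain j where j: "A j = A j0" "j > n"
      using j0 unfolding infinite_nat_iff_unbounded by auto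
    define r where "r = 1 / real (Suc j)"
    have "r \<le> 1 / real (Suc n)" using j(2) by (auto simp: r_def frac_le)
    hence r: "r < s" "r < s1" using n by auto
    have same: "{v\<in>S. l r v > 0} = {v\<in>S. l s0 v > 0}"
      using j(1) by (simp add: A_def r_def s0_def)
    define b where "b = (\<phi> s0 - \<phi> r) / (s0 - r)"
    have 1: "\<phi> \<sigma> = \<phi> r + (\<sigma> - r) * b" if "r \<le> \<sigma>" "\<sigma> \<le> s0" for \<sigma>
      unfolding b_def using aff[of r s0 \<sigma>] that same r s by auto
    have "\<phi> s0 - \<phi> s1 = (s0 - s1) * b"
      using 1[of s0] 1[of s1] r s1 by (simp add: algebra_simps)
    hence "a = b" using s1 by (simp add: a_def)
    thus ?thesis using 1[of s] 1[of s0] r s s1 by (simp add: algebra_simps)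
  qed
  \<comment> \<open>A convex function on the whole line is continuous, so the formula extends from
    positive parameters to 0.\<close>
  have "\<phi> 0 = \<phi> s0 - s0 * a"
  proof -
    have "continuous_on UNIV \<phi>"
      using conv by (intro convex_on_continuous) auto
    hence "isCont \<phi> 0"
      by (simp add: continuous_on_eq_continuous_at)
    hence "(\<phi> \<longlongrightarrow> \<phi> 0) (at 0)" unfolding isCont_def .
    hence lim: "(\<phi> \<longlongrightarrow> \<phi> 0) (at_right 0)"
      unfolding filterlim_at_split by simp
    have "((\<lambda>s. \<phi> s0 + (s - s0) * a) \<longlongrightarrow> \<phi> s0 + (0 - s0) * a) (at_right 0)"
      by (intro tendsto_intros)
    moreover have "\<forall>\<^sub>F s in at_right 0. \<phi> s0 + (s - s0) * a = \<phi> s"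
      unfolding eventually_at_right_field
      by (intro exI[of _ s0] conjI allI impI s0 main[symmetric]) auto
    ultimately have "(\<phi> \<longlongrightarrow> \<phi> s0 + (0 - s0) * a) (at_right 0)"
      by (rule Lim_transform_eventually)
    from tendsto_unique[OF trivial_limit_at_right_real lim this] show ?thesis by simp
  qed
  hence "\<phi> s = \<phi> 0 + s * a" if "s \<in> {0..s0}" for s
    using main[of s] that by (cases "s = 0") (auto simp: algebra_simps)
  thus ?thesis using s0 unfolding \<phi>_def by (intro exI[of _ s0]) auto
qed

text \<open>The one-sided directional derivative of the norm. For a polyhedral norm the difference
  quotient is constant near 0, so no limit is taken.\<close>

definition slope :: "'a \<Rightarrow> 'a \<Rightarrow> real"
  where "slope z h = (THE a. \<exists>s0>0. \<forall>s\<in>{0..s0}. N (z + s *\<^sub>R h) = N z + s * a)"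

lemma slope_eqI:
  assumes "s0 > 0" "\<And>s. 0 \<le> s \<Longrightarrow> s \<le> s0 \<Longrightarrow> N (z + s *\<^sub>R h) = N z + s * a"
  shows "slope z h = a"
  unfolding slope_def
proof (rule the_equality)
  fix b assume "\<exists>s0>0. \<forall>s\<in>{0..s0}. N (z + s *\<^sub>R h) = N z + s * b"
  then obtain s1 where s1: "s1 > 0" "\<And>s. 0 \<le> s \<Longrightarrow> s \<le> s1 \<Longrightarrow> N (z + s *\<^sub>R h) = N z + s * b"
    by auto
  define s where "s = min s0 s1"
  have "s > 0" "N z + s * b = N z + s * a"
    using assms s1(1) s1(2)[of s] by (auto simp: s_def)
  thus "b = a" by simp
qed (use assms in auto)

text \<open>
  For dense \<open>d\<close> these are the points of smoothness of a polyhedral norm.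
\<close>

definition smooth_pts :: "(nat \<Rightarrow> 'a) \<Rightarrow> 'a set"
  where "smooth_pts d = {z\<in>V. \<forall>n m. \<exists>s>0.
    N (z + s *\<^sub>R d n) + N (z - s *\<^sub>R d n) - 2 * N z < s / real (Suc m)}"

end

section \<open>Directional derivatives of a polyhedral norm and their countability\<close>

locale polyhedral_space = banach_subspace +
  fixes d :: "nat \<Rightarrow> 'a"
  assumes polyhedral: "polyhedral_on V N"
    and d_mem: "\<And>n. d n \<in> V"
    and d_dense: "\<And>x \<epsilon>. x \<in> V \<Longrightarrow> \<epsilon> > 0 \<Longrightarrow> \<exists>n. N (x - d n) < \<epsilon>"
begin

lemma slope:
  assumes "z \<in> V" "h \<in> V"
  obtains s0 where "s0 > 0" "\<And>s. 0 \<le> s \<Longrightarrow> s \<le> s0 \<Longrightarrow> N (z + s *\<^sub>R h) = N z + s * slope z h"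
proof -
  obtain s0 a where s0: "s0 > 0" "\<forall>s\<in>{0..s0}. N (z + s *\<^sub>R h) = N z + s * a"
    using polyhedral_affine[OF polyhedral assms] by blast
  moreover have "slope z h = a" by (rule slope_eqI[of s0]) (use s0 in auto)
  ultimately show ?thesis by (intro that[of s0]) auto
qed

text \<open>A convex function lies above the extension of its initial affine piece; \<open>t\<close>
  shrinks \<open>s\<close> into that piece.\<close>

lemma slope_le:
  assumes "z \<in> V" "h \<in> V" "s \<ge> 0"
  shows "N z + s * slope z h \<le> N (z + s *\<^sub>R h)"
proof (cases "s = 0")
  case False
  obtain s0 where s0: "s0 > 0" "\<And>s. 0 \<le> s \<Longrightarrow> s \<le> s0 \<Longrightarrow> N (z + s *\<^sub>R h) = N z + s * slope z h"
    using slope assms by blast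
  define t where "t = min 1 (s0 / s)"
  have t: "0 < t" "t \<le> 1" "t * s \<le> s0"
    using False assms s0(1) by (auto simp: t_def min_def field_simps)
  have "N (z + ((1 - t) *\<^sub>R 0 + t *\<^sub>R s) *\<^sub>R h) \<le> (1 - t) * N (z + 0 *\<^sub>R h) + t * N (z + s *\<^sub>R h)"
    using t by (intro convex_onD[OF norm_line_convex]) (use assms in auto)
  moreover have "N (z + (t * s) *\<^sub>R h) = N z + t * s * slope z h"
    using t assms by (intro s0(2)) auto
  ultimately have "t * (N z + s * slope z h) \<le> t * N (z + s *\<^sub>R h)" by (simp add: algebra_simps)
  thus ?thesis using t(1) by simp
qed simp

text \<open>\<open>z + s (h + k)\<close> is the midpoint of \<open>z + 2 s h\<close> and
  \<open>z + 2 s k\<close>, which for small \<open>s\<close> lie on the two initial affine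
  pieces.\<close>

lemma slope_add:
  assumes "z \<in> V" "h \<in> V" "k \<in> V"
  shows "slope z (h + k) \<le> slope z h + slope z k"
proof -
  obtain s1 where s1: "s1 > 0" "\<And>s. 0 \<le> s \<Longrightarrow> s \<le> s1 \<Longrightarrow> N (z + s *\<^sub>R h) = N z + s * slope z h"
    using slope assms by blast
  obtain s2 where s2: "s2 > 0" "\<And>s. 0 \<le> s \<Longrightarrow> s \<le> s2 \<Longrightarrow> N (z + s *\<^sub>R k) = N z + s * slope z k"
    using slope assms by blast
  define s where "s = min s1 s2 / 2"
  have s: "s > 0" "2 * s \<le> s1" "2 * s \<le> s2" using s1 s2 by (auto simp: s_def)
  have "N z + s * slope z (h + k) \<le> N (z + s *\<^sub>R (h + k))"
    using assms s by (intro slope_le) auto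
  also have "z + s *\<^sub>R (h + k) = (1/2) *\<^sub>R (z + (2 * s) *\<^sub>R h) + (1/2) *\<^sub>R (z + (2 * s) *\<^sub>R k)"
    by (simp add: scaleR_add_right algebra_simps flip: scaleR_add_left)
  also have "N \<dots> \<le> N ((1/2) *\<^sub>R (z + (2 * s) *\<^sub>R h)) + N ((1/2) *\<^sub>R (z + (2 * s) *\<^sub>R k))"
    using assms by (intro norm_triangle) auto
  also have "\<dots> = (1/2) * N (z + (2 * s) *\<^sub>R h) + (1/2) * N (z + (2 * s) *\<^sub>R k)"
    using assms by (simp add: norm_scale)
  also have "\<dots> = N z + s * (slope z h + slope z k)"
    using s s1(2)[of "2 * s"] s2(2)[of "2 * s"] by (simp add: algebra_simps)
  finally show ?thesis using s(1) by simp
qed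

lemma slope_scale:
  assumes "z \<in> V" "h \<in> V" "c \<ge> 0"
  shows "slope z (c *\<^sub>R h) = c * slope z h"
proof -
  obtain s0 where s0: "s0 > 0" "\<And>s. 0 \<le> s \<Longrightarrow> s \<le> s0 \<Longrightarrow> N (z + s *\<^sub>R h) = N z + s * slope z h"
    using slope assms by blast
  show ?thesis
  proof (rule slope_eqI)
    show "s0 / (c + 1) > 0" using s0 assms by simp
    fix s assume s: "0 \<le> s" "s \<le> s0 / (c + 1)"
    have "s * c \<le> s * (c + 1)" using s by (simp add: mult_left_mono)
    also have "\<dots> \<le> s0" using s assms by (simp add: field_simps)
    finally show "N (z + s *\<^sub>R c *\<^sub>R h) = N z + s * (c * slope z h)"
      using s0(2)[of "s * c"] s assms by simp
  qed
qed

lemma slope_bound: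
  assumes "z \<in> V" "h \<in> V"
  shows "slope z h \<le> N h"
proof -
  obtain s0 where s0: "s0 > 0" "\<And>s. 0 \<le> s \<Longrightarrow> s \<le> s0 \<Longrightarrow> N (z + s *\<^sub>R h) = N z + s * slope z h"
    using slope assms by blast
  have "N z + s0 * slope z h \<le> N z + s0 * N h"
    using s0 norm_triangle[of z "s0 *\<^sub>R h"] assms by (simp add: norm_scale)
  thus ?thesis using s0(1) by simp
qed

lemma slope_minus_ge:
  assumes "z \<in> V" "h \<in> V"
  shows "0 \<le> slope z h + slope z (- h)"
proof -
  have "slope z 0 = 0" by (rule slope_eqI[of 1]) auto
  thus ?thesis using slope_add[of z h "- h"] assms by simp
qed

lemma slope_self:
  assumes "z \<in> V"
  shows "slope z z = N z"
proof (rule slope_eqI[of 1])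
  fix s :: real assume "0 \<le> s"
  moreover have "N (z + s *\<^sub>R z) = N ((1 + s) *\<^sub>R z)" by (simp add: scaleR_add_left)
  ultimately show "N (z + s *\<^sub>R z) = N z + s * N z"
    using assms by (simp add: norm_scale distrib_right)
qed simp

text \<open>Smoothness bounds the sum of the slopes in the directions \<open>d n\<close> and
  \<open>- d n\<close> by every \<open>1 / (m + 1)\<close>. Slopes change by at most the norm of the
  change of direction, so density of \<open>d\<close> settles all directions.\<close>

lemma slope_minus:
  assumes z: "z \<in> smooth_pts d" and h: "h \<in> V"
  shows "slope z (- h) = - slope z h"
proof -
  have zV: "z \<in> V" using z by (simp add: smooth_pts_def)
  have d: "slope z (d n) + slope z (- d n) \<le> 0" for n
  proof (rule field_le_epsilon)
    fix e :: real assume "e > 0"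
    then obtain m where m: "1 / real (Suc m) < e" using nat_approx_posE by blast
    obtain s where s: "s > 0" "N (z + s *\<^sub>R d n) + N (z - s *\<^sub>R d n) - 2 * N z < s / real (Suc m)"
      using z unfolding smooth_pts_def by blast
    have "s * (slope z (d n) + slope z (- d n)) < s * (1 / real (Suc m))"
      using s slope_le[OF zV d_mem, of s n] slope_le[of z "- d n" s] zV d_mem
      by (simp add: algebra_simps)
    hence "slope z (d n) + slope z (- d n) < 1 / real (Suc m)" using s(1) mult_less_cancel_left_pos by blast
    thus "slope z (d n) + slope z (- d n) \<le> 0 + e" using m by linarith
  qed
  have "slope z h + slope z (- h) \<le> 0"
  proof (rule field_le_epsilon)
    fix e :: real assume "e > 0"
    then obtain n where n: "N (h - d n) < e / 2" using d_dense[OF h, of "e / 2"] by auto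
    have "slope z h \<le> slope z (d n) + N (h - d n)"
      using slope_add[of z "d n" "h - d n"] slope_bound[of z "h - d n"] zV h d_mem by auto
    moreover have "slope z (- h) \<le> slope z (- d n) + N (- (h - d n))"
      using slope_add[of z "- d n" "- (h - d n)"] slope_bound[of z "- (h - d n)"] zV h d_mem[of n]
      by auto
    ultimately show "slope z h + slope z (- h) \<le> 0 + e"
      using d[of n] n norm_minus[of "h - d n"] h d_mem[of n] by simp
  qed
  thus ?thesis using slope_minus_ge[OF zV h] by simp
qed

lemma slope_linear:
  assumes z: "z \<in> smooth_pts d"
  shows "linear_on V (slope z)"
proof -
  have zV: "z \<in> V" using z by (simp add: smooth_pts_def)
  have 1: "slope z (h + k) = slope z h + slope z k" if "h \<in> V" "k \<in> V" for h k
  proof (rule antisym)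
    have "slope z (- h + - k) \<le> slope z (- h) + slope z (- k)"
      using that zV by (intro slope_add) auto
    moreover have "slope z (- h + - k) = - slope z (h + k)"
      using slope_minus[OF z, of "h + k"] that by simp
    ultimately show "slope z h + slope z k \<le> slope z (h + k)"
      using slope_minus[OF z] that by simp
  qed (use slope_add zV that in auto)
  have 2: "slope z (c *\<^sub>R h) = c * slope z h" if "h \<in> V" for h c
  proof (cases "c \<ge> 0")
    case False
    have "slope z (c *\<^sub>R h) = slope z (- ((- c) *\<^sub>R h))" by simp
    also have "\<dots> = - slope z ((- c) *\<^sub>R h)" using that by (intro slope_minus[OF z]) auto
    also have "\<dots> = c * slope z h" using that False zV by (subst slope_scale) auto
    finally show ?thesis .
  qed (use slope_scale zV that in auto)
  show ?thesis unfolding linear_on_def using 1 2 by auto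
qed

lemma slope_abs_le:
  assumes z: "z \<in> smooth_pts d" and h: "h \<in> V"
  shows "\<bar>slope z h\<bar> \<le> N h"
proof -
  have zV: "z \<in> V" using z by (simp add: smooth_pts_def)
  show ?thesis
    using slope_bound[OF zV h] slope_bound[OF zV, of "- h"] slope_minus[OF z h] norm_minus[OF h] h by auto
qed

text \<open>
  A generic ray from \<open>x\<close> meets the smooth points arbitrarily close to \<open>x\<close>. The norm is affine on an
  initial piece of the ray, so its derivative at such a point norms \<open>x\<close> as well.
\<close>

lemma smooth_norming:
  assumes x: "x \<in> V"
  shows "\<exists>z\<in>smooth_pts d. slope z x = N x"
proof -
  \<comment> \<open>The symmetric second difference of the norm, by which \<open>smooth_pts\<close>
    is defined.\<close>
  define \<Delta> where "\<Delta> = (\<lambda>z h. N (z + h) + N (z - h) - 2 * N z)"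
  \<comment> \<open>The directions \<open>h\<close> for which the point at parameter
    \<open>1 / (k + 1)\<close> of the ray from \<open>x\<close> passes test \<open>(n, m)\<close> of
    smoothness. These countably many sets are open and dense, so one direction passes all tests for
    all \<open>k\<close> at once.\<close>
  define O' where "O' = (\<lambda>(k, n, m). {h\<in>V. \<exists>s>0. \<Delta> (x + (1 / real (Suc k)) *\<^sub>R h) (s *\<^sub>R d n) < s / real (Suc m)})"
  have \<Delta>_Lipschitz: "\<Delta> z' h \<le> \<Delta> z h + 4 * N (z - z')" if "z \<in> V" "z' \<in> V" "h \<in> V" for z z' h
  proof -
    have "N (z' + h) \<le> N (z + h) + N (z - z')"
      using norm_triangle_diff[of "z' + h" "z + h"] norm_diff_commute[of z z'] that by auto
    moreover have "N (z' - h) \<le> N (z - h) + N (z - z')"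
      using norm_triangle_diff[of "z' - h" "z - h"] norm_diff_commute[of z z'] that by auto
    moreover have "N z \<le> N z' + N (z - z')"
      using norm_triangle_diff[of z z'] that by auto
    ultimately show ?thesis by (simp add: \<Delta>_def)
  qed
  have "\<exists>h\<in>V. \<forall>T\<in>range O'. h \<in> T"
  proof (rule Baire_dense)
    fix T h assume "T \<in> range O'" "h \<in> T"
    then obtain k n m s where T: "T = O' (k, n, m)" and h: "h \<in> V" "s > 0"
      and lt: "\<Delta> (x + (1 / real (Suc k)) *\<^sub>R h) (s *\<^sub>R d n) < s / real (Suc m)"
      by (auto simp: O'_def)
    define e where "e = s / real (Suc m) - \<Delta> (x + (1 / real (Suc k)) *\<^sub>R h) (s *\<^sub>R d n)"
    have e: "e > 0" using lt by (simp add: e_def)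
    have "y \<in> T" if y: "y \<in> V" "N (h - y) < e / 4" for y
    proof -
      have "\<Delta> (x + (1 / real (Suc k)) *\<^sub>R y) (s *\<^sub>R d n) \<le> \<Delta> (x + (1 / real (Suc k)) *\<^sub>R h) (s *\<^sub>R d n)
          + 4 * N ((x + (1 / real (Suc k)) *\<^sub>R h) - (x + (1 / real (Suc k)) *\<^sub>R y))"
        using x y h d_mem by (intro \<Delta>_Lipschitz) auto
      moreover have "(x + (1 / real (Suc k)) *\<^sub>R h) - (x + (1 / real (Suc k)) *\<^sub>R y) = (1 / real (Suc k)) *\<^sub>R (h - y)"
        by (simp add: scaleR_diff_right)
      moreover have "N ((1 / real (Suc k)) *\<^sub>R (h - y)) = (1 / real (Suc k)) * N (h - y)"
        using y h by (subst norm_scale) auto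
      moreover have "(1 / real (Suc k)) * N (h - y) \<le> 1 * N (h - y)"
        using y h by (intro mult_right_mono norm_ge_0) auto
      ultimately have "\<Delta> (x + (1 / real (Suc k)) *\<^sub>R y) (s *\<^sub>R d n) < s / real (Suc m)"
        using y(2) e_def by auto
      thus ?thesis using T y h by (auto simp: O'_def)
    qed
    thus "h \<in> V \<and> (\<exists>r>0. \<forall>y\<in>V. N (h - y) < r \<longrightarrow> y \<in> T)"
      using h e by (intro conjI exI[of _ "e / 4"]) auto
  next
    fix T h and r :: real assume "T \<in> range O'" and h: "h \<in> V" and r: "r > 0"
    then obtain k n m where T: "T = O' (k, n, m)" by auto
    define z where "z = x + (1 / real (Suc k)) *\<^sub>R h"
    have z: "z \<in> V" using x h by (simp add: z_def)
    obtain s0 where s0: "s0 > 0" "\<And>s. 0 \<le> s \<Longrightarrow> s \<le> s0 \<Longrightarrow> N (z + s *\<^sub>R d n) = N z + s * slope z (d n)"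
      using slope[OF z d_mem] by blast
    define c where "c = real (Suc k) * (N (d n) + 1)"
    have c: "c > 0" using norm_ge_0[OF d_mem, of n] by (simp add: c_def add_nonneg_pos)
    \<comment> \<open>Moving from \<open>z\<close> by \<open>s\<close> in direction
      \<open>d n\<close> reaches the middle of a segment on which the norm is affine, where the
      second difference vanishes. The second bound keeps the corresponding direction
      \<open>y\<close> within \<open>r\<close> of \<open>h\<close>.\<close>
    define s where "s = min (s0 / 2) (r / (2 * c))"
    have s: "s > 0" "2 * s \<le> s0" "s * c < r"
    proof -
      show "s > 0" "2 * s \<le> s0" using s0 r c by (auto simp: s_def)
      have "s * c \<le> r / (2 * c) * c" using c by (intro mult_right_mono) (auto simp: s_def)
      thus "s * c < r" using c r by simp
    qed
    define y where "y = h + (real (Suc k) * s) *\<^sub>R d n"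
    have y1: "x + (1 / real (Suc k)) *\<^sub>R y = z + s *\<^sub>R d n"
      unfolding y_def z_def scaleR_add_right scaleR_scaleR by simp
    have y2: "z + s *\<^sub>R d n + s *\<^sub>R d n = z + (2 * s) *\<^sub>R d n"
      unfolding mult_2 scaleR_add_left add.assoc ..
    have "\<Delta> (x + (1 / real (Suc k)) *\<^sub>R y) (s *\<^sub>R d n)
        = N (z + (2 * s) *\<^sub>R d n) + N z - 2 * N (z + s *\<^sub>R d n)"
      unfolding \<Delta>_def y1 y2 add_diff_cancel_right' ..
    also have "\<dots> = 0" using s0(2)[of s] s0(2)[of "2 * s"] s by simp
    also have "\<dots> < s / real (Suc m)" using s by simp
    finally have "y \<in> T" using s h d_mem unfolding T O'_def y_def by auto
    moreover have "N (h - y) < r"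
    proof -
      have "h - y = (- (real (Suc k) * s)) *\<^sub>R d n" by (simp add: y_def)
      hence "N (h - y) = \<bar>- (real (Suc k) * s)\<bar> * N (d n)"
        by (simp only: norm_scale[OF d_mem])
      also have "\<dots> = real (Suc k) * s * N (d n)" using s by (simp add: abs_mult)
      also have "\<dots> \<le> s * c" using s by (simp add: c_def algebra_simps)
      finally show ?thesis using s by simp
    qed
    ultimately show "\<exists>y\<in>T. N (h - y) < r" by blast
  qed auto
  then obtain h where "h \<in> V" and O': "\<forall>T\<in>range O'. h \<in> T" ..
  hence h: "h \<in> V" "\<And>k n m. h \<in> O' (k, n, m)" using bspec[OF O' rangeI] by auto
  have sm: "x + (1 / real (Suc k)) *\<^sub>R h \<in> smooth_pts d" for k
    using h x unfolding smooth_pts_def O'_def \<Delta>_def by auto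
  obtain s0 where s0: "s0 > 0" "\<And>s. 0 \<le> s \<Longrightarrow> s \<le> s0 \<Longrightarrow> N (x + s *\<^sub>R h) = N x + s * slope x h"
    using slope[OF x h(1)] by blast
  obtain k where k: "1 / real (Suc k) < s0" using nat_approx_posE[OF s0(1)] by blast
  define s1 where "s1 = 1 / real (Suc k)"
  have s1: "0 < s1" "s1 < s0" using k by (auto simp: s1_def)
  define z where "z = x + s1 *\<^sub>R h"
  have z: "z \<in> smooth_pts d" using sm by (simp add: z_def s1_def)
  have zV: "z \<in> V" using z by (simp add: smooth_pts_def)
  have Nz: "N z = N x + s1 * slope x h" using s0(2)[of s1] s1 by (simp add: z_def)
  have "slope z h = slope x h"
  proof (rule slope_eqI)
    fix s assume "0 \<le> s" "s \<le> s0 - s1"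
    hence "N (x + (s1 + s) *\<^sub>R h) = N x + (s1 + s) * slope x h"
      using s1 by (intro s0(2)) auto
    thus "N (z + s *\<^sub>R h) = N z + s * slope x h"
      unfolding Nz by (simp add: z_def scaleR_add_left add.assoc algebra_simps)
  qed (use s1 in auto)
  \<comment> \<open>Linearity of the derivative at the smooth point \<open>z\<close> allows going
    back along the ray from \<open>z\<close> to \<open>x\<close>; the norm decreases by the same
    affine rule, so the derivative attains the norm at \<open>x\<close>.\<close>
  moreover have "slope z (z - s1 *\<^sub>R h) = slope z z - s1 * slope z h"
    using linear_on_simps(2,3)[OF slope_linear[OF z]] zV h by simp
  ultimately have "slope z x = N z - s1 * slope x h"
    using slope_self[OF zV] by (simp add: z_def)
  thus ?thesis using Nz z by auto
qed

text \<open>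
  The closed convex set on which the norm coincides with \<open>slope z\<close> contains a piece of every ray
  from \<open>z\<close>, hence it has interior points by Baire's theorem.
\<close>

lemma smooth_near_dense:
  assumes z: "z \<in> smooth_pts d"
  shows "\<exists>n. \<exists>r>0. \<forall>y\<in>V. N (d n - y) < r \<longrightarrow> slope z y = N y"
proof -
  have zV: "z \<in> V" using z by (simp add: smooth_pts_def)
  note lin = linear_on_simps[OF slope_linear[OF z]]
  have Lip: "\<bar>slope z v - slope z w\<bar> \<le> N (v - w)" if "v \<in> V" "w \<in> V" for v w
    using slope_abs_le[OF z, of "v - w"] lin(3) that by auto
  \<comment> \<open>\<open>h\<close> belongs to \<open>F k\<close> if the norm and its derivative at
    \<open>z\<close> still agree at parameter \<open>1 / (k + 1)\<close> of the ray in direction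
    \<open>h\<close>.\<close>
  define F where "F = (\<lambda>k. {h\<in>V. slope z (z + (1 / real (Suc k)) *\<^sub>R h) = N (z + (1 / real (Suc k)) *\<^sub>R h)})"
  have "\<exists>k. \<exists>x\<in>V. \<exists>r>0. \<forall>y\<in>V. N (x - y) < r \<longrightarrow> y \<in> F k"
  proof (rule Baire_union)
    show "V \<subseteq> (\<Union>k. F k)"
    proof
      fix h assume h: "h \<in> V"
      obtain s0 where s0: "s0 > 0" "\<And>s. 0 \<le> s \<Longrightarrow> s \<le> s0 \<Longrightarrow> N (z + s *\<^sub>R h) = N z + s * slope z h"
        using slope[OF zV h] by blast
      obtain k where k: "1 / real (Suc k) < s0" using nat_approx_posE[OF s0(1)] by blast
      have "slope z (z + (1 / real (Suc k)) *\<^sub>R h) = N z + (1 / real (Suc k)) * slope z h"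
        using lin(1,2) zV h slope_self[OF zV] by simp
      hence "h \<in> F k" using s0(2)[of "1 / real (Suc k)"] k h by (simp add: F_def)
      thus "h \<in> (\<Union>k. F k)" by blast
    qed
  next
    fix k h assume h: "h \<in> V" "h \<notin> F k"
    define c where "c = 1 / real (Suc k)"
    define e where "e = \<bar>N (z + c *\<^sub>R h) - slope z (z + c *\<^sub>R h)\<bar>"
    have e: "e > 0" using h by (simp add: F_def e_def c_def)
    have "y \<notin> F k" if y: "y \<in> V" "N (h - y) < e / 2" for y
    proof
      assume "y \<in> F k"
      hence eq: "slope z (z + c *\<^sub>R y) = N (z + c *\<^sub>R y)" by (simp add: F_def c_def)
      have "(z + c *\<^sub>R h) - (z + c *\<^sub>R y) = c *\<^sub>R (h - y)" by (simp add: scaleR_diff_right)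
      hence "N ((z + c *\<^sub>R h) - (z + c *\<^sub>R y)) = c * N (h - y)"
        using h y by (simp add: norm_scale c_def)
      also have "\<dots> \<le> 1 * N (h - y)" using h y by (intro mult_right_mono norm_ge_0) (auto simp: c_def)
      finally have 1: "N ((z + c *\<^sub>R h) - (z + c *\<^sub>R y)) < e / 2" using y by simp
      have 2: "\<bar>N (z + c *\<^sub>R h) - N (z + c *\<^sub>R y)\<bar> \<le> N ((z + c *\<^sub>R h) - (z + c *\<^sub>R y))"
        using norm_triangle_diff[of "z + c *\<^sub>R h" "z + c *\<^sub>R y"]
          norm_triangle_diff[of "z + c *\<^sub>R y" "z + c *\<^sub>R h"]
          norm_diff_commute[of "z + c *\<^sub>R h" "z + c *\<^sub>R y"] zV h y by simp
      have 3: "\<bar>slope z (z + c *\<^sub>R h) - slope z (z + c *\<^sub>R y)\<bar> \<le> N ((z + c *\<^sub>R h) - (z + c *\<^sub>R y))"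
        using zV h y by (intro Lip) auto
      have "e \<le> \<bar>N (z + c *\<^sub>R h) - N (z + c *\<^sub>R y)\<bar>
          + \<bar>slope z (z + c *\<^sub>R h) - slope z (z + c *\<^sub>R y)\<bar>"
        unfolding e_def using eq by arith
      thus False using 1 2 3 by linarith
    qed
    thus "\<exists>r>0. \<forall>y\<in>V. N (h - y) < r \<longrightarrow> y \<notin> F k" using e by (intro exI[of _ "e / 2"]) auto
  qed
  then obtain k h r where r: "h \<in> V" "r > 0" "\<And>y. y \<in> V \<Longrightarrow> N (h - y) < r \<Longrightarrow> y \<in> F k" by blast
  define c where "c = 1 / real (Suc k)"
  have c: "c > 0" by (simp add: c_def)
  \<comment> \<open>The homothety that maps \<open>h\<close> to \<open>z + c h\<close> turns the
    ball inside \<open>F k\<close> into a ball of radius \<open>c r\<close> on which norm and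
    derivative agree.\<close>
  have ball: "slope z y = N y" if y: "y \<in> V" "N (z + c *\<^sub>R h - y) < c * r" for y
  proof -
    have eq: "h - (1 / c) *\<^sub>R (y - z) = (1 / c) *\<^sub>R (z + c *\<^sub>R h - y)"
      using c by (simp add: scaleR_diff_right scaleR_add_right)
    have "N (h - (1 / c) *\<^sub>R (y - z)) = (1 / c) * N (z + c *\<^sub>R h - y)"
      unfolding eq using c y zV r by (subst norm_scale) auto
    also have "\<dots> < r" using y c by (simp add: field_simps)
    finally have "(1 / c) *\<^sub>R (y - z) \<in> F k" by (intro r(3)) (use y zV in auto)
    moreover have "z + c *\<^sub>R (1 / c) *\<^sub>R (y - z) = y" using c by simp
    ultimately show ?thesis unfolding F_def c_def[symmetric] by simp
  qed
  obtain n where n: "N (z + c *\<^sub>R h - d n) < c * r / 2"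
    using d_dense[of "z + c *\<^sub>R h" "c * r / 2"] zV r c by auto
  have "slope z y = N y" if y: "y \<in> V" "N (d n - y) < c * r / 2" for y
  proof (rule ball[OF y(1)])
    have "N ((z + c *\<^sub>R h - d n) + (d n - y)) \<le> N (z + c *\<^sub>R h - d n) + N (d n - y)"
      using zV r y d_mem by (intro norm_triangle) auto
    thus "N (z + c *\<^sub>R h - y) < c * r" using n y by simp
  qed
  thus ?thesis using c r by (intro exI[of _ n] exI[of _ "c * r / 2"]) auto
qed

text \<open>A functional that agrees with the norm on some ball around \<open>d n\<close> is
  determined by \<open>n\<close>. Every derivative at a smooth point is of this kind for some
  \<open>n\<close>, so choosing one for each \<open>n\<close> loses none of them.\<close>

theorem countable_boundary:
  obtains f :: "nat \<Rightarrow> 'a \<Rightarrow> real"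
  where "\<And>n. linear_on V (f n)" "\<And>n x. x \<in> V \<Longrightarrow> \<bar>f n x\<bar> \<le> N x" "\<And>x. x \<in> V \<Longrightarrow> \<exists>n. f n x = N x"
proof -
  define P where "P = (\<lambda>n z. z \<in> smooth_pts d \<and> (\<exists>r>0. \<forall>y\<in>V. N (d n - y) < r \<longrightarrow> slope z y = N y))"
  have uniq: "slope z x = slope z' x" if P: "P n z" "P n z'" and x: "x \<in> V" for n z z' x
  proof -
    have z: "z \<in> smooth_pts d" "z' \<in> smooth_pts d" using P by (auto simp: P_def)
    obtain r where r: "r > 0" "\<And>y. y \<in> V \<Longrightarrow> N (d n - y) < r \<Longrightarrow> slope z y = N y"
      using P(1) unfolding P_def by blast
    obtain r' where r': "r' > 0" "\<And>y. y \<in> V \<Longrightarrow> N (d n - y) < r' \<Longrightarrow> slope z' y = N y"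
      using P(2) unfolding P_def by blast
    \<comment> \<open>Small enough for \<open>d n + c x\<close> to lie in both balls; the difference
      with \<open>d n\<close> then recovers both functionals at \<open>x\<close>.\<close>
    define c where "c = min r r' / (N x + 1)"
    have Nx: "N x \<ge> 0" by (rule norm_ge_0[OF x])
    have c: "c > 0" using r r' Nx by (simp add: c_def)
    have "c * N x < c * (N x + 1)" using c by (simp add: algebra_simps)
    also have "\<dots> = min r r'" using Nx by (simp add: c_def)
    finally have "N (d n - (d n + c *\<^sub>R x)) < min r r'"
      using x c norm_minus[of "c *\<^sub>R x"] by (simp add: norm_scale)
    moreover have "N (d n - d n) < min r r'" using r r' by simp
    ultimately have "slope z (d n + c *\<^sub>R x) = slope z' (d n + c *\<^sub>R x)" "slope z (d n) = slope z' (d n)"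
      using r(2)[of "d n + c *\<^sub>R x"] r'(2)[of "d n + c *\<^sub>R x"] r(2)[of "d n"] r'(2)[of "d n"]
        x d_mem[of n] by auto
    hence "c * slope z x = c * slope z' x"
      using linear_on_simps(1,2)[OF slope_linear[OF z(1)]] linear_on_simps(1,2)[OF slope_linear[OF z(2)]]
        x d_mem by simp
    thus ?thesis using c by simp
  qed
  \<comment> \<open>Indices without a derivative get the zero functional, which satisfies the
    linearity and the bound trivially.\<close>
  define f where "f = (\<lambda>n x. if \<exists>z. P n z then slope (SOME z. P n z) x else 0)"
  have f: "\<exists>z\<in>smooth_pts d. f n = slope z" if "\<exists>z. P n z" for n
  proof -
    have "P n (SOME z. P n z)" using that by (rule someI_ex)
    thus ?thesis using that by (auto simp: f_def P_def)
  qed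
  show ?thesis
  proof (rule that)
    fix n
    show "linear_on V (f n)"
    proof (cases "\<exists>z. P n z")
      case True
      thus ?thesis using f slope_linear by metis
    qed (auto simp: f_def linear_on_def)
    fix x assume x: "x \<in> V"
    show "\<bar>f n x\<bar> \<le> N x"
    proof (cases "\<exists>z. P n z")
      case True
      thus ?thesis using f slope_abs_le x by metis
    qed (use norm_ge_0[OF x] in \<open>auto simp: f_def\<close>)
  next
    fix x assume x: "x \<in> V"
    then obtain z where z: "z \<in> smooth_pts d" "slope z x = N x" using smooth_norming by blast
    then obtain n where n: "P n z" using smooth_near_dense unfolding P_def by blast
    hence "P n (SOME z. P n z)" by (rule someI)
    from uniq[OF this n x] have "f n x = slope z x" using n unfolding f_def by (subst if_P) auto
    thus "\<exists>n. f n x = N x" unfolding z(2) ..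
  qed
qed

end

section \<open>Orlicz sequence spaces\<close>

locale orlicz =
  fixes M :: "real \<Rightarrow> real"
  assumes orlicz: "orlicz_function M"
begin

lemma M_0 [simp]: "M 0 = 0"
  using orlicz by (simp add: orlicz_function_def)

lemma M_mono: "0 \<le> s \<Longrightarrow> s \<le> t \<Longrightarrow> M s \<le> M t"
  using orlicz by (auto simp: orlicz_function_def mono_on_def)

lemma M_nonneg: "0 \<le> t \<Longrightarrow> 0 \<le> M t"
  using M_mono[of 0 t] by simp

lemma M_convex:
  assumes "0 \<le> t" "t \<le> 1" "0 \<le> x" "0 \<le> y"
  shows "M ((1 - t) * x + t * y) \<le> (1 - t) * M x + t * M y"
proof -
  have "convex_on {0..} M" using orlicz by (simp add: orlicz_function_def)
  from convex_onD[OF this assms(1,2), of x y] show ?thesis using assms by simp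
qed

lemma M_contract: "0 \<le> c \<Longrightarrow> c \<le> 1 \<Longrightarrow> 0 \<le> t \<Longrightarrow> M (c * t) \<le> c * M t"
  using M_convex[of c 0 t] by simp

lemma M_add_le:
  assumes "0 < r" "0 < s" "0 \<le> x" "0 \<le> y"
  shows "M ((x + y) / (r + s)) \<le> r / (r + s) * M (x / r) + s / (r + s) * M (y / s)"
proof -
  define t where "t = s / (r + s)"
  have t: "0 \<le> t" "t \<le> 1" "1 - t = r / (r + s)" using assms by (auto simp: t_def field_simps)
  have "(1 - t) * (x / r) + t * (y / s) = (x + y) / (r + s)"
    unfolding t(3) using assms by (simp add: t_def add_divide_distrib)
  thus ?thesis using M_convex[OF t(1,2), of "x / r" "y / s"] assms unfolding t(3) by (simp add: t_def)
qed

text \<open>\<open>M\<close> is not assumed to satisfy a doubling condition, so the factor 2 stays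
  inside the argument. This is harmless for sequences whose modular is summable at every
  scale.\<close>

lemma M_midpoint:
  assumes "0 \<le> x" "0 \<le> y"
  shows "M (x + y) \<le> M (2 * x) + M (2 * y)"
proof -
  have "M (x + y) \<le> M (2 * max x y)" using assms by (intro M_mono) auto
  also have "\<dots> \<le> M (2 * x) + M (2 * y)"
    using M_nonneg[of "2 * x"] M_nonneg[of "2 * y"] assms by (auto simp: max_def)
  finally show ?thesis .
qed

lemma M_large: "\<exists>T>0. M T > B"
proof -
  have "filterlim M at_top at_top" using orlicz by (simp add: orlicz_function_def)
  hence "\<forall>\<^sub>F t in at_top. M t > B" by (simp add: filterlim_at_top_dense)
  then obtain N where "\<forall>t\<ge>N. M t > B" by (auto simp: eventually_at_top_linorder)
  thus ?thesis by (intro exI[of _ "max N 1"]) auto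
qed

lemma M_small:
  assumes "e > 0"
  shows "\<exists>s>0. M s \<le> e"
proof -
  define c where "c = e / (e + M 1)"
  have "M 1 \<ge> 0" by (rule M_nonneg) simp
  hence c: "0 < c" "c \<le> 1" "c * M 1 \<le> e"
    using assms by (auto simp: c_def field_simps add_pos_nonneg)
  have "M (c * 1) \<le> c * M 1" using c by (intro M_contract) auto
  thus ?thesis using c by (intro exI[of _ c]) auto
qed

lemma M_tendsto:
  assumes "s \<longlonglongrightarrow> t" "\<And>k. 0 \<le> s k" "0 \<le> t"
  shows "(\<lambda>k. M (s k)) \<longlonglongrightarrow> M t"
proof -
  have "continuous_on {0..} M" using orlicz by (simp add: orlicz_function_def)
  from continuous_on_tendsto_compose[OF this assms(1)] show ?thesis using assms by simp
qed

lemma summable_M_add: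
  assumes c: "c > 0" and s: "summable (\<lambda>i. M (2 * c * \<bar>a i\<bar>))" "summable (\<lambda>i. M (2 * c * \<bar>b i\<bar>))"
    and le: "\<And>i. \<bar>x i\<bar> \<le> \<bar>a i\<bar> + \<bar>b i\<bar>"
  shows "summable (\<lambda>i. M (c * \<bar>x i\<bar>))"
proof (rule summable_comparison_test'[OF summable_add[OF s]])
  fix i
  have "M (c * \<bar>x i\<bar>) \<le> M (c * \<bar>a i\<bar> + c * \<bar>b i\<bar>)"
    unfolding distrib_left[symmetric] using c le by (intro M_mono mult_left_mono) auto
  also have "\<dots> \<le> M (2 * (c * \<bar>a i\<bar>)) + M (2 * (c * \<bar>b i\<bar>))"
    using c by (intro M_midpoint) auto
  finally show "norm (M (c * \<bar>x i\<bar>)) \<le> M (2 * c * \<bar>a i\<bar>) + M (2 * c * \<bar>b i\<bar>)"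
    using M_nonneg[of "c * \<bar>x i\<bar>"] c by (simp add: mult.assoc)
qed

text \<open>The condition under the infimum in the Luxemburg norm. Partial sums replace summability
  and the infinite sum, so that limits in \<open>r\<close> and in the coordinates can be taken
  inside finite sums.\<close>

definition bounded_by :: "real \<Rightarrow> (nat \<Rightarrow> real) \<Rightarrow> bool"
  where "bounded_by r a \<longleftrightarrow> 0 < r \<and> (\<forall>n. (\<Sum>i<n. M (\<bar>a i\<bar> / r)) \<le> 1)"

lemma bounded_by_iff:
  "bounded_by r a \<longleftrightarrow> 0 < r \<and> summable (\<lambda>n. M (\<bar>a n\<bar> / r)) \<and> (\<Sum>n. M (\<bar>a n\<bar> / r)) \<le> 1"
proof (cases "0 < r")
  case True
  have nonneg: "0 \<le> M (\<bar>a n\<bar> / r)" for n using True by (intro M_nonneg) auto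
  show ?thesis
  proof
    assume b: "bounded_by r a"
    have "summable (\<lambda>n. M (\<bar>a n\<bar> / r))"
      using b nonneg by (intro summableI_nonneg_bounded[of _ 1]) (auto simp: bounded_by_def)
    moreover from this have "(\<Sum>n. M (\<bar>a n\<bar> / r)) \<le> 1"
      using b by (intro suminf_le_const) (auto simp: bounded_by_def)
    ultimately show "0 < r \<and> summable (\<lambda>n. M (\<bar>a n\<bar> / r)) \<and> (\<Sum>n. M (\<bar>a n\<bar> / r)) \<le> 1"
      using True by blast
  next
    assume s: "0 < r \<and> summable (\<lambda>n. M (\<bar>a n\<bar> / r)) \<and> (\<Sum>n. M (\<bar>a n\<bar> / r)) \<le> 1"
    have "(\<Sum>i<n. M (\<bar>a i\<bar> / r)) \<le> (\<Sum>n. M (\<bar>a n\<bar> / r))" for n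
      using s nonneg by (intro sum_le_suminf) auto
    thus "bounded_by r a" unfolding bounded_by_def using s by (meson order_trans)
  qed
qed (simp add: bounded_by_def)

lemma bounded_by_mono:
  assumes "bounded_by r a" "r \<le> r'"
  shows "bounded_by r' a"
  unfolding bounded_by_def
proof (intro conjI allI)
  fix n
  have r: "r > 0" using assms by (simp add: bounded_by_def)
  thus "0 < r'" using assms by simp
  have "(\<Sum>i<n. M (\<bar>a i\<bar> / r')) \<le> (\<Sum>i<n. M (\<bar>a i\<bar> / r))"
    using r assms by (intro sum_mono M_mono divide_left_mono) auto
  also have "\<dots> \<le> 1" using assms by (simp add: bounded_by_def)
  finally show "(\<Sum>i<n. M (\<bar>a i\<bar> / r')) \<le> 1" .
qed

text \<open>Continuity of \<open>M\<close> lets the radius decrease to \<open>r\<close> in each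
  finite sum. Hence a positive infimum is attained, and norm bounds become equivalent to modular
  bounds.\<close>

lemma bounded_by_limit:
  assumes "r > 0" "\<And>r'. r' > r \<Longrightarrow> bounded_by r' a"
  shows "bounded_by r a"
  unfolding bounded_by_def
proof (intro conjI allI)
  fix n
  have "(\<lambda>k. r + 1 / real (Suc k)) \<longlonglongrightarrow> r + 0"
    by (intro tendsto_intros LIMSEQ_Suc[OF lim_1_over_n])
  hence "(\<lambda>k. \<Sum>i<n. M (\<bar>a i\<bar> / (r + 1 / real (Suc k)))) \<longlonglongrightarrow> (\<Sum>i<n. M (\<bar>a i\<bar> / r))"
    using assms(1) by (intro tendsto_sum M_tendsto tendsto_divide tendsto_const) auto
  moreover have "(\<Sum>i<n. M (\<bar>a i\<bar> / (r + 1 / real (Suc k)))) \<le> 1" for k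
    using assms(2)[of "r + 1 / real (Suc k)"] unfolding bounded_by_def by simp
  ultimately show "(\<Sum>i<n. M (\<bar>a i\<bar> / r)) \<le> 1"
    by (intro LIMSEQ_le_const2) auto
qed (fact assms(1))

text \<open>By \<open>M_contract\<close>, enlarging the radius by a factor \<open>s\<close> divides
  the modular at least by \<open>s\<close>, which brings any finite modular below 1.\<close>

lemma orlicz_space_iff: "a \<in> orlicz_space M \<longleftrightarrow> (\<exists>r. bounded_by r a)"
proof
  assume "a \<in> orlicz_space M"
  then obtain r where r: "r > 0" "summable (\<lambda>n. M (\<bar>a n\<bar> / r))" by (auto simp: orlicz_space_def)
  define s where "s = max 1 (\<Sum>n. M (\<bar>a n\<bar> / r))"
  have s: "s \<ge> 1" "(\<Sum>n. M (\<bar>a n\<bar> / r)) \<le> s" by (auto simp: s_def)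
  have "bounded_by (r * s) a"
    unfolding bounded_by_def
  proof (intro conjI allI)
    fix n
    have "(\<Sum>i<n. M (\<bar>a i\<bar> / (r * s))) \<le> (\<Sum>i<n. 1 / s * M (\<bar>a i\<bar> / r))"
    proof (rule sum_mono)
      fix i
      show "M (\<bar>a i\<bar> / (r * s)) \<le> 1 / s * M (\<bar>a i\<bar> / r)"
        using M_contract[of "1 / s" "\<bar>a i\<bar> / r"] s r by (simp add: mult.commute)
    qed
    also have "\<dots> = 1 / s * (\<Sum>i<n. M (\<bar>a i\<bar> / r))" by (simp add: sum_distrib_left)
    also have "\<dots> \<le> 1 / s * (\<Sum>n. M (\<bar>a n\<bar> / r))"
      using r s by (intro mult_left_mono sum_le_suminf) (auto intro: M_nonneg)
    also have "\<dots> \<le> 1 / s * s" using s by (intro mult_left_mono) auto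
    finally show "(\<Sum>i<n. M (\<bar>a i\<bar> / (r * s))) \<le> 1" using s by simp
  qed (use r s in simp)
  thus "\<exists>r. bounded_by r a" by blast
qed (auto simp: orlicz_space_def bounded_by_iff)

lemma orlicz_norm_eq: "orlicz_norm M a = Inf {r. bounded_by r a}"
  unfolding orlicz_norm_def bounded_by_iff ..

lemma orlicz_norm_le: "bounded_by r a \<Longrightarrow> orlicz_norm M a \<le> r"
  unfolding orlicz_norm_eq by (intro cInf_lower) (auto simp: bounded_by_def bdd_below_def intro: exI[of _ 0])

lemma orlicz_norm_nonneg:
  assumes "a \<in> orlicz_space M"
  shows "orlicz_norm M a \<ge> 0"
  unfolding orlicz_norm_eq using assms
  by (intro cInf_greatest) (auto simp: orlicz_space_iff bounded_by_def)

lemma orlicz_norm_less_imp: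
  assumes "a \<in> orlicz_space M" "orlicz_norm M a < r"
  shows "bounded_by r a"
proof -
  have "{r. bounded_by r a} \<noteq> {}" using assms(1) by (simp add: orlicz_space_iff)
  then obtain s where "bounded_by s a" "s < r"
    using cInf_lessD[of "{r. bounded_by r a}" r] assms(2) by (auto simp: orlicz_norm_eq)
  thus ?thesis using bounded_by_mono by simp
qed

lemma orlicz_norm_le_iff:
  assumes "a \<in> orlicz_space M" "r > 0"
  shows "orlicz_norm M a \<le> r \<longleftrightarrow> bounded_by r a"
  using assms orlicz_norm_le orlicz_norm_less_imp by (auto intro: bounded_by_limit)

lemma bounded_by_add:
  assumes "bounded_by r a" "bounded_by s b"
  shows "bounded_by (r + s) (a + b)"
  unfolding bounded_by_def
proof (intro conjI allI)
  fix n
  have rs: "r > 0" "s > 0" using assms by (auto simp: bounded_by_def)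
  thus "0 < r + s" by simp
  have "(\<Sum>i<n. M (\<bar>(a + b) i\<bar> / (r + s)))
      \<le> (\<Sum>i<n. r / (r + s) * M (\<bar>a i\<bar> / r) + s / (r + s) * M (\<bar>b i\<bar> / s))"
  proof (rule sum_mono)
    fix i
    have "M (\<bar>(a + b) i\<bar> / (r + s)) \<le> M ((\<bar>a i\<bar> + \<bar>b i\<bar>) / (r + s))"
      using rs by (intro M_mono divide_right_mono) auto
    also have "\<dots> \<le> r / (r + s) * M (\<bar>a i\<bar> / r) + s / (r + s) * M (\<bar>b i\<bar> / s)"
      using rs by (intro M_add_le) auto
    finally show "M (\<bar>(a + b) i\<bar> / (r + s)) \<le> \<dots>" .
  qed
  also have "\<dots> = r / (r + s) * (\<Sum>i<n. M (\<bar>a i\<bar> / r)) + s / (r + s) * (\<Sum>i<n. M (\<bar>b i\<bar> / s))"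
    by (simp add: sum.distrib sum_distrib_left)
  also have "\<dots> \<le> r / (r + s) * 1 + s / (r + s) * 1"
    using assms rs by (intro add_mono mult_left_mono) (auto simp: bounded_by_def)
  also have "\<dots> = 1" using rs by (simp flip: add_divide_distrib)
  finally show "(\<Sum>i<n. M (\<bar>(a + b) i\<bar> / (r + s))) \<le> 1" .
qed

lemma bounded_by_scale:
  assumes "bounded_by r a" "c \<noteq> 0"
  shows "bounded_by (\<bar>c\<bar> * r) (c *\<^sub>R a)"
  using assms by (auto simp: bounded_by_def abs_mult)

lemma bounded_by_0: "r > 0 \<Longrightarrow> bounded_by r 0"
  by (simp add: bounded_by_def)

lemma orlicz_space_scale: "a \<in> orlicz_space M \<Longrightarrow> c *\<^sub>R a \<in> orlicz_space M"
  unfolding orlicz_space_iff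
  using bounded_by_scale[of _ a c] bounded_by_0[of 1] by (cases "c = 0") auto

lemma orlicz_norm_scale_le:
  assumes "a \<in> orlicz_space M" "c \<noteq> 0"
  shows "orlicz_norm M (c *\<^sub>R a) \<le> \<bar>c\<bar> * orlicz_norm M a"
proof (rule field_le_epsilon)
  fix e :: real assume e: "e > 0"
  have "bounded_by (\<bar>c\<bar> * (orlicz_norm M a + e / \<bar>c\<bar>)) (c *\<^sub>R a)"
    using assms e by (intro bounded_by_scale orlicz_norm_less_imp) auto
  hence "orlicz_norm M (c *\<^sub>R a) \<le> \<bar>c\<bar> * (orlicz_norm M a + e / \<bar>c\<bar>)"
    by (rule orlicz_norm_le)
  thus "orlicz_norm M (c *\<^sub>R a) \<le> \<bar>c\<bar> * orlicz_norm M a + e"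
    using assms(2) by (simp add: distrib_left)
qed

lemma normed_orlicz_space: "normed_on (orlicz_space M) (orlicz_norm M)"
  unfolding normed_on_def
proof (intro conjI ballI allI)
  show "subspace (orlicz_space M)"
    unfolding subspace_def
  proof (intro conjI ballI allI)
    show "0 \<in> orlicz_space M" unfolding orlicz_space_iff using bounded_by_0[of 1] by auto
  next
    fix a b assume "a \<in> orlicz_space M" "b \<in> orlicz_space M"
    thus "a + b \<in> orlicz_space M" unfolding orlicz_space_iff using bounded_by_add by blast
  qed (rule orlicz_space_scale)
next
  fix a b assume ab: "a \<in> orlicz_space M" "b \<in> orlicz_space M"
  show "orlicz_norm M (a + b) \<le> orlicz_norm M a + orlicz_norm M b"
  proof (rule field_le_epsilon)
    fix e :: real assume e: "e > 0"
    have "bounded_by ((orlicz_norm M a + e / 2) + (orlicz_norm M b + e / 2)) (a + b)"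
      using ab e by (intro bounded_by_add orlicz_norm_less_imp) auto
    from orlicz_norm_le[OF this] show "orlicz_norm M (a + b) \<le> orlicz_norm M a + orlicz_norm M b + e" by simp
  qed
next
  fix a assume a: "a \<in> orlicz_space M"
  have zero: "orlicz_norm M 0 = 0"
  proof (rule antisym)
    show "orlicz_norm M 0 \<le> 0"
    proof (rule field_le_epsilon)
      fix e :: real assume "e > 0"
      thus "orlicz_norm M 0 \<le> 0 + e" using orlicz_norm_le[OF bounded_by_0] by simp
    qed
    show "0 \<le> orlicz_norm M 0"
      by (rule orlicz_norm_nonneg) (use bounded_by_0[of 1] in \<open>auto simp: orlicz_space_iff\<close>)
  qed
  show "orlicz_norm M a = 0 \<longleftrightarrow> a = 0"
  proof
    assume n0: "orlicz_norm M a = 0"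
    show "a = 0"
    proof (rule ext, rule ccontr)
      fix i assume "a i \<noteq> 0 i"
      hence ai: "\<bar>a i\<bar> > 0" by simp
      \<comment> \<open>Already a single coordinate forces the norm to be at least
        \<open>\<bar>a i\<bar> / T\<close>, because \<open>M\<close> exceeds 1 at
        \<open>T\<close>.\<close>
      obtain T where T: "T > 0" "M T > 1" using M_large by blast
      have "bounded_by (\<bar>a i\<bar> / T) a"
        using n0 a ai T by (intro orlicz_norm_less_imp) auto
      hence "(\<Sum>j<Suc i. M (\<bar>a j\<bar> / (\<bar>a i\<bar> / T))) \<le> 1" unfolding bounded_by_def by blast
      moreover have "M (\<bar>a i\<bar> / (\<bar>a i\<bar> / T)) \<le> (\<Sum>j<Suc i. M (\<bar>a j\<bar> / (\<bar>a i\<bar> / T)))"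
        using T ai by (intro member_le_sum M_nonneg) auto
      moreover have "\<bar>a i\<bar> / (\<bar>a i\<bar> / T) = T" using ai by simp
      ultimately show False using T by simp
    qed
  qed (use zero in simp)
  fix c
  show "orlicz_norm M (c *\<^sub>R a) = \<bar>c\<bar> * orlicz_norm M a"
  proof (cases "c = 0")
    case False
    have "orlicz_norm M a = orlicz_norm M ((1 / c) *\<^sub>R (c *\<^sub>R a))" using False by simp
    also have "\<dots> \<le> \<bar>1 / c\<bar> * orlicz_norm M (c *\<^sub>R a)"
      using a False by (intro orlicz_norm_scale_le orlicz_space_scale) auto
    finally have "\<bar>c\<bar> * orlicz_norm M a \<le> orlicz_norm M (c *\<^sub>R a)"
      using False by (simp add: field_simps)
    thus ?thesis using orlicz_norm_scale_le[OF a False] by simp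
  qed (simp add: zero)
qed (rule orlicz_norm_nonneg)

sublocale orl: normed_subspace "orlicz_space M" "orlicz_norm M"
  by unfold_locales (rule normed_orlicz_space)

section \<open>The subspace spanned by the unit vectors\<close>

abbreviation hM :: "(nat \<Rightarrow> real) set" where "hM \<equiv> orlicz_h M"
abbreviation nm :: "(nat \<Rightarrow> real) \<Rightarrow> real" where "nm \<equiv> orlicz_norm M"

definition trunc :: "nat \<Rightarrow> (nat \<Rightarrow> real) \<Rightarrow> nat \<Rightarrow> real"
  where "trunc n a = (\<lambda>i. if i < n then a i else 0)"

lemma trunc_eq_sum: "trunc n a = (\<Sum>i<n. a i *\<^sub>R unit_seq i)"
proof
  fix j
  have "(\<Sum>i<n. a i *\<^sub>R unit_seq i) j = (\<Sum>i<n. if j = i then a i else 0)"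
    by (induction n) (auto simp: unit_seq_def)
  thus "trunc n a j = (\<Sum>i<n. a i *\<^sub>R unit_seq i) j" by (simp add: trunc_def)
qed

lemma span_unit_seq_support:
  assumes "y \<in> span (range unit_seq)"
  shows "\<exists>n. \<forall>i\<ge>n. y i = 0"
proof -
  have "subspace {y :: nat \<Rightarrow> real. \<exists>n. \<forall>i\<ge>n. y i = 0}"
    unfolding subspace_def
  proof (intro conjI ballI allI)
    fix x y :: "nat \<Rightarrow> real"
    assume "x \<in> {y. \<exists>n. \<forall>i\<ge>n. y i = 0}" "y \<in> {y. \<exists>n. \<forall>i\<ge>n. y i = 0}"
    then obtain n m where "\<forall>i\<ge>n. x i = 0" "\<forall>i\<ge>m. y i = 0" by auto
    thus "x + y \<in> {y. \<exists>n. \<forall>i\<ge>n. y i = 0}" by (auto intro!: exI[of _ "max n m"])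
  qed auto
  moreover have "range unit_seq \<subseteq> {y. \<exists>n. \<forall>i\<ge>n. y i = 0}"
    by (auto simp: unit_seq_def) (metis Suc_n_not_le_n)
  ultimately have "span (range unit_seq) \<subseteq> {y. \<exists>n. \<forall>i\<ge>n. y i = 0}" by (intro span_minimal)
  thus ?thesis using assms by blast
qed

lemma tail_bounded_by:
  assumes "\<And>c. c > 0 \<Longrightarrow> summable (\<lambda>i. M (c * \<bar>a i\<bar>))" "r > 0"
  shows "\<exists>n0. \<forall>n\<ge>n0. bounded_by r (a - trunc n a)"
proof -
  have s: "summable (\<lambda>i. M (\<bar>a i\<bar> / r))" using assms(1)[of "1 / r"] assms(2) by simp
  have nonneg: "0 \<le> M (\<bar>a i\<bar> / r)" for i using assms(2) by (intro M_nonneg) auto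
  obtain n0 where n0: "\<And>n. n \<ge> n0 \<Longrightarrow> norm (\<Sum>i. M (\<bar>a (i + n)\<bar> / r)) < 1"
    using suminf_exist_split[OF _ s, of 1] by auto
  have "bounded_by r (a - trunc n a)" if n: "n \<ge> n0" for n
    unfolding bounded_by_def
  proof (intro conjI allI)
    fix m
    have "(\<Sum>i<m. M (\<bar>(a - trunc n a) i\<bar> / r)) \<le> (\<Sum>i<m + n. M (\<bar>(a - trunc n a) i\<bar> / r))"
      using assms(2) by (intro sum_mono2 M_nonneg) auto
    also have "\<dots> = (\<Sum>i\<in>{n..<n + m}. M (\<bar>a i\<bar> / r))"
      by (rule sum.mono_neutral_cong_right) (auto simp: trunc_def)
    also have "\<dots> = (\<Sum>i<m. M (\<bar>a (i + n)\<bar> / r))"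
      by (rule sum.reindex_bij_witness[of _ "\<lambda>i. i + n" "\<lambda>i. i - n"]) auto
    also have "\<dots> \<le> (\<Sum>i. M (\<bar>a (i + n)\<bar> / r))"
      using s nonneg by (intro sum_le_suminf summable_ignore_initial_segment) auto
    also have "\<dots> \<le> 1" using n0[OF n] by simp
    finally show "(\<Sum>i<m. M (\<bar>(a - trunc n a) i\<bar> / r)) \<le> 1" .
  qed (fact assms(2))
  thus ?thesis by blast
qed

text \<open>If \<open>y\<close> is finitely supported and within \<open>1 / (2 c)\<close> of
  \<open>a\<close>, then the modulars of \<open>2 c (a - y)\<close> and \<open>2 c y\<close> are
  finite, hence so is that of \<open>c a\<close>. Conversely, finite modulars at all scales make the
  truncations converge in norm.\<close>

lemma hM_iff: "a \<in> hM \<longleftrightarrow> (\<forall>c>0. summable (\<lambda>i. M (c * \<bar>a i\<bar>)))"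
proof
  assume "a \<in> hM"
  hence a: "a \<in> orlicz_space M"
    "\<And>r. r > 0 \<Longrightarrow> \<exists>y\<in>span (range unit_seq). y \<in> orl.mball a r"
    unfolding orlicz_h_def orl.norm_topology_eq orl.metric_closure_of by auto
  show "\<forall>c>0. summable (\<lambda>i. M (c * \<bar>a i\<bar>))"
  proof (intro allI impI)
    fix c :: real assume c: "c > 0"
    obtain y where y: "y \<in> span (range unit_seq)" "y \<in> orl.mball a (1 / (2 * c))"
      using a(2)[of "1 / (2 * c)"] c by auto
    have yl: "y \<in> orlicz_space M" "orlicz_norm M (a - y) < 1 / (2 * c)" using y(2) a(1) by auto
    have "bounded_by (1 / (2 * c)) (a - y)"
      using yl a(1) by (intro orlicz_norm_less_imp) auto
    hence s1: "summable (\<lambda>i. M (2 * c * \<bar>a i - y i\<bar>))" by (simp add: bounded_by_iff mult.commute)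
    obtain n where n: "\<forall>i\<ge>n. y i = 0" using span_unit_seq_support[OF y(1)] by blast
    have s2: "summable (\<lambda>i. M (2 * c * \<bar>y i\<bar>))"
      by (rule summable_finite[of "{..<n}"]) (use n in auto)
    show "summable (\<lambda>i. M (c * \<bar>a i\<bar>))"
      by (rule summable_M_add[OF c s1 s2]) auto
  qed
next
  assume s: "\<forall>c>0. summable (\<lambda>i. M (c * \<bar>a i\<bar>))"
  have a: "a \<in> orlicz_space M"
    using s[rule_format, of 1] by (auto simp: orlicz_space_def intro!: exI[of _ 1])
  have "\<exists>y\<in>span (range unit_seq). y \<in> orl.mball a r" if r: "r > 0" for r
  proof -
    obtain n where n: "bounded_by (r / 2) (a - trunc n a)"
      using tail_bounded_by[of a "r / 2"] s r by auto
    have sp: "trunc n a \<in> span (range unit_seq)"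
      unfolding trunc_eq_sum by (intro span_sum span_scale span_base) auto
    have "a - trunc n a \<in> orlicz_space M" using n by (auto simp: orlicz_space_iff)
    from orl.mem(3)[OF a this] have "trunc n a \<in> orlicz_space M" by simp
    moreover have "orlicz_norm M (a - trunc n a) < r" using orlicz_norm_le[OF n] r by simp
    ultimately show ?thesis using sp a by (intro bexI[of _ "trunc n a"]) auto
  qed
  thus "a \<in> hM"
    unfolding orlicz_h_def orl.norm_topology_eq orl.metric_closure_of using a by blast
qed

lemma hM_subset: "hM \<subseteq> orlicz_space M"
  unfolding orlicz_h_def orl.norm_topology_eq orl.metric_closure_of by blast

lemma hM_summable:
  assumes "a \<in> hM" "c \<ge> 0"
  shows "summable (\<lambda>i. M (c * \<bar>a i\<bar>))"
  using assms by (cases "c = 0") (auto simp: hM_iff)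

lemma hM_dominated:
  assumes a: "a \<in> hM" and le: "\<And>i. \<bar>b i\<bar> \<le> \<bar>a i\<bar>"
  shows "b \<in> hM"
  unfolding hM_iff
proof (intro allI impI)
  fix c :: real assume c: "c > 0"
  show "summable (\<lambda>i. M (c * \<bar>b i\<bar>))"
  proof (rule summable_comparison_test'[OF hM_summable[OF a]])
    fix i
    show "norm (M (c * \<bar>b i\<bar>)) \<le> M (c * \<bar>a i\<bar>)"
      using c le[of i] M_nonneg[of "c * \<bar>b i\<bar>"] by (auto intro!: M_mono)
  qed (use c in simp)
qed

lemma subspace_hM: "subspace hM"
  unfolding subspace_def
proof (intro conjI ballI allI)
  show "0 \<in> hM" by (simp add: hM_iff)
next
  fix a b assume ab: "a \<in> hM" "b \<in> hM"
  show "a + b \<in> hM"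
    unfolding hM_iff
  proof (intro allI impI)
    fix c :: real assume c: "c > 0"
    show "summable (\<lambda>i. M (c * \<bar>(a + b) i\<bar>))"
      by (rule summable_M_add[OF c hM_summable[OF ab(1)] hM_summable[OF ab(2)]]) (use c in auto)
  qed
next
  fix c and a assume a: "a \<in> hM"
  show "c *\<^sub>R a \<in> hM"
    unfolding hM_iff
  proof (intro allI impI)
    fix e :: real assume e: "e > 0"
    show "summable (\<lambda>i. M (e * \<bar>(c *\<^sub>R a) i\<bar>))"
      using hM_summable[OF a, of "e * \<bar>c\<bar>"] e by (simp add: abs_mult mult.assoc)
  qed
qed

sublocale normed_subspace hM nm
proof
  have "\<forall>x\<in>hM. x \<in> orlicz_space M" using hM_subset by blast
  thus "normed_on hM nm"
    using normed_orlicz_space subspace_hM unfolding normed_on_def by simp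
qed

section \<open>The modular and its relation to the norm\<close>

definition Mo :: "(nat \<Rightarrow> real) \<Rightarrow> real"
  where "Mo a = (\<Sum>i. M \<bar>a i\<bar>)"

lemma Mo_summable: "a \<in> hM \<Longrightarrow> summable (\<lambda>i. M \<bar>a i\<bar>)"
  using hM_summable[of a 1] by simp

lemma norm_le_iff:
  assumes "a \<in> hM" "r > 0"
  shows "nm a \<le> r \<longleftrightarrow> Mo ((1 / r) *\<^sub>R a) \<le> 1"
proof -
  have "a \<in> orlicz_space M" using assms hM_subset by blast
  moreover have "summable (\<lambda>n. M (\<bar>a n\<bar> / r))"
    using hM_summable[OF assms(1), of "1 / r"] assms(2) by simp
  ultimately show ?thesis
    using assms(2) by (simp add: orlicz_norm_le_iff bounded_by_iff Mo_def abs_mult)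
qed

lemma Mo_nonneg: "a \<in> hM \<Longrightarrow> 0 \<le> Mo a"
  unfolding Mo_def by (intro suminf_nonneg Mo_summable M_nonneg) auto

lemma Mo_mono: "a \<in> hM \<Longrightarrow> b \<in> hM \<Longrightarrow> (\<And>i. \<bar>b i\<bar> \<le> \<bar>a i\<bar>) \<Longrightarrow> Mo b \<le> Mo a"
  unfolding Mo_def by (intro suminf_le Mo_summable M_mono) auto

lemma norm_mono:
  assumes a: "a \<in> hM" and b: "b \<in> hM" and le: "\<And>i. \<bar>b i\<bar> \<le> \<bar>a i\<bar>"
  shows "nm b \<le> nm a"
proof (rule field_le_epsilon)
  fix e :: real assume "e > 0"
  hence r: "nm a + e > 0" using norm_ge_0[OF a] by linarith
  have "Mo ((1 / (nm a + e)) *\<^sub>R b) \<le> Mo ((1 / (nm a + e)) *\<^sub>R a)"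
    using a b le r by (intro Mo_mono mem) (auto simp: abs_mult intro!: divide_right_mono)
  also have "\<dots> \<le> 1" using norm_le_iff[OF a r] \<open>e > 0\<close> by simp
  finally show "nm b \<le> nm a + e" using norm_le_iff[OF b r] by simp
qed

lemma Mo_contract: "a \<in> hM \<Longrightarrow> 0 \<le> c \<Longrightarrow> c \<le> 1 \<Longrightarrow> Mo (c *\<^sub>R a) \<le> c * Mo a"
proof -
  assume a: "a \<in> hM" and c: "0 \<le> c" "c \<le> 1"
  have "Mo (c *\<^sub>R a) \<le> (\<Sum>i. c * M \<bar>a i\<bar>)"
    unfolding Mo_def
  proof (rule suminf_le)
    show "M \<bar>(c *\<^sub>R a) i\<bar> \<le> c * M \<bar>a i\<bar>" for i
      using M_contract[OF c, of "\<bar>a i\<bar>"] c by (simp add: abs_mult)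
    show "summable (\<lambda>i. M \<bar>(c *\<^sub>R a) i\<bar>)" using a by (intro Mo_summable mem)
    show "summable (\<lambda>i. c * M \<bar>a i\<bar>)" using a by (intro summable_mult Mo_summable)
  qed
  also have "\<dots> = c * Mo a" unfolding Mo_def by (rule suminf_mult[OF Mo_summable[OF a]])
  finally show ?thesis .
qed

text \<open>By convexity the modular is at most the norm inside the unit ball. This sharpens the
  mere bound 1.\<close>

lemma Mo_le_norm:
  assumes "a \<in> hM" "nm a \<le> r" "0 < r" "r \<le> 1"
  shows "Mo a \<le> r"
proof -
  have "Mo a = Mo (r *\<^sub>R ((1 / r) *\<^sub>R a))" using assms by simp
  also have "\<dots> \<le> r * Mo ((1 / r) *\<^sub>R a)" using assms by (intro Mo_contract mem) auto
  also have "\<dots> \<le> r * 1" using norm_le_iff[of a r] assms by (intro mult_left_mono) auto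
  finally show ?thesis by simp
qed

lemma Mo_add:
  assumes "a \<in> hM" "b \<in> hM" "\<And>i. a i = 0 \<or> b i = 0"
  shows "Mo (a + b) = Mo a + Mo b"
proof -
  have "M \<bar>(a + b) i\<bar> = M \<bar>a i\<bar> + M \<bar>b i\<bar>" for i using assms(3)[of i] by auto
  thus ?thesis unfolding Mo_def using suminf_add[OF Mo_summable[OF assms(1)] Mo_summable[OF assms(2)]] by simp
qed

lemma Mo_0 [simp]: "Mo 0 = 0"
  by (simp add: Mo_def)

lemma Mo_sum:
  assumes "finite I" "\<And>k. k \<in> I \<Longrightarrow> w k \<in> hM"
    "\<And>j k i. j \<in> I \<Longrightarrow> k \<in> I \<Longrightarrow> j \<noteq> k \<Longrightarrow> w j i = 0 \<or> w k i = (0::real)"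
  shows "Mo (sum w I) = (\<Sum>k\<in>I. Mo (w k))"
  using assms
proof (induction I rule: finite_induct)
  case (insert k I)
  have "w k i = 0 \<or> sum w I i = 0" for i
  proof (cases "w k i = 0")
    case False
    hence "\<forall>j\<in>I. w j i = 0" using insert.prems(2)[of k] insert.hyps by fastforce
    moreover have "sum w I i = (\<Sum>j\<in>I. w j i)"
      using insert.hyps(1) by (induction I rule: finite_induct) auto
    ultimately show ?thesis by simp
  qed simp
  hence add: "Mo (w k + sum w I) = Mo (w k) + Mo (sum w I)"
    using insert.prems by (intro Mo_add sum_mem) auto
  have "Mo (sum w I) = (\<Sum>k\<in>I. Mo (w k))"
    by (rule insert.IH) (use insert.prems in blast)+
  thus ?case unfolding sum.insert[OF insert.hyps] add by (rule arg_cong)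
qed simp

lemma trunc_mem [intro]: "a \<in> hM \<Longrightarrow> trunc n a \<in> hM"
  by (erule hM_dominated) (auto simp: trunc_def)

lemma norm_trunc: "a \<in> hM \<Longrightarrow> nm (trunc n a) \<le> nm a"
  by (rule norm_mono) (auto simp: trunc_def intro: trunc_mem[unfolded trunc_def])

lemma norm_tail:
  assumes "a \<in> hM" "e > 0"
  shows "\<exists>n0. \<forall>n\<ge>n0. nm (a - trunc n a) < e"
proof -
  obtain n0 where "\<forall>n\<ge>n0. bounded_by (e / 2) (a - trunc n a)"
    using tail_bounded_by[of a "e / 2"] assms by (auto simp: hM_iff)
  hence "\<forall>n\<ge>n0. nm (a - trunc n a) \<le> e / 2" using orlicz_norm_le by blast
  thus ?thesis using assms(2) by (intro exI[of _ n0]) fastforce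
qed

lemma unit_seq_mem [simp, intro]: "unit_seq j \<in> hM"
  unfolding hM_iff
proof (intro allI impI)
  fix c :: real
  show "summable (\<lambda>i. M (c * \<bar>unit_seq j i\<bar>))"
    by (rule summable_finite[of "{j}"]) (auto simp: unit_seq_def)
qed

lemma Mo_unit: "Mo (t *\<^sub>R unit_seq j) = M \<bar>t\<bar>"
proof -
  have "Mo (t *\<^sub>R unit_seq j) = (\<Sum>i\<in>{j}. M \<bar>(t *\<^sub>R unit_seq j) i\<bar>)"
    unfolding Mo_def by (rule suminf_finite) (auto simp: unit_seq_def)
  thus ?thesis by (simp add: unit_seq_def)
qed

lemma norm_unit_eq: "nm (unit_seq j) = nm (unit_seq 0)"
proof (rule antisym)
  have "nm (unit_seq i) \<le> nm (unit_seq k)" for i k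
  proof (rule field_le_epsilon)
    fix e :: real assume e: "e > 0"
    hence r: "nm (unit_seq k) + e > 0" using norm_ge_0[of "unit_seq k"] by (simp add: add_nonneg_pos)
    thus "nm (unit_seq i) \<le> nm (unit_seq k) + e"
      using norm_le_iff[of "unit_seq i", OF _ r] norm_le_iff[of "unit_seq k", OF _ r] e
      by (simp add: Mo_unit)
  qed
  thus "nm (unit_seq j) \<le> nm (unit_seq 0)" "nm (unit_seq 0) \<le> nm (unit_seq j)" by blast+
qed

lemma coord_le:
  assumes "a \<in> hM"
  shows "\<bar>a i\<bar> * nm (unit_seq 0) \<le> nm a"
proof -
  have "\<bar>a i\<bar> * nm (unit_seq 0) = nm (a i *\<^sub>R unit_seq i)"
    by (simp add: norm_scale norm_unit_eq[of i])
  also have "\<dots> \<le> nm a"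
  proof (rule norm_mono[OF assms])
    show "\<bar>(a i *\<^sub>R unit_seq i) k\<bar> \<le> \<bar>a k\<bar>" for k by (simp add: unit_seq_def)
  qed auto
  finally show ?thesis .
qed

lemma norm_unit_pos: "nm (unit_seq 0) > 0"
proof -
  have "unit_seq 0 \<noteq> 0" unfolding fun_eq_iff unit_seq_def by (auto intro!: exI[of _ 0])
  thus ?thesis using norm_eq_0[of "unit_seq 0"] norm_ge_0[of "unit_seq 0"] by force
qed

text \<open>Coordinates of a Cauchy sequence converge by \<open>coord_le\<close>, and
  \<open>bounded_by\<close> passes to the coordinatewise limit \<open>x\<close>. So \<open>x\<close>
  is within \<open>1 / (2 c)\<close> of a member for every \<open>c\<close>, which gives its
  membership by the argument of \<open>hM_iff\<close>.\<close>

lemma banach: "banach_on hM nm"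
  unfolding banach_on_def
proof (intro conjI normed)
  show "mcomplete"
    unfolding mcomplete_def
  proof (intro allI impI)
    fix s assume "MCauchy s"
    hence s: "\<And>n. s n \<in> hM" "\<And>e. e > 0 \<Longrightarrow> \<exists>N. \<forall>n n'. N \<le> n \<longrightarrow> N \<le> n' \<longrightarrow> norm_dist hM nm (s n) (s n') < e"
      unfolding MCauchy_def by auto
    have cau: "\<exists>N. \<forall>m\<ge>N. \<forall>n\<ge>N. nm (s m - s n) < e" if "e > 0" for e
      using s(2)[OF that] s(1) by (metis dist_eq)
    have "convergent (\<lambda>n. s n i)" for i
    proof -
      have "Cauchy (\<lambda>n. s n i)"
      proof (rule metric_CauchyI)
        fix e :: real assume "e > 0"
        hence "e * nm (unit_seq 0) > 0" using norm_unit_pos by simp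
        then obtain N where N: "\<forall>m\<ge>N. \<forall>n\<ge>N. nm (s m - s n) < e * nm (unit_seq 0)" using cau by blast
        have "\<bar>s m i - s n i\<bar> < e" if "m \<ge> N" "n \<ge> N" for m n
        proof -
          have "\<bar>(s m - s n) i\<bar> * nm (unit_seq 0) < e * nm (unit_seq 0)"
            using coord_le[of "s m - s n" i] s(1) N that by (meson le_less_trans mem(3))
          thus ?thesis using norm_unit_pos by simp
        qed
        thus "\<exists>N. \<forall>m\<ge>N. \<forall>n\<ge>N. dist (s m i) (s n i) < e" by (auto simp: dist_real_def)
      qed
      thus ?thesis by (rule Cauchy_convergent)
    qed
    then obtain x where x: "\<And>i. (\<lambda>n. s n i) \<longlonglongrightarrow> x i" unfolding convergent_def by metis
    have bd: "bounded_by e (s m - x)" if m: "\<forall>n\<ge>m. nm (s m - s n) < e" and e: "e > 0" for e m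
      unfolding bounded_by_def
    proof (intro conjI allI)
      fix k
      have "(\<lambda>n. \<Sum>i<k. M (\<bar>s m i - s n i\<bar> / e)) \<longlonglongrightarrow> (\<Sum>i<k. M (\<bar>s m i - x i\<bar> / e))"
        using e x by (intro tendsto_sum M_tendsto tendsto_divide tendsto_const tendsto_rabs tendsto_diff) auto
      moreover have "(\<Sum>i<k. M (\<bar>s m i - s n i\<bar> / e)) \<le> 1" if "n \<ge> m" for n
      proof -
        have "s m - s n \<in> orlicz_space M" using s(1) hM_subset by (meson mem(3) subsetD)
        hence "bounded_by e (s m - s n)" using m that by (intro orlicz_norm_less_imp) auto
        thus ?thesis by (simp add: bounded_by_def)
      qed
      ultimately show "(\<Sum>i<k. M (\<bar>(s m - x) i\<bar> / e)) \<le> 1"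
        by (intro LIMSEQ_le_const2[of _ _ 1]) auto
    qed (fact e)
    have xh: "x \<in> hM"
      unfolding hM_iff
    proof (intro allI impI)
      fix c :: real assume c: "c > 0"
      obtain m where "\<forall>n\<ge>m. nm (s m - s n) < 1 / (2 * c)" using cau[of "1 / (2 * c)"] c by auto
      hence "bounded_by (1 / (2 * c)) (s m - x)" using c by (intro bd) auto
      hence s1: "summable (\<lambda>i. M (2 * c * \<bar>s m i - x i\<bar>))" by (simp add: bounded_by_iff mult.commute)
      have s2: "summable (\<lambda>i. M (2 * c * \<bar>s m i\<bar>))" using c s(1) by (intro hM_summable) auto
      show "summable (\<lambda>i. M (c * \<bar>x i\<bar>))"
        by (rule summable_M_add[OF c s1 s2]) auto
    qed
    have "limitin mtopology s x sequentially"
      unfolding limitin_iff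
    proof (intro conjI allI impI xh)
      fix e :: real assume e: "e > 0"
      obtain n0 where n0: "\<forall>m\<ge>n0. \<forall>n\<ge>n0. nm (s m - s n) < e / 2" using cau[of "e / 2"] e by auto
      have "nm (s m - x) \<le> e / 2" if "m \<ge> n0" for m
        using e n0 that by (intro orlicz_norm_le bd) auto
      thus "\<exists>n0. \<forall>n\<ge>n0. s n \<in> hM \<and> nm (s n - x) < e"
        using s(1) e by (intro exI[of _ n0]) fastforce
    qed
    thus "\<exists>x. limitin mtopology s x sequentially" by blast
  qed
qed

sublocale banach_subspace hM nm
  by unfold_locales (use banach in \<open>simp add: banach_on_def\<close>)

end

section \<open>The dual norm\<close>

context normed_subspace
begin

lemma bounded_functional_bdd:
  assumes "\<forall>x\<in>V. \<bar>f x\<bar> \<le> C * N x"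
  shows "bdd_above ((\<lambda>x. \<bar>f x\<bar>) ` {x\<in>V. N x \<le> 1})"
proof -
  have "\<bar>f x\<bar> \<le> \<bar>C\<bar>" if "x \<in> V" "N x \<le> 1" for x
  proof -
    have "\<bar>f x\<bar> \<le> C * N x" using assms that by blast
    also have "\<dots> \<le> \<bar>C\<bar> * 1"
      using that norm_ge_0 by (intro mult_mono) auto
    finally show ?thesis by simp
  qed
  thus ?thesis by (auto simp: bdd_above_def intro!: exI[of _ "\<bar>C\<bar>"])
qed

lemma dual_norm_le:
  assumes "0 \<le> c" "\<And>x. x \<in> V \<Longrightarrow> \<bar>f x\<bar> \<le> c * N x"
  shows "dual_norm V N f \<le> c"
  unfolding dual_norm_def
proof (rule cSUP_least)
  fix x assume x: "x \<in> {x\<in>V. N x \<le> 1}"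
  hence "\<bar>f x\<bar> \<le> c * N x" using assms(2) by blast
  also have "\<dots> \<le> c * 1" using x assms(1) by (intro mult_left_mono) auto
  finally show "\<bar>f x\<bar> \<le> c" by simp
next
  show "{x\<in>V. N x \<le> 1} \<noteq> {}" by (auto intro!: exI[of _ 0])
qed

lemma dual_bound:
  assumes f: "f \<in> dual_on V N" and x: "x \<in> V"
  shows "\<bar>f x\<bar> \<le> dual_norm V N f * N x"
proof (cases "x = 0")
  case True
  have "f 0 = 0" using f linear_on_simps(4)[of f 0 0] by (simp add: dual_on_def)
  thus ?thesis using True by simp
next
  case False
  hence pos: "N x > 0" using norm_ge_0[OF x] norm_eq_0[OF x] by simp
  obtain C where C: "\<forall>x\<in>V. \<bar>f x\<bar> \<le> C * N x" using f by (auto simp: dual_on_def)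
  have lin: "linear_on V f" using f by (simp add: dual_on_def)
  have "\<bar>f ((1 / N x) *\<^sub>R x)\<bar> \<le> dual_norm V N f"
    unfolding dual_norm_def
    by (rule cSUP_upper[OF _ bounded_functional_bdd[OF C]]) (use x pos in \<open>simp add: norm_scale\<close>)
  moreover have "f ((1 / N x) *\<^sub>R x) = f x / N x"
    using linear_on_simps(2)[OF lin x x] by simp
  ultimately show ?thesis using pos by (simp add: field_simps)
qed

lemma normed_dual: "normed_on (dual_on V N) (dual_norm V N)"
proof -
  let ?D = "dual_on V N" and ?n = "dual_norm V N"
  have bnd: "\<exists>C. C \<ge> 0 \<and> (\<forall>x\<in>V. \<bar>f x\<bar> \<le> C * N x)" if f: "f \<in> ?D" for f
  proof -
    obtain C where C: "\<forall>x\<in>V. \<bar>f x\<bar> \<le> C * N x" using f by (auto simp: dual_on_def)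
    have "\<bar>f x\<bar> \<le> \<bar>C\<bar> * N x" if "x \<in> V" for x
    proof -
      have "\<bar>f x\<bar> \<le> C * N x" using C that by blast
      also have "\<dots> \<le> \<bar>C\<bar> * N x" using norm_ge_0[OF that] by (intro mult_right_mono) auto
      finally show ?thesis .
    qed
    thus ?thesis by (intro exI[of _ "\<bar>C\<bar>"]) auto
  qed
  have lin: "linear_on V f" "\<And>x. x \<notin> V \<Longrightarrow> f x = 0" if "f \<in> ?D" for f
    using that by (auto simp: dual_on_def)
  have ge0: "?n f \<ge> 0" if f: "f \<in> ?D" for f
  proof -
    obtain C where C: "\<forall>x\<in>V. \<bar>f x\<bar> \<le> C * N x" using f by (auto simp: dual_on_def)
    have "\<bar>f 0\<bar> \<le> ?n f"
      unfolding dual_norm_def by (rule cSUP_upper[OF _ bounded_functional_bdd[OF C]]) simp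
    thus ?thesis by linarith
  qed
  have scale: "c *\<^sub>R f \<in> ?D" "?n (c *\<^sub>R f) \<le> \<bar>c\<bar> * ?n f" if f: "f \<in> ?D" for c f
  proof -
    obtain C where C: "\<forall>x\<in>V. \<bar>f x\<bar> \<le> C * N x" using f by (auto simp: dual_on_def)
    have "\<bar>(c *\<^sub>R f) x\<bar> \<le> (\<bar>c\<bar> * C) * N x" if "x \<in> V" for x
      using C that by (simp add: abs_mult mult.assoc mult_left_mono)
    hence "\<exists>C. \<forall>x\<in>V. \<bar>(c *\<^sub>R f) x\<bar> \<le> C * N x" by blast
    moreover have "linear_on V (c *\<^sub>R f)"
      using lin(1)[OF f] unfolding linear_on_def by (auto simp: algebra_simps)
    ultimately show "c *\<^sub>R f \<in> ?D" using lin(2)[OF f] by (simp add: dual_on_def)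
    show "?n (c *\<^sub>R f) \<le> \<bar>c\<bar> * ?n f"
      using ge0[OF f] dual_bound[OF f]
      by (intro dual_norm_le) (auto simp: abs_mult mult.assoc mult_left_mono)
  qed
  have add: "f + g \<in> ?D" "?n (f + g) \<le> ?n f + ?n g" if fg: "f \<in> ?D" "g \<in> ?D" for f g
  proof -
    have b: "\<bar>(f + g) x\<bar> \<le> (?n f + ?n g) * N x" if "x \<in> V" for x
      using dual_bound[OF fg(1) that] dual_bound[OF fg(2) that] by (simp add: distrib_right)
    have "linear_on V (f + g)"
      using lin(1)[OF fg(1)] lin(1)[OF fg(2)] unfolding linear_on_def by (auto simp: algebra_simps)
    thus "f + g \<in> ?D" using b lin(2) fg by (auto simp: dual_on_def)
    show "?n (f + g) \<le> ?n f + ?n g" using b ge0 fg by (intro dual_norm_le) auto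
  qed
  have z: "0 \<in> ?D" by (auto simp: dual_on_def linear_on_def intro!: exI[of _ 0])
  have n0: "?n 0 = 0" using dual_norm_le[of 0 0] ge0[OF z] by simp
  show ?thesis
    unfolding normed_on_def
  proof (intro conjI ballI allI)
    show "subspace ?D" unfolding subspace_def using z add(1) scale(1) by blast
  next
    fix f assume f: "f \<in> ?D"
    show "?n f \<ge> 0" by (rule ge0[OF f])
    show "?n f = 0 \<longleftrightarrow> f = 0"
    proof
      assume "?n f = 0"
      hence "f x = 0" for x using dual_bound[OF f, of x] lin(2)[OF f, of x] by (cases "x \<in> V") auto
      thus "f = 0" by (simp add: fun_eq_iff)
    qed (use n0 in simp)
    fix c
    show "?n (c *\<^sub>R f) = \<bar>c\<bar> * ?n f"
    proof (cases "c = 0")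
      case False
      have "?n f = ?n ((1 / c) *\<^sub>R c *\<^sub>R f)" using False by simp
      also have "\<dots> \<le> \<bar>1 / c\<bar> * ?n (c *\<^sub>R f)" by (rule scale(2)[OF scale(1)[OF f]])
      finally have "\<bar>c\<bar> * ?n f \<le> ?n (c *\<^sub>R f)" using False by (simp add: field_simps)
      thus ?thesis using scale(2)[OF f, of c] by simp
    qed (simp add: n0)
  qed (rule add(2))
qed

end

section \<open>Power estimates and blocks\<close>

definition supp_in :: "nat \<Rightarrow> nat \<Rightarrow> (nat \<Rightarrow> real) \<Rightarrow> bool"
  where "supp_in m n a \<longleftrightarrow> (\<forall>i. a i \<noteq> 0 \<longrightarrow> m \<le> i \<and> i < n)"

text \<open>The recursion behind all gliding hump arguments below: block \<open>k\<close> is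
  selected beyond the end of its predecessors, which makes the supports disjoint.\<close>

lemma block_sequence:
  assumes "\<And>k m. \<exists>n w. supp_in m n w \<and> Q k w"
  obtains n :: "nat \<Rightarrow> nat" and w :: "nat \<Rightarrow> nat \<Rightarrow> real"
  where "n 0 = b" "mono n" "\<And>k. supp_in (n k) (n (Suc k)) (w k)" "\<And>k. Q k (w k)"
    "\<And>j k i. j \<noteq> k \<Longrightarrow> w j i = 0 \<or> w k i = 0"
proof -
  have "\<forall>k m. \<exists>p. supp_in m (fst p) (snd p) \<and> Q k (snd p)"
    using assms by (metis fst_conv snd_conv)
  then obtain h where h: "\<forall>k m. supp_in m (fst (h k m)) (snd (h k m)) \<and> Q k (snd (h k m))"
    by metis
  define f g where "f = (\<lambda>k m. fst (h k m))" and "g = (\<lambda>k m. snd (h k m))"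
  have fg: "\<And>k m. supp_in m (f k m) (g k m)" "\<And>k m. Q k (g k m)"
    using h by (auto simp: f_def g_def)
  \<comment> \<open>The maximum keeps \<open>n\<close> monotone, since \<open>supp_in\<close> does
    not require its bounds to be ordered.\<close>
  define n where "n = rec_nat b (\<lambda>k m. max m (f k m))"
  define w where "w = (\<lambda>k. g k (n k))"
  have n: "n 0 = b" "\<And>k. n (Suc k) = max (n k) (f k (n k))" by (simp_all add: n_def)
  have mono: "mono n" by (rule monoI[OF lift_Suc_mono_le]) (auto simp: n)
  have supp: "supp_in (n k) (n (Suc k)) (w k)" for k
    using fg(1)[of "n k" k] by (fastforce simp: supp_in_def w_def n(2))
  have less: "w j i = 0 \<or> w k i = 0" if "j < k" for j k i
  proof -
    have "n (Suc j) \<le> n k" using mono that by (simp add: monoD)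
    thus ?thesis using supp[of j] supp[of k] unfolding supp_in_def by (meson leD le_trans)
  qed
  have "w j i = 0 \<or> w k i = 0" if "j \<noteq> k" for j k i
    using less[of j k i] less[of k j i] that by (cases "j < k") auto
  thus ?thesis using that[of n w] n(1) mono supp fg(2) by (simp add: w_def)
qed

context orlicz
begin

text \<open>The estimate has to hold uniformly in \<open>x\<close>, so that it passes to modulars:
  shrinking a vector by a factor \<open>r\<close> divides its modular by at least
  \<open>r^q / C\<close>.\<close>

definition growth :: "nat \<Rightarrow> real \<Rightarrow> bool"
  where "growth q C \<longleftrightarrow> 0 < C \<and> (\<forall>t x. 0 \<le> t \<longrightarrow> t \<le> 1 \<longrightarrow> 0 \<le> x \<longrightarrow> M (t * x) \<le> C * t ^ q * M x)"

lemma Mo_growth: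
  assumes g: "growth q C" and a: "a \<in> hM" and t: "0 \<le> t" "t \<le> 1"
  shows "Mo (t *\<^sub>R a) \<le> C * t ^ q * Mo a"
proof -
  have "Mo (t *\<^sub>R a) \<le> (\<Sum>i. C * t ^ q * M \<bar>a i\<bar>)"
    unfolding Mo_def
  proof (rule suminf_le)
    show "M \<bar>(t *\<^sub>R a) i\<bar> \<le> C * t ^ q * M \<bar>a i\<bar>" for i
      using g t unfolding growth_def by (simp add: abs_mult)
    show "summable (\<lambda>i. M \<bar>(t *\<^sub>R a) i\<bar>)" using a by (intro Mo_summable mem)
    show "summable (\<lambda>i. C * t ^ q * M \<bar>a i\<bar>)" using a by (intro summable_mult Mo_summable)
  qed
  also have "\<dots> = C * t ^ q * Mo a" unfolding Mo_def by (rule suminf_mult[OF Mo_summable[OF a]])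
  finally show ?thesis .
qed

lemma Mo_le_1: "a \<in> hM \<Longrightarrow> nm a \<le> 1 \<Longrightarrow> Mo a \<le> 1"
  using norm_le_iff[of a 1] by simp

text \<open>An upper \<open>q\<close>-estimate: modulars of disjoint vectors add up, and each is at
  most \<open>C / r^q\<close> after division by \<open>r\<close>. Hence the norm of a sum of
  \<open>K\<close> such vectors is only of order \<open>K^(1/q)\<close>.\<close>

lemma norm_disjoint_sum_le:
  assumes g: "growth q C" and I: "finite I"
    and w: "\<And>k. k \<in> I \<Longrightarrow> w k \<in> hM" "\<And>k. k \<in> I \<Longrightarrow> nm (w k) \<le> 1"
    and disj: "\<And>j k i. j \<in> I \<Longrightarrow> k \<in> I \<Longrightarrow> j \<noteq> k \<Longrightarrow> w j i = 0 \<or> w k i = 0"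
    and r: "1 \<le> r" "real (card I) * C \<le> r ^ q"
  shows "nm (sum w I) \<le> r"
proof -
  have "(1 / r) *\<^sub>R sum w I = (\<Sum>k\<in>I. (1 / r) *\<^sub>R w k)" by (rule scaleR_sum_right)
  hence "Mo ((1 / r) *\<^sub>R sum w I) = (\<Sum>k\<in>I. Mo ((1 / r) *\<^sub>R w k))"
    using I w(1) disj by (simp only:) (intro Mo_sum mem, auto)
  also have "\<dots> \<le> (\<Sum>k\<in>I. C * (1 / r) ^ q)"
  proof (rule sum_mono)
    fix k assume k: "k \<in> I"
    have "Mo ((1 / r) *\<^sub>R w k) \<le> C * (1 / r) ^ q * Mo (w k)"
      using r k w by (intro Mo_growth[OF g]) auto
    also have "\<dots> \<le> C * (1 / r) ^ q * 1"
      using g r Mo_le_1[OF w(1)[OF k] w(2)[OF k]] by (intro mult_left_mono) (auto simp: growth_def)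
    finally show "Mo ((1 / r) *\<^sub>R w k) \<le> C * (1 / r) ^ q" by simp
  qed
  also have "\<dots> = real (card I) * C / r ^ q" by (simp add: power_one_over)
  also have "\<dots> \<le> 1" using r by (simp add: divide_le_eq)
  finally show ?thesis using norm_le_iff[of "sum w I" r] r w(1) by (simp add: sum_mem)
qed

text \<open>
  If a functional is not small on tails, it is at least \<open>\<epsilon> K\<close> on a sum of \<open>K\<close> disjoint blocks, whose
  norm is only of order \<open>sqrt K\<close>.
\<close>

lemma functional_small_on_tails:
  assumes gr: "growth 2 C" and lin: "linear_on hM g" and bd: "\<And>x. x \<in> hM \<Longrightarrow> \<bar>g x\<bar> \<le> D * nm x"
    and e: "e > 0"
  shows "\<exists>n. \<forall>x\<in>hM. (\<forall>i<n. x i = 0) \<longrightarrow> \<bar>g x\<bar> \<le> e * nm x"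
proof (rule ccontr)
  assume no: "\<not> ?thesis"
  define D' where "D' = \<bar>D\<bar> + 1"
  have D': "D' > 0" "\<And>x. x \<in> hM \<Longrightarrow> \<bar>g x\<bar> \<le> D' * nm x"
  proof -
    show "D' > 0" by (simp add: D'_def)
    fix x assume x: "x \<in> hM"
    have "\<bar>g x\<bar> \<le> D * nm x" by (rule bd[OF x])
    also have "\<dots> \<le> D' * nm x" using norm_ge_0[OF x] by (intro mult_right_mono) (auto simp: D'_def)
    finally show "\<bar>g x\<bar> \<le> D' * nm x" .
  qed
  have "\<exists>n w. supp_in m n w \<and> w \<in> hM \<and> nm w \<le> 1 \<and> e / 2 < g w" for m
  proof -
    obtain x where x: "x \<in> hM" "\<forall>i<m. x i = 0" "\<bar>g x\<bar> > e * nm x" using no by (meson not_le)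
    have "x \<noteq> 0" using x(3) linear_on_simps(4)[OF lin x(1) x(1)] by auto
    hence pos: "nm x > 0" using norm_ge_0[OF x(1)] norm_eq_0[OF x(1)] by simp
    define y where "y = (sgn (g x) / nm x) *\<^sub>R x"
    have y: "y \<in> hM" using x y_def by simp
    have gx: "g x \<noteq> 0" using x(3) e pos by (smt (verit) mult_pos_pos)
    have "g y = sgn (g x) / nm x * g x" unfolding y_def using linear_on_simps(2)[OF lin x(1) x(1)] by simp
    also have "\<dots> = \<bar>g x\<bar> / nm x" by (simp add: abs_sgn mult.commute)
    finally have gy: "g y > e" using x(3) pos by (simp add: less_divide_eq)
    have ny: "nm y = 1" unfolding y_def using x(1) pos gx by (simp add: norm_scale abs_sgn_eq)
    \<comment> \<open>Truncating this far changes the value of \<open>g\<close> by less than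
      \<open>e / 2\<close>, so a finite block with value above \<open>e / 2\<close> remains.\<close>
    obtain n where n: "nm (y - trunc n y) < e / (2 * D')"
      using norm_tail[OF y, of "e / (2 * D')"] e D'(1) by auto
    have "\<bar>g (y - trunc n y)\<bar> \<le> D' * nm (y - trunc n y)" using y by (intro D'(2)) auto
    also have "\<dots> < D' * (e / (2 * D'))" using n D'(1) by (intro mult_strict_left_mono)
    also have "\<dots> = e / 2" using D'(1) by simp
    finally have "g (trunc n y) > e / 2"
      using gy unfolding linear_on_simps(3)[OF lin y trunc_mem[OF y]] by linarith
    moreover have "supp_in m n (trunc n y)"
      using x(2) by (auto simp: supp_in_def trunc_def y_def) (meson not_le)
    ultimately show ?thesis using norm_trunc[OF y, of n] y ny
      by (intro exI[of _ n] exI[of _ "trunc n y"]) auto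
  qed
  hence "\<And>(k::nat) m. \<exists>n w. supp_in m n w \<and> w \<in> hM \<and> nm w \<le> 1 \<and> e / 2 < g w" by blast
  then obtain n w where "n 0 = (0::nat)" "mono n" "\<And>k. supp_in (n k) (n (Suc k)) (w k)"
    and w': "\<And>k::nat. w k \<in> hM \<and> nm (w k) \<le> 1 \<and> e / 2 < g (w k)"
      "\<And>j k i. j \<noteq> k \<Longrightarrow> w j i = 0 \<or> w k i = 0"
    by (rule block_sequence[where b = 0 and Q = "\<lambda>k w. w \<in> hM \<and> nm w \<le> 1 \<and> e / 2 < g w"]) (rule that)
  hence w: "\<And>k. w k \<in> hM" "\<And>k. nm (w k) \<le> 1" "\<And>k. e / 2 < g (w k)" by auto
  \<comment> \<open>With \<open>C\<close> at most \<open>c^2\<close>, the radius \<open>c m\<close>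
    is admissible for \<open>m^2\<close> blocks in \<open>norm_disjoint_sum_le\<close>.\<close>
  define c where "c = max 1 C"
  have c: "c \<ge> 1" "C \<le> c\<^sup>2"
  proof -
    show "c \<ge> 1" by (simp add: c_def)
    hence "c * 1 \<le> c * c" by (intro mult_left_mono) auto
    thus "C \<le> c\<^sup>2" by (simp add: power2_eq_square c_def)
  qed
  \<comment> \<open>For \<open>m^2\<close> blocks the value of \<open>g\<close> is at least
    \<open>m^2 e / 2\<close>, while the norm bound allows only \<open>D' c m\<close>; this choice of
    \<open>m\<close> makes the two incompatible.\<close>
  obtain m :: nat where m: "2 * D' * c / e < real m" using reals_Archimedean2 by blast
  have "0 \<le> 2 * D' * c / e" using D'(1) c(1) e by simp
  hence "real m > 0" using m by linarith
  hence m1: "m \<ge> 1" by simp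
  let ?S = "\<Sum>k<m\<^sup>2. w k"
  have "nm ?S \<le> c * real m"
  proof (rule norm_disjoint_sum_le[OF gr])
    have "1 * 1 \<le> c * real m" using c m1 by (intro mult_mono) auto
    thus "1 \<le> c * real m" by simp
    show "real (card {..<m\<^sup>2}) * C \<le> (c * real m)\<^sup>2"
      using mult_right_mono[OF c(2), of "(real m)\<^sup>2"] by (simp add: power_mult_distrib mult.commute)
  qed (use w w'(2) in auto)
  hence "g ?S \<le> D' * (c * real m)"
    using D'(2)[of ?S] w(1) D'(1) by (smt (verit) mult_left_mono sum_mem)
  moreover have "g ?S = (\<Sum>k<m\<^sup>2. g (w k))" using w(1) by (intro linear_on_sum[OF lin])
  moreover have "(\<Sum>k<m\<^sup>2. e / 2) \<le> (\<Sum>k<m\<^sup>2. g (w k))"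
    using w(3) by (intro sum_mono) (simp add: less_imp_le)
  ultimately have "real m * (real m * e) \<le> real m * (2 * D' * c)"
    by (simp add: power2_eq_square algebra_simps)
  hence "real m * e \<le> 2 * D' * c" using m1 by simp
  thus False using m e by (simp add: divide_less_eq)
qed

section \<open>Separability of the dual and of the space\<close>

lemma norm_tail_le: "a \<in> hM \<Longrightarrow> nm (a - trunc n a) \<le> nm a"
  by (rule norm_mono) (auto intro: mem, simp add: trunc_def)

lemma sum_coord_le:
  assumes a: "a \<in> hM" and r: "\<And>i. i < n \<Longrightarrow> \<bar>r i\<bar> \<le> d"
  shows "\<bar>\<Sum>i<n. r i * a i\<bar> \<le> real n * d / nm (unit_seq 0) * nm a"
proof -
  have "\<bar>\<Sum>i<n. r i * a i\<bar> \<le> (\<Sum>i<n. \<bar>r i * a i\<bar>)" by (rule sum_abs)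
  also have "\<dots> \<le> (\<Sum>i<n. d * (nm a / nm (unit_seq 0)))"
  proof (rule sum_mono)
    fix i assume "i \<in> {..<n}"
    hence "\<bar>r i\<bar> \<le> d" using r by simp
    moreover have "\<bar>a i\<bar> \<le> nm a / nm (unit_seq 0)"
      using coord_le[OF a, of i] norm_unit_pos by (simp add: le_divide_eq)
    ultimately show "\<bar>r i * a i\<bar> \<le> d * (nm a / nm (unit_seq 0))"
      unfolding abs_mult by (intro mult_mono) auto
  qed
  also have "\<dots> = real n * d / nm (unit_seq 0) * nm a" by simp
  finally show ?thesis .
qed

lemma rat_approx:
  fixes x :: "nat \<Rightarrow> real"
  assumes "d > 0"
  obtains q :: "rat list" where "length q = n" "\<And>i. i < n \<Longrightarrow> \<bar>x i - of_rat (q ! i)\<bar> \<le> d"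
proof -
  have "\<exists>q. \<bar>x i - of_rat q\<bar> \<le> d" for i
  proof -
    obtain r where "r \<in> \<rat>" "x i - d < r" "r < x i"
      using Rats_dense_in_real[of "x i - d" "x i"] assms by auto
    moreover from this obtain q where "r = of_rat q" by (auto elim: Rats_cases)
    ultimately show ?thesis by (intro exI[of _ q]) auto
  qed
  then obtain q where "\<And>i. \<bar>x i - of_rat (q i)\<bar> \<le> d" by metis
  thus ?thesis using that[of "map q [0..<n]"] by simp
qed

theorem separable_dual:
  assumes gr: "growth 2 C"
  shows "separable_dual_on hM nm"
proof -
  interpret D: normed_subspace "dual_on hM nm" "dual_norm hM nm"
    by unfold_locales (rule normed_dual)
  \<comment> \<open>Finitely supported functionals with rational coefficients, indexed by lists for
    countability. They vanish outside the space because \<open>dual_on\<close> demands this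
    representation.\<close>
  define F where "F = (\<lambda>q::rat list. \<lambda>x. if x \<in> hM then \<Sum>i<length q. of_rat (q ! i) * x i else 0 :: real)"
  have F: "F q \<in> dual_on hM nm" for q
  proof -
    have lin: "linear_on hM (F q)"
      unfolding linear_on_def F_def
      by (auto simp: sum.distrib[symmetric] distrib_left sum_distrib_left mult.left_commute)
    have "\<bar>F q x\<bar> \<le> real (length q) * (\<Sum>i<length q. \<bar>of_rat (q ! i)\<bar>) / nm (unit_seq 0) * nm x"
      if "x \<in> hM" for x
    proof -
      have "\<bar>of_rat (q ! i) :: real\<bar> \<le> (\<Sum>i<length q. \<bar>of_rat (q ! i)\<bar>)" if "i < length q" for i
        using that by (intro member_le_sum[of i "{..<length q}" "\<lambda>i. \<bar>of_rat (q ! i)\<bar>"]) auto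
      thus ?thesis using sum_coord_le[OF that, of "length q" "\<lambda>i. of_rat (q ! i)"] that by (simp add: F_def)
    qed
    hence "\<exists>C. \<forall>x\<in>hM. \<bar>F q x\<bar> \<le> C * nm x" by blast
    with lin show ?thesis unfolding dual_on_def by (simp add: F_def)
  qed
  have dense: "\<exists>q. dual_norm hM nm (f - F q) < e" if f: "f \<in> dual_on hM nm" and e: "e > 0" for f e
  proof -
    have lin: "linear_on hM f" using f by (simp add: dual_on_def)
    obtain n where n: "\<And>x. x \<in> hM \<Longrightarrow> \<forall>i<n. x i = 0 \<Longrightarrow> \<bar>f x\<bar> \<le> e / 4 * nm x"
      using functional_small_on_tails[OF gr lin dual_bound[OF f], of "e / 4"] e by auto
    \<comment> \<open>With this accuracy the \<open>n\<close> rounded coefficients together cost at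
      most \<open>e / 4\<close>; adding 1 to \<open>n\<close> avoids a division by zero.\<close>
    define d where "d = e * nm (unit_seq 0) / (4 * (real n + 1))"
    have d: "d > 0" using e norm_unit_pos by (simp add: d_def)
    obtain q :: "rat list" where q: "length q = n" "\<And>i. i < n \<Longrightarrow> \<bar>f (unit_seq i) - of_rat (q ! i)\<bar> \<le> d"
      using rat_approx[OF d, of n "\<lambda>i. f (unit_seq i)"] by blast
    have "dual_norm hM nm (f - F q) \<le> e / 2"
    proof (rule dual_norm_le)
      fix x assume x: "x \<in> hM"
      have "f (trunc n x) = (\<Sum>i<n. x i * f (unit_seq i))"
        unfolding trunc_eq_sum using linear_on_sum[OF lin, of "{..<n}" "\<lambda>i. x i *\<^sub>R unit_seq i"]
          linear_on_simps(2)[OF lin unit_seq_mem unit_seq_mem] by simp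
      hence "(f - F q) x = f (x - trunc n x) + (\<Sum>i<n. (f (unit_seq i) - of_rat (q ! i)) * x i)"
        using linear_on_simps(3)[OF lin x trunc_mem[OF x], of n] x q(1)
        by (simp add: F_def algebra_simps sum_subtractf)
      moreover have "\<bar>f (x - trunc n x)\<bar> \<le> e / 4 * nm x"
      proof -
        have "\<bar>f (x - trunc n x)\<bar> \<le> e / 4 * nm (x - trunc n x)"
          by (rule n) (use x in auto, simp add: trunc_def)
        also have "\<dots> \<le> e / 4 * nm x" using e norm_tail_le[OF x] by (intro mult_left_mono) auto
        finally show ?thesis .
      qed
      moreover have "\<bar>\<Sum>i<n. (f (unit_seq i) - of_rat (q ! i)) * x i\<bar> \<le> e / 4 * nm x"
      proof -
        have "\<bar>\<Sum>i<n. (f (unit_seq i) - of_rat (q ! i)) * x i\<bar> \<le> real n * d / nm (unit_seq 0) * nm x"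
          using q(2) by (intro sum_coord_le[OF x])
        also have "\<dots> \<le> e / 4 * nm x"
        proof (rule mult_right_mono[OF _ norm_ge_0[OF x]])
          have "real n * d / nm (unit_seq 0) = e / 4 * (real n / (real n + 1))"
            using norm_unit_pos by (simp add: d_def)
          also have "\<dots> \<le> e / 4 * 1" using e by (intro mult_left_mono) (auto simp: divide_le_eq)
          finally show "real n * d / nm (unit_seq 0) \<le> e / 4" by simp
        qed
        finally show ?thesis .
      qed
      ultimately show "\<bar>(f - F q) x\<bar> \<le> e / 2 * nm x" by linarith
    qed (use e in simp)
    thus ?thesis using e by (intro exI[of _ q]) simp
  qed
  have "D.mtopology closure_of (range F) = dual_on hM nm"
    unfolding D.metric_closure_of
  proof (intro equalityI subsetI)
    fix f assume f: "f \<in> dual_on hM nm"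
    have "\<exists>y\<in>range F. y \<in> D.mball f r" if r: "r > 0" for r
    proof -
      obtain q where "dual_norm hM nm (f - F q) < r" using dense[OF f r] by blast
      thus ?thesis using f F by (intro bexI[of _ "F q"]) auto
    qed
    thus "f \<in> {f \<in> dual_on hM nm. \<forall>r>0. \<exists>y\<in>range F. y \<in> D.mball f r}" using f by simp
  qed simp
  moreover have "countable (range F)" by simp
  ultimately show ?thesis
    unfolding separable_dual_on_def separable_space_def D.norm_topology_eq D.topspace_mtopology
    using F by blast
qed

text \<open>Supplies, after transport by an isomorphism, the sequence on which the locale
  \<open>polyhedral_space\<close> depends.\<close>

lemma dense_sequence:
  obtains d :: "nat \<Rightarrow> nat \<Rightarrow> real"
  where "\<And>n. d n \<in> hM" "\<And>x e. x \<in> hM \<Longrightarrow> e > 0 \<Longrightarrow> \<exists>n. nm (x - d n) < e"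
proof -
  define G where "G = (\<lambda>q::rat list. \<Sum>i<length q. of_rat (q ! i) *\<^sub>R unit_seq i)"
  have G: "G q \<in> hM" for q unfolding G_def by (intro sum_mem mem) auto
  have "\<exists>n. nm (x - G (from_nat n)) < e" if x: "x \<in> hM" and e: "e > 0" for x e
  proof -
    obtain n where n: "nm (x - trunc n x) < e / 2" using norm_tail[OF x, of "e / 2"] e by auto
    define d where "d = e / (2 * (real n + 1) * nm (unit_seq 0))"
    have d: "d > 0" using e norm_unit_pos by (simp add: d_def)
    obtain q :: "rat list" where q: "length q = n" "\<And>i. i < n \<Longrightarrow> \<bar>x i - of_rat (q ! i)\<bar> \<le> d"
      using rat_approx[OF d, of n x] by blast
    have "trunc n x - G q = (\<Sum>i<n. (x i - of_rat (q ! i)) *\<^sub>R unit_seq i)"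
      unfolding G_def trunc_eq_sum q(1) by (simp add: sum_subtractf[symmetric] scaleR_diff_left)
    hence "nm (trunc n x - G q) \<le> (\<Sum>i<n. nm ((x i - of_rat (q ! i)) *\<^sub>R unit_seq i))"
      by (simp only:) (intro norm_sum mem unit_seq_mem)
    also have "\<dots> \<le> (\<Sum>i<n. d * nm (unit_seq 0))"
    proof (rule sum_mono)
      fix i assume "i \<in> {..<n}"
      thus "nm ((x i - of_rat (q ! i)) *\<^sub>R unit_seq i) \<le> d * nm (unit_seq 0)"
        using q(2)[of i] norm_unit_pos unfolding norm_scale[OF unit_seq_mem] norm_unit_eq[of i]
        by (intro mult_right_mono) auto
    qed
    also have "\<dots> = e / 2 * (real n / (real n + 1))" using norm_unit_pos by (simp add: d_def)
    also have "\<dots> \<le> e / 2 * 1" using e by (intro mult_left_mono) (auto simp: divide_le_eq)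
    finally have "nm ((x - trunc n x) + (trunc n x - G q)) < e"
      using norm_triangle[of "x - trunc n x" "trunc n x - G q"] x n G[of q] trunc_mem[OF x, of n] by auto
    moreover have "(x - trunc n x) + (trunc n x - G q) = x - G (from_nat (to_nat q))" by simp
    ultimately show ?thesis by metis
  qed
  thus ?thesis using that[of "\<lambda>n. G (from_nat n)"] G by blast
qed

end

section \<open>Copies of the space of null sequences\<close>

lemma c0_add: "a \<in> c0 \<Longrightarrow> b \<in> c0 \<Longrightarrow> a + b \<in> c0"
  unfolding c0_def plus_fun_def using tendsto_add[of a 0 sequentially b 0] by simp

lemma c0_scale: "a \<in> c0 \<Longrightarrow> c *\<^sub>R a \<in> c0"
  unfolding c0_def scaleR_fun_def using tendsto_mult_left[of a 0 sequentially c] by simp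

lemma c0_diff: "a \<in> c0 \<Longrightarrow> b \<in> c0 \<Longrightarrow> a - b \<in> c0"
  using c0_add[of a "(-1) *\<^sub>R b"] c0_scale[of b "-1"] by simp

lemma c0_abs_le_sup_norm:
  assumes "a \<in> c0"
  shows "\<bar>a k\<bar> \<le> sup_norm a"
proof -
  have "Bseq a" using assms by (auto simp: c0_def intro: convergent_imp_Bseq convergentI)
  then obtain K where "\<And>n. \<bar>a n\<bar> \<le> K" by (auto simp: Bseq_def)
  hence "bdd_above (range (\<lambda>n. \<bar>a n\<bar>))" by (auto simp: bdd_above_def)
  thus ?thesis unfolding sup_norm_def by (intro cSUP_upper) auto
qed

lemma sup_norm_le: "(\<And>k. \<bar>a k\<bar> \<le> c) \<Longrightarrow> sup_norm a \<le> c"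
  unfolding sup_norm_def by (intro cSUP_least) auto

context normed_subspace
begin

lemma limitin_unique:
  assumes "limitin mtopology s x sequentially" "limitin mtopology s y sequentially"
  shows "x = y"
  using assms limitin_metric_unique[of s x sequentially y] by simp

lemma limitin_add:
  assumes "limitin mtopology s x sequentially" "limitin mtopology t y sequentially"
  shows "limitin mtopology (\<lambda>n. s n + t n) (x + y) sequentially"
  unfolding limitin_iff
proof (intro conjI allI impI)
  have xy: "x \<in> V" "y \<in> V" using assms by (auto simp: limitin_iff)
  thus "x + y \<in> V" by simp
  fix e :: real assume "e > 0"
  then obtain n0 n1 where n: "\<And>n. n \<ge> n0 \<Longrightarrow> s n \<in> V \<and> N (s n - x) < e / 2"
    "\<And>n. n \<ge> n1 \<Longrightarrow> t n \<in> V \<and> N (t n - y) < e / 2"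
    using assms unfolding limitin_iff by (meson half_gt_zero)
  have "s n + t n \<in> V \<and> N (s n + t n - (x + y)) < e" if "n \<ge> max n0 n1" for n
  proof -
    have st: "s n \<in> V" "N (s n - x) < e / 2" "t n \<in> V" "N (t n - y) < e / 2" using n that by auto
    have "s n + t n - (x + y) = (s n - x) + (t n - y)" by simp
    hence "N (s n + t n - (x + y)) \<le> N (s n - x) + N (t n - y)"
      using st xy by (simp only:) (intro norm_triangle mem)
    thus ?thesis using st by auto
  qed
  thus "\<exists>n0. \<forall>n\<ge>n0. s n + t n \<in> V \<and> N (s n + t n - (x + y)) < e" by blast
qed

lemma limitin_scale:
  assumes "limitin mtopology s x sequentially"
  shows "limitin mtopology (\<lambda>n. c *\<^sub>R s n) (c *\<^sub>R x) sequentially"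
  unfolding limitin_iff
proof (intro conjI allI impI)
  have x: "x \<in> V" using assms by (auto simp: limitin_iff)
  thus "c *\<^sub>R x \<in> V" by simp
  fix e :: real assume "e > 0"
  hence "e / (\<bar>c\<bar> + 1) > 0" by simp
  then obtain n0 where n: "\<And>n. n \<ge> n0 \<Longrightarrow> s n \<in> V \<and> N (s n - x) < e / (\<bar>c\<bar> + 1)"
    using assms unfolding limitin_iff by meson
  have "c *\<^sub>R s n \<in> V \<and> N (c *\<^sub>R s n - c *\<^sub>R x) < e" if "n \<ge> n0" for n
  proof -
    have s: "s n \<in> V" "N (s n - x) < e / (\<bar>c\<bar> + 1)" using n that by auto
    have "N (c *\<^sub>R s n - c *\<^sub>R x) = \<bar>c\<bar> * N (s n - x)"
      unfolding scaleR_diff_right[symmetric] using s x by (intro norm_scale) auto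
    also have "\<dots> \<le> (\<bar>c\<bar> + 1) * N (s n - x)"
      using norm_ge_0[of "s n - x"] s x by (intro mult_right_mono) auto
    also have "\<dots> < (\<bar>c\<bar> + 1) * (e / (\<bar>c\<bar> + 1))" using s by (intro mult_strict_left_mono) auto
    also have "\<dots> = e" by simp
    finally show ?thesis using s by auto
  qed
  thus "\<exists>n0. \<forall>n\<ge>n0. c *\<^sub>R s n \<in> V \<and> N (c *\<^sub>R s n - c *\<^sub>R x) < e" by blast
qed

lemma norm_limit_close:
  assumes "limitin mtopology s x sequentially" "e > 0"
  shows "\<exists>n0. \<forall>n\<ge>n0. s n \<in> V \<and> \<bar>N (s n) - N x\<bar> < e"
proof -
  have x: "x \<in> V" using assms by (auto simp: limitin_iff)
  obtain n0 where "\<forall>n\<ge>n0. s n \<in> V \<and> N (s n - x) < e" using assms unfolding limitin_iff by meson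
  thus ?thesis
    using norm_triangle_diff[OF _ x] norm_triangle_diff[OF x] norm_diff_commute[OF x]
    by (intro exI[of _ n0]) fastforce
qed

lemma norm_limit_le:
  assumes "limitin mtopology s x sequentially" "\<And>n. N (s n) \<le> c"
  shows "N x \<le> c"
proof (rule field_le_epsilon)
  fix e :: real assume "e > 0"
  then obtain n where "\<bar>N (s n) - N x\<bar> < e" using norm_limit_close[OF assms(1)] by blast
  thus "N x \<le> c + e" using assms(2)[of n] by linarith
qed

lemma norm_limit_ge:
  assumes "limitin mtopology s x sequentially" "\<And>n. n \<ge> n1 \<Longrightarrow> c \<le> N (s n)"
  shows "c \<le> N x"
proof (rule field_le_epsilon)
  fix e :: real assume "e > 0"
  then obtain n0 where "\<forall>n\<ge>n0. \<bar>N (s n) - N x\<bar> < e" using norm_limit_close[OF assms(1)] by blast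
  hence "\<bar>N (s (max n0 n1)) - N x\<bar> < e" by simp
  thus "c \<le> N x + e" using assms(2)[of "max n0 n1"] by linarith
qed

end

text \<open>The two estimates say that \<open>z\<close> is equivalent to the unit vector basis of
  the null sequences. The upper one makes the series with null coefficients converge. The lower one
  turns norm convergence of images into uniform convergence of the coefficient sequences, whose
  limit is again null, so the image is closed.\<close>

lemma (in banach_subspace) c0_copy:
  fixes z :: "nat \<Rightarrow> 'a"
  assumes W: "subspace W" "closedin mtopology W"
    and z: "\<And>k. z k \<in> W" and A: "A > 0"
    and lower: "\<And>a n k. k < n \<Longrightarrow> A * \<bar>a k\<bar> \<le> N (\<Sum>j<n. a j *\<^sub>R z j)"
    and upper: "\<And>a I c. finite I \<Longrightarrow> 0 \<le> c \<Longrightarrow> (\<And>k. k \<in> I \<Longrightarrow> \<bar>a k\<bar> \<le> c) \<Longrightarrow>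
      N (\<Sum>k\<in>I. a k *\<^sub>R z k) \<le> B * c"
  shows "\<exists>Z. subspace Z \<and> Z \<subseteq> W \<and> closedin mtopology Z \<and> isomorphic_on Z N c0 sup_norm"
proof -
  have WV: "W \<subseteq> V" using W(2) closedin_subset by fastforce
  have zV: "z k \<in> V" for k using z WV by blast
  define S where "S = (\<lambda>(a::nat \<Rightarrow> real) n. \<Sum>k<n. a k *\<^sub>R z k)"
  have SW: "S a n \<in> W" for a n
    unfolding S_def using z by (intro subspace_sum[OF W(1)] subspace_scale[OF W(1)])
  have SV: "S a n \<in> V" for a n using SW WV by blast
  define B' where "B' = \<bar>B\<bar> + 1"
  have B': "B' > 0" by (simp add: B'_def)
  have upper': "N (\<Sum>k\<in>I. a k *\<^sub>R z k) \<le> B' * c"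
    if "finite I" "0 \<le> c" "\<And>k. k \<in> I \<Longrightarrow> \<bar>a k\<bar> \<le> c" for a I c
  proof -
    have "N (\<Sum>k\<in>I. a k *\<^sub>R z k) \<le> B * c" using that by (rule upper)
    also have "\<dots> \<le> B' * c" using that(2) by (intro mult_right_mono) (auto simp: B'_def)
    finally show ?thesis .
  qed
  have ex: "\<exists>x. limitin mtopology (S a) x sequentially" if a: "a \<in> c0" for a
  proof (rule Cauchy_limit[OF SV])
    fix e :: real assume e: "e > 0"
    define c where "c = e / (2 * B')"
    have c: "c > 0" using e B' by (simp add: c_def)
    obtain n0 where n0: "\<forall>n\<ge>n0. norm (a n - 0) < c"
      using a c LIMSEQ_D unfolding c0_def by blast
    have "N (S a n - S a m) < e" if "m \<ge> n0" "n \<ge> m" for m n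
    proof -
      have "S a n - S a m = (\<Sum>k\<in>{m..<n}. a k *\<^sub>R z k)"
        unfolding S_def lessThan_atLeast0 using that by (intro sum_diff_nat_ivl) auto
      hence "N (S a n - S a m) \<le> B' * c"
      proof (simp only:, intro upper')
        fix k assume "k \<in> {m..<n}"
        hence "norm (a k - 0) < c" using n0 that by simp
        thus "\<bar>a k\<bar> \<le> c" by simp
      qed (use c in simp_all)
      also have "\<dots> < e" using e B' by (simp add: c_def)
      finally show ?thesis .
    qed
    thus "\<exists>n0. \<forall>m\<ge>n0. \<forall>n\<ge>m. N (S a n - S a m) < e" by blast
  qed
  define T where "T = (\<lambda>a. SOME x. limitin mtopology (S a) x sequentially)"
  have T: "limitin mtopology (S a) (T a) sequentially" if "a \<in> c0" for a
    unfolding T_def using ex[OF that] by (rule someI_ex)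
  have TW: "T a \<in> W" if "a \<in> c0" for a
    using closed_limit[OF W(2) SW T[OF that]] .
  have TV: "T a \<in> V" if "a \<in> c0" for a using TW[OF that] WV by blast
  have T_add: "T (a + b) = T a + T b" if "a \<in> c0" "b \<in> c0" for a b
  proof -
    have "S (a + b) = (\<lambda>n. S a n + S b n)"
      by (simp add: S_def scaleR_add_left sum.distrib)
    thus ?thesis using limitin_unique[OF T[OF c0_add[OF that]]] limitin_add[OF T[OF that(1)] T[OF that(2)]] by simp
  qed
  have T_scale: "T (c *\<^sub>R a) = c *\<^sub>R T a" if "a \<in> c0" for c a
  proof -
    have "S (c *\<^sub>R a) = (\<lambda>n. c *\<^sub>R S a n)"
      by (simp add: S_def scaleR_sum_right)
    thus ?thesis using limitin_unique[OF T[OF c0_scale[OF that]]] limitin_scale[OF T[OF that]] by simp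
  qed
  have T_diff: "T (a - b) = T a - T b" if "a \<in> c0" "b \<in> c0" for a b
    using T_add[OF c0_diff[OF that] that(2)] by simp
  have T_le: "N (T a) \<le> B' * c" if "a \<in> c0" "0 \<le> c" "\<And>k. \<bar>a k\<bar> \<le> c" for a c
    by (rule norm_limit_le[OF T[OF that(1)]]) (unfold S_def, intro upper', use that in auto)
  have T_ge: "A * \<bar>a k\<bar> \<le> N (T a)" if "a \<in> c0" for a k
    by (rule norm_limit_ge[OF T[OF that], of "Suc k"]) (unfold S_def, intro lower, simp)
  have inj: "inj_on T c0"
  proof (rule inj_onI)
    fix a b assume ab: "a \<in> c0" "b \<in> c0" "T a = T b"
    have "N (T (a - b)) = 0" using T_diff[OF ab(1,2)] ab(3) by simp
    hence "A * \<bar>(a - b) k\<bar> \<le> 0" for k using T_ge[OF c0_diff[OF ab(1,2)], of k] by simp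
    thus "a = b" using A by (simp add: fun_eq_iff mult_le_0_iff)
  qed
  define Z where "Z = T ` c0"
  have ZW: "Z \<subseteq> W" using TW by (auto simp: Z_def)
  have "subspace Z"
    unfolding subspace_def
  proof (intro conjI ballI allI)
    have "0 \<in> c0" by (simp add: c0_def zero_fun_def)
    hence "T (0 *\<^sub>R 0) \<in> Z" unfolding Z_def by simp
    moreover have "T (0 *\<^sub>R 0) = 0" using T_scale[OF \<open>0 \<in> c0\<close>, of 0] by simp
    ultimately show "0 \<in> Z" by simp
  next
    fix x y assume "x \<in> Z" "y \<in> Z"
    then obtain a b where "a \<in> c0" "b \<in> c0" "x = T a" "y = T b" by (auto simp: Z_def)
    thus "x + y \<in> Z" using imageI[OF c0_add, of a b T] T_add[of a b] by (simp add: Z_def)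
  next
    fix c x assume "x \<in> Z"
    then obtain a where "a \<in> c0" "x = T a" by (auto simp: Z_def)
    thus "c *\<^sub>R x \<in> Z" using imageI[OF c0_scale, of a T c] T_scale[of a c] by (simp add: Z_def)
  qed
  moreover have "closedin mtopology Z"
    unfolding metric_closedin_iff_sequentially_closed
  proof (intro conjI allI impI)
    show "Z \<subseteq> V" using ZW WV by blast
    fix s x assume sx: "range s \<subseteq> Z \<and> limitin mtopology s x sequentially"
    have "\<forall>n. \<exists>a. a \<in> c0 \<and> s n = T a" using sx by (auto simp: Z_def)
    then obtain \<alpha> where \<alpha>: "\<And>n. \<alpha> n \<in> c0" "\<And>n. s n = T (\<alpha> n)" by metis
    have x: "x \<in> V" and sV: "\<And>n. s n \<in> V" using sx TV \<alpha> by (auto simp: limitin_iff)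
    have unif: "\<exists>n0. \<forall>m\<ge>n0. \<forall>n\<ge>n0. \<forall>k. \<bar>\<alpha> n k - \<alpha> m k\<bar> < e" if e: "e > 0" for e
    proof -
      have "A * e / 2 > 0" using A e by simp
      then obtain n0 where n0: "\<And>n. n \<ge> n0 \<Longrightarrow> N (s n - x) < A * e / 2"
        using sx unfolding limitin_iff by meson
      have "\<bar>\<alpha> n k - \<alpha> m k\<bar> < e" if "m \<ge> n0" "n \<ge> n0" for m n k
      proof -
        have "A * \<bar>(\<alpha> n - \<alpha> m) k\<bar> \<le> N (s n - s m)"
          using T_ge[OF c0_diff[OF \<alpha>(1) \<alpha>(1)], of n m k] T_diff[OF \<alpha>(1) \<alpha>(1), of n m] \<alpha>(2) by simp
        also have "\<dots> \<le> N (s n - x) + N (s m - x)"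
          using norm_triangle[of "s n - x" "x - s m"] norm_diff_commute[OF x sV[of m]] x sV by simp
        also have "\<dots> < A * e" using n0[OF that(1)] n0[OF that(2)] by linarith
        finally show ?thesis using A by simp
      qed
      thus ?thesis by blast
    qed
    have "convergent (\<lambda>n. \<alpha> n k)" for k
    proof -
      have "Cauchy (\<lambda>n. \<alpha> n k)"
        by (rule metric_CauchyI) (use unif in \<open>force simp: dist_real_def\<close>)
      thus ?thesis by (rule Cauchy_convergent)
    qed
    then obtain a where a: "\<And>k. (\<lambda>n. \<alpha> n k) \<longlonglongrightarrow> a k" unfolding convergent_def by metis
    have near: "\<exists>n0. \<forall>m\<ge>n0. \<forall>k. \<bar>a k - \<alpha> m k\<bar> \<le> e" if e: "e > 0" for e
    proof -
      obtain n0 where n0: "\<forall>m\<ge>n0. \<forall>n\<ge>n0. \<forall>k. \<bar>\<alpha> n k - \<alpha> m k\<bar> < e" using unif[OF e] by blast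
      have "\<bar>a k - \<alpha> m k\<bar> \<le> e" if "m \<ge> n0" for m k
      proof (rule LIMSEQ_le_const2)
        show "(\<lambda>n. \<bar>\<alpha> n k - \<alpha> m k\<bar>) \<longlonglongrightarrow> \<bar>a k - \<alpha> m k\<bar>" by (intro tendsto_intros a)
        show "\<exists>N. \<forall>n\<ge>N. \<bar>\<alpha> n k - \<alpha> m k\<bar> \<le> e" using n0 that by (intro exI[of _ n0]) (auto intro: less_imp_le)
      qed
      thus ?thesis by blast
    qed
    have ac0: "a \<in> c0"
      unfolding c0_def
    proof (rule CollectI, rule LIMSEQ_I)
      fix e :: real assume e: "e > 0"
      obtain m where m: "\<forall>k. \<bar>a k - \<alpha> m k\<bar> \<le> e / 2" using near[of "e / 2"] e by auto
      obtain k0 where k0: "\<forall>k\<ge>k0. norm (\<alpha> m k - 0) < e / 2"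
        using \<alpha>(1)[of m] e LIMSEQ_D[of "\<alpha> m" 0 "e / 2"] unfolding c0_def by auto
      have "norm (a k - 0) < e" if "k \<ge> k0" for k
      proof -
        have "\<bar>\<alpha> m k\<bar> < e / 2" using k0 that by simp
        moreover have "\<bar>a k - \<alpha> m k\<bar> \<le> e / 2" using m by blast
        ultimately have "\<bar>a k\<bar> < e" by linarith
        thus ?thesis by simp
      qed
      thus "\<exists>no. \<forall>n\<ge>no. norm (a n - 0) < e" by blast
    qed
    have "limitin mtopology s (T a) sequentially"
      unfolding limitin_iff
    proof (intro conjI allI impI TV ac0)
      fix e :: real assume e: "e > 0"
      define c where "c = e / (2 * B')"
      have c: "c > 0" using e B' by (simp add: c_def)
      obtain n0 where n0: "\<forall>m\<ge>n0. \<forall>k. \<bar>a k - \<alpha> m k\<bar> \<le> c" using near[OF c] by blast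
      have "s n \<in> V \<and> N (s n - T a) < e" if "n \<ge> n0" for n
      proof -
        have "N (s n - T a) = N (T (\<alpha> n - a))" unfolding \<alpha>(2) T_diff[OF \<alpha>(1) ac0] ..
        also have "\<dots> \<le> B' * c"
          using n0 that c by (intro T_le c0_diff \<alpha> ac0) (auto simp: abs_minus_commute)
        also have "\<dots> < e" using e B' by (simp add: c_def)
        finally show ?thesis using sV by blast
      qed
      thus "\<exists>n0. \<forall>n\<ge>n0. s n \<in> V \<and> N (s n - T a) < e" by blast
    qed
    hence "x = T a" using sx limitin_unique by blast
    thus "x \<in> Z" using ac0 by (simp add: Z_def)
  qed
  moreover have "isomorphic_on Z N c0 sup_norm"
  proof -
    define U where "U = inv_into c0 T"
    have UT: "U (T a) = a" if "a \<in> c0" for a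
      unfolding U_def using inj that by (rule inv_into_f_f)
    have "linear_on Z U"
      unfolding linear_on_def Z_def
      using UT T_add T_scale c0_add c0_scale by (auto simp flip: T_add T_scale)
    moreover have "bij_betw U Z c0"
      unfolding U_def Z_def using inj by (intro bij_betw_inv_into) (simp add: bij_betw_def)
    moreover have "sup_norm (U x) \<le> (1 / A) * N x" if xZ: "x \<in> Z" for x
    proof -
      obtain a where a: "a \<in> c0" "x = T a" using xZ unfolding Z_def by blast
      show ?thesis
        unfolding a(2) UT[OF a(1)]
        using T_ge[OF a(1)] A by (intro sup_norm_le) (simp add: le_divide_eq mult.commute)
    qed
    moreover have "N x \<le> B' * sup_norm (U x)" if xZ: "x \<in> Z" for x
    proof -
      obtain a where a: "a \<in> c0" "x = T a" using xZ unfolding Z_def by blast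
      have "0 \<le> sup_norm a" using c0_abs_le_sup_norm[OF a(1), of 0] by linarith
      thus ?thesis
        unfolding a(2) UT[OF a(1)] using a c0_abs_le_sup_norm by (intro T_le) auto
    qed
    ultimately show ?thesis unfolding isomorphic_on_def by blast
  qed
  ultimately show ?thesis using ZW by blast
qed

section \<open>Saturation by copies of the space of null sequences\<close>

text \<open>Requiring one more coordinate to vanish lowers the dimension by at most one: modulo a
  single \<open>v\<close> with \<open>v n\<close> nonzero, every vector can be corrected to satisfy
  the new condition.\<close>

lemma infinite_dim_tail:
  fixes W :: "(nat \<Rightarrow> real) set"
  assumes W: "subspace W" "\<not> finite_dim W"
  shows "\<exists>w\<in>W. w \<noteq> 0 \<and> (\<forall>i<n. w i = 0)"
proof -
  have sub: "subspace {w\<in>W. \<forall>i<m. w i = 0}" for m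
    using W(1) by (auto simp: subspace_def)
  have "\<not> finite_dim {w\<in>W. \<forall>i<n. w i = 0}"
  proof (induction n)
    case (Suc n)
    show ?case
    proof
      assume "finite_dim {w\<in>W. \<forall>i<Suc n. w i = 0}"
      then obtain B where B: "finite B" "{w\<in>W. \<forall>i<Suc n. w i = 0} = span B" by (auto simp: finite_dim_def)
      show False
      proof (cases "\<exists>v\<in>W. (\<forall>i<n. v i = 0) \<and> v n \<noteq> 0")
        case False
        hence "{w\<in>W. \<forall>i<Suc n. w i = 0} = {w\<in>W. \<forall>i<n. w i = 0}" by (auto simp: less_Suc_eq)
        thus False using Suc B by (auto simp: finite_dim_def)
      next
        case True
        then obtain v where v: "v \<in> W" "\<forall>i<n. v i = 0" "v n \<noteq> 0" by blast
        have "{w\<in>W. \<forall>i<n. w i = 0} = span (insert v B)"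
        proof (intro equalityI subsetI)
          fix w assume w: "w \<in> {w\<in>W. \<forall>i<n. w i = 0}"
          have "w - (w n / v n) *\<^sub>R v \<in> {w\<in>W. \<forall>i<Suc n. w i = 0}"
            using w v W(1) by (auto simp: less_Suc_eq intro!: subspace_diff subspace_scale)
          hence "w - (w n / v n) *\<^sub>R v \<in> span B" using B(2) by blast
          thus "w \<in> span (insert v B)" unfolding span_insert by blast
        next
          fix w assume w: "w \<in> span (insert v B)"
          have "B \<subseteq> {w\<in>W. \<forall>i<Suc n. w i = 0}" unfolding B(2) by (rule span_superset)
          hence "insert v B \<subseteq> {w\<in>W. \<forall>i<n. w i = 0}" using v by auto
          hence "span (insert v B) \<subseteq> {w\<in>W. \<forall>i<n. w i = 0}" by (rule span_minimal[OF _ sub])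
          thus "w \<in> {w\<in>W. \<forall>i<n. w i = 0}" using w by blast
        qed
        thus False using Suc B(1) by (auto simp: finite_dim_def)
      qed
    qed
  qed (use W in simp)
  moreover have "finite_dim {0 :: nat \<Rightarrow> real}" by (auto simp: finite_dim_def intro!: exI[of _ "{}"])
  ultimately have "{w\<in>W. \<forall>i<n. w i = 0} \<noteq> {0}" by metis
  moreover have "0 \<in> {w\<in>W. \<forall>i<n. w i = 0}" using subspace_0[OF W(1)] by simp
  ultimately show ?thesis by blast
qed

lemma sum_half_powers_le: "finite I \<Longrightarrow> (\<Sum>k\<in>I. (1/2::real) ^ Suc k) \<le> 1"
  using sum_le_suminf[OF sums_summable[OF power_half_series], of I] sums_unique[OF power_half_series]
  by simp

context orlicz
begin

lemma supp_in_sum: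
  assumes "\<And>k. k \<in> I \<Longrightarrow> supp_in m n (w k)"
  shows "supp_in m n (sum w I)"
  using assms
proof (induction I rule: infinite_finite_induct)
  case (insert k I)
  hence "supp_in m n (w k)" "supp_in m n (sum w I)" by auto
  moreover have "w k i \<noteq> 0 \<or> sum w I i \<noteq> 0" if "(w k + sum w I) i \<noteq> 0" for i using that by auto
  ultimately have "supp_in m n (w k + sum w I)" unfolding supp_in_def by blast
  thus ?case unfolding sum.insert[OF insert.hyps] .
qed (auto simp: supp_in_def)

definition close_to :: "(nat \<Rightarrow> real) set \<Rightarrow> real \<Rightarrow> (nat \<Rightarrow> real) \<Rightarrow> bool"
  where "close_to W e w \<longleftrightarrow> (\<exists>z\<in>W. nm (w - z) \<le> e)"

definition unit_block :: "(nat \<Rightarrow> real) set \<Rightarrow> real \<Rightarrow> nat \<Rightarrow> (nat \<Rightarrow> real) \<Rightarrow> bool"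
  where "unit_block W e m w \<longleftrightarrow> w \<in> hM \<and> nm w = 1 \<and> (\<exists>n. supp_in m n w) \<and> close_to W e w"

text \<open>A vector of \<open>W\<close> that vanishes on the first \<open>m\<close> coordinates is
  truncated far out and normalised.\<close>

lemma unit_block_exists:
  assumes W: "subspace W" "W \<subseteq> hM" "\<not> finite_dim W" and e: "e > 0"
  shows "\<exists>w. unit_block W e m w"
proof -
  obtain v where v: "v \<in> W" "v \<noteq> 0" "\<forall>i<m. v i = 0" using infinite_dim_tail[OF W(1,3)] by blast
  have vh: "v \<in> hM" using v W by blast
  have nv: "nm v > 0" using norm_ge_0[OF vh] norm_eq_0[OF vh] v(2) by simp
  \<comment> \<open>The first bound keeps at least half of the norm of \<open>v\<close> after
    truncation; the second then gives an error of at most \<open>e\<close> after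
    normalisation.\<close>
  define d where "d = min (1/2) (e / 2) * nm v"
  have d: "d > 0" "d \<le> nm v / 2" "d \<le> e / 2 * nm v"
    using e nv unfolding d_def by (auto simp: min_def mult_right_mono)
  obtain n where n: "nm (v - trunc n v) < d" using norm_tail[OF vh d(1)] by auto
  define y where "y = trunc n v"
  have y: "y \<in> hM" using vh by (auto simp: y_def)
  have ny: "nm y \<ge> nm v / 2" using norm_triangle_diff[OF vh y] n d unfolding y_def by linarith
  hence ny0: "nm y > 0" using nv by linarith
  define w where "w = (1 / nm y) *\<^sub>R y"
  have "nm w = 1" using y ny0 by (simp add: w_def norm_scale)
  moreover have "supp_in m n w"
    using v(3) by (auto simp: supp_in_def w_def y_def trunc_def) (meson not_le)
  moreover have "close_to W e w"
    unfolding close_to_def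
  proof (rule bexI)
    have "w - (1 / nm y) *\<^sub>R v = (- (1 / nm y)) *\<^sub>R (v - y)"
      by (simp add: w_def scaleR_diff_right)
    hence "nm (w - (1 / nm y) *\<^sub>R v) = (1 / nm y) * nm (v - y)"
      using norm_scale[OF mem(3)[OF vh y], of "- (1 / nm y)"] ny0 by (simp only:) simp
    also have "\<dots> \<le> (1 / nm y) * (e / 2 * nm v)"
      using n d ny0 unfolding y_def by (intro mult_left_mono) auto
    also have "\<dots> \<le> (1 / nm y) * (e * nm y)"
      using ny ny0 e by (intro mult_left_mono) (auto simp: field_simps)
    also have "\<dots> = e" using ny0 by simp
    finally show "nm (w - (1 / nm y) *\<^sub>R v) \<le> e" .
    show "(1 / nm y) *\<^sub>R v \<in> W" using v(1) W(1) by (intro subspace_scale)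
  qed
  ultimately show ?thesis unfolding unit_block_def using y by (auto simp: w_def)
qed

text \<open>
  Otherwise, sums of \<open>K\<^sup>r\<close> disjoint unit blocks have norm at least \<open>4\<^sup>r\<close>, where \<open>1/K\<close> is a lower bound
  for the modular of a quarter of a unit block. This is incompatible with \<open>growth q\<close> if \<open>4\<^sup>q > K\<close>.
\<close>

lemma small_modular_block:
  assumes gr: "\<And>q. \<exists>C. growth q C"
    and W: "subspace W" "W \<subseteq> hM" "\<not> finite_dim W" and e: "e > 0"
  shows "\<exists>w. unit_block W e m w \<and> Mo ((1/4) *\<^sub>R w) \<le> e"
proof (rule ccontr)
  assume no: "\<not> ?thesis"
  \<comment> \<open>The errors form a geometric series with sum \<open>e\<close>, so every finite
    sum of these blocks is still within \<open>e\<close> of \<open>W\<close>.\<close>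
  have "\<exists>n w. supp_in p n w \<and> unit_block W (e * (1/2) ^ Suc k) p w" for k p
    using unit_block_exists[OF W, of "e * (1/2) ^ Suc k" p] e unfolding unit_block_def by fastforce
  hence "\<And>k p. \<exists>n w. supp_in p n w \<and> (w \<in> hM \<and> nm w = 1 \<and> close_to W (e * (1/2) ^ Suc k) w)"
    unfolding unit_block_def by meson
  then obtain n w where n: "n 0 = m" "mono n" "\<And>k. supp_in (n k) (n (Suc k)) (w k)"
    and w': "\<And>k. w k \<in> hM \<and> nm (w k) = 1 \<and> close_to W (e * (1/2) ^ Suc k) (w k)"
      "\<And>j k i. j \<noteq> k \<Longrightarrow> w j i = 0 \<or> w k i = 0"
    by (rule block_sequence[where b = m
          and Q = "\<lambda>k w. w \<in> hM \<and> nm w = 1 \<and> close_to W (e * (1/2) ^ Suc k) w"]) (rule that)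
  have w: "\<And>k. w k \<in> hM" "\<And>k. nm (w k) = 1" using w' by auto
  obtain z where z: "\<And>k. z k \<in> W" "\<And>k. nm (w k - z k) \<le> e * (1/2) ^ Suc k"
    using w'(1) unfolding close_to_def by metis
  have zh: "z k \<in> hM" for k using z W by blast
  have close: "close_to W e (sum w I)" if "finite I" for I
    unfolding close_to_def
  proof (rule bexI)
    have "nm (\<Sum>k\<in>I. w k - z k) \<le> (\<Sum>k\<in>I. nm (w k - z k))" using w zh by (intro norm_sum) auto
    also have "\<dots> \<le> (\<Sum>k\<in>I. e * (1/2) ^ Suc k)" using z by (intro sum_mono)
    also have "\<dots> = e * (\<Sum>k\<in>I. (1/2) ^ Suc k)" by (rule sum_distrib_left[symmetric])
    also have "\<dots> \<le> e * 1" using e sum_half_powers_le[OF that] by (intro mult_left_mono) auto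
    finally show "nm (sum w I - sum z I) \<le> e" by (simp add: sum_subtractf)
    show "sum z I \<in> W" using z by (intro subspace_sum[OF W(1)])
  qed
  have supp: "supp_in (n a) (n b) (sum w {a..<b})" for a b
  proof (rule supp_in_sum)
    fix k assume k: "k \<in> {a..<b}"
    have "n a \<le> n k" "n (Suc k) \<le> n b" using n(2) k by (auto simp: monoD)
    thus "supp_in (n a) (n b) (w k)" using n(3)[of k] unfolding supp_in_def by (meson le_trans less_le_trans)
  qed
  obtain K :: nat where K: "1 / e < real K" using reals_Archimedean2 by blast
  hence Ke: "1 < real K * e" using e by (simp add: divide_less_eq)
  have K0: "K > 0" using Ke by (cases K) auto
  \<comment> \<open>The induction is over all starting points \<open>l\<close>, because it uses
    \<open>K\<close> consecutive groups at different positions.\<close>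
  have lower: "4 ^ r \<le> nm (sum w {l..<l + K ^ r})" for r l
  proof (induction r arbitrary: l)
    case 0
    show ?case using w by simp
  next
    case (Suc r)
    define u where "u = (\<lambda>j. sum w {l + j * K ^ r..<l + j * K ^ r + K ^ r})"
    have uh: "u j \<in> hM" for j unfolding u_def using w by (intro sum_mem)
    have nu: "4 ^ r \<le> nm (u j)" for j unfolding u_def by (rule Suc)
    have nu0: "nm (u j) > 0" for j using nu[of j] by (meson less_le_trans zero_less_power zero_less_numeral)
    have total: "sum u {..<j} = sum w {l..<l + j * K ^ r}" for j
    proof (induction j)
      case (Suc j)
      have "sum u {..<Suc j} = sum w {l..<l + j * K ^ r} + u j" using Suc by (simp add: add.commute)
      also have "\<dots> = sum w {l..<l + j * K ^ r + K ^ r}"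
        unfolding u_def by (rule sum.atLeastLessThan_concat) auto
      finally show ?case by (simp add: algebra_simps)
    qed simp
    have udisj: "u j i = 0 \<or> u k i = 0" if "j \<noteq> k" for j k i
    proof -
      have "u j i = 0 \<or> u k i = 0" if "j < k" for j k i
      proof -
        have le: "l + j * K ^ r + K ^ r \<le> l + k * K ^ r"
          using that mult_le_mono1[of "Suc j" k "K ^ r"] by simp
        have "n (l + j * K ^ r + K ^ r) \<le> n (l + k * K ^ r)" using n(2) le by (rule monoD)
        thus ?thesis
          using supp[of "l + j * K ^ r" "l + j * K ^ r + K ^ r"] supp[of "l + k * K ^ r" "l + k * K ^ r + K ^ r"]
          unfolding u_def supp_in_def by (meson leD le_trans)
      qed
      from this[of j k i] this[of k j i] show ?thesis using that by (cases "j < k") auto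
    qed
    show ?case
    proof (rule ccontr)
      assume "\<not> ?case"
      hence "nm (sum u {..<K}) \<le> 4 ^ Suc r" unfolding total by (simp add: mult.commute)
      hence le1: "Mo ((1 / 4 ^ Suc r) *\<^sub>R sum u {..<K}) \<le> 1"
        using uh by (subst norm_le_iff[symmetric]) (auto intro: sum_mem)
      have "(1 / 4 ^ Suc r) *\<^sub>R sum u {..<K} = (\<Sum>j<K. (1 / 4 ^ Suc r) *\<^sub>R u j)"
        by (rule scaleR_sum_right)
      hence eq: "Mo ((1 / 4 ^ Suc r) *\<^sub>R sum u {..<K}) = (\<Sum>j<K. Mo ((1 / 4 ^ Suc r) *\<^sub>R u j))"
        using uh udisj by (simp only:) (intro Mo_sum mem, auto)
      have "e \<le> Mo ((1 / 4 ^ Suc r) *\<^sub>R u j)" for j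
      proof -
        define v where "v = (1 / nm (u j)) *\<^sub>R u j"
        have v: "v \<in> hM" using uh by (auto simp: v_def)
        have "nm v = 1" using uh[of j] nu0[of j] by (simp add: v_def norm_scale)
        moreover have "supp_in m (n (l + j * K ^ r + K ^ r)) v"
          using supp[of "l + j * K ^ r" "l + j * K ^ r + K ^ r"] monoD[OF n(2), of 0 "l + j * K ^ r"] n(1)
          unfolding v_def u_def supp_in_def by fastforce
        moreover have "close_to W e v"
        proof -
          obtain y where y: "y \<in> W" "nm (u j - y) \<le> e"
            using close[of "{l + j * K ^ r..<l + j * K ^ r + K ^ r}"] unfolding u_def close_to_def by auto
          have yh: "y \<in> hM" using y W by blast
          have "nm (v - (1 / nm (u j)) *\<^sub>R y) = (1 / nm (u j)) * nm (u j - y)"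
            unfolding v_def scaleR_diff_right[symmetric] norm_scale[OF mem(3)[OF uh yh]] using nu0[of j] by simp
          \<comment> \<open>Normalising divides by a number that is at least 1, so the distance to
            \<open>W\<close> does not grow and the negated claim applies to
            \<open>v\<close>.\<close>
          also have "\<dots> \<le> 1 * nm (u j - y)"
          proof (rule mult_right_mono)
            have "(1::real) \<le> 4 ^ r" by simp
            hence "1 \<le> nm (u j)" using nu[of j] by linarith
            thus "1 / nm (u j) \<le> 1" by simp
          qed (use uh yh in \<open>auto intro: norm_ge_0\<close>)
          finally show ?thesis unfolding close_to_def using y W(1)
            by (intro bexI[of _ "(1 / nm (u j)) *\<^sub>R y"] subspace_scale) auto
        qed
        ultimately have "unit_block W e m v" unfolding unit_block_def using v by blast
        hence "e \<le> Mo ((1/4) *\<^sub>R v)" using no by force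
        \<comment> \<open>By the induction hypothesis \<open>u j\<close> has norm at least
          \<open>4^r\<close>, so a quarter of its normalisation is dominated by
          \<open>u j / 4^(r+1)\<close>.\<close>
        also have "\<dots> \<le> Mo ((1 / 4 ^ Suc r) *\<^sub>R u j)"
        proof (rule Mo_mono)
          fix i
          have "1 / (4 * nm (u j)) \<le> 1 / 4 ^ Suc r"
            using nu[of j] nu0[of j] by (intro divide_left_mono) auto
          from mult_right_mono[OF this, of "\<bar>u j i\<bar>"]
          show "\<bar>((1/4) *\<^sub>R v) i\<bar> \<le> \<bar>((1 / 4 ^ Suc r) *\<^sub>R u j) i\<bar>"
            using nu0[of j] by (simp add: v_def abs_mult)
        qed (use uh v in auto)
        finally show ?thesis .
      qed
      hence "(\<Sum>j<K. e) \<le> (\<Sum>j<K. Mo ((1 / 4 ^ Suc r) *\<^sub>R u j))" by (intro sum_mono)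
      thus False using le1 eq Ke by simp
    qed
  qed
  \<comment> \<open>The factor 2 leaves a spare \<open>2^r\<close> when \<open>K^r\<close> is
    compared with \<open>4^(q r)\<close>. It absorbs \<open>C\<close> and the \<open>2^q\<close>
    lost by aiming at half of \<open>4^r\<close>; taking \<open>r\<close> positive makes that half
    at least 1.\<close>
  obtain q where q: "2 * real K < 4 ^ q" using real_arch_pow[of 4 "2 * real K"] by auto
  obtain C where C: "growth q C" using gr by blast
  obtain r0 where r0: "C * 2 ^ q < 2 ^ r0" using real_arch_pow[of 2 "C * 2 ^ q"] by auto
  define r where "r = Suc r0"
  have "(0::real) < 2 ^ r0" by simp
  hence r: "C * 2 ^ q \<le> 2 ^ r" using r0 unfolding r_def power_Suc by linarith
  have "nm (sum w {0..<0 + K ^ r}) \<le> 4 ^ r / 2"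
  proof (rule norm_disjoint_sum_le[OF C])
    have "(1::real) \<le> 4 ^ r0" by simp
    thus "1 \<le> 4 ^ r / (2::real)" unfolding r_def power_Suc by linarith
    have "real K ^ r * (C * 2 ^ q) \<le> real K ^ r * 2 ^ r" using r by (intro mult_left_mono) auto
    also have "\<dots> = (2 * real K) ^ r" by (simp add: power_mult_distrib)
    also have "\<dots> \<le> (4 ^ q) ^ r" using q by (intro power_mono) auto
    also have "\<dots> = (4 ^ r) ^ q" by (simp add: power_mult[symmetric] mult.commute)
    finally show "real (card {0..<0 + K ^ r}) * C \<le> (4 ^ r / 2) ^ q"
      by (simp add: power_divide le_divide_eq mult.assoc)
  qed (use w w'(2) in auto)
  moreover have "(4::real) ^ r / 2 < 4 ^ r" by simp
  ultimately show False using lower[of r 0] by linarith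
qed

text \<open>Unit blocks whose quarters have summably small modulars cannot build up a large norm
  under bounded coefficients, and disjointness gives the lower estimate. Both survive the passage to
  nearby vectors of \<open>W\<close>.\<close>

theorem c0_saturated:
  assumes gr: "\<And>q. \<exists>C. growth q C"
  shows "c0_saturated_on hM nm"
  unfolding c0_saturated_on_def norm_topology_eq
proof (intro allI impI)
  fix W assume "subspace W \<and> closedin mtopology W \<and> \<not> finite_dim W"
  hence W: "subspace W" "closedin mtopology W" "\<not> finite_dim W" by auto
  have Wh: "W \<subseteq> hM" using closedin_subset[OF W(2)] by simp
  have "\<exists>n w. supp_in p n w \<and> (w \<in> hM \<and> nm w = 1 \<and> close_to W (1/2 * (1/2) ^ Suc k) w
      \<and> Mo ((1/4) *\<^sub>R w) \<le> 1/2 * (1/2) ^ Suc k)" for k p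
    using small_modular_block[OF gr W(1) Wh W(3), of "1/2 * (1/2) ^ Suc k" p]
    unfolding unit_block_def by auto
  then obtain n w where "n 0 = (0::nat)" "mono n" "\<And>k. supp_in (n k) (n (Suc k)) (w k)"
    and w': "\<And>k. w k \<in> hM \<and> nm (w k) = 1 \<and> close_to W (1/2 * (1/2) ^ Suc k) (w k)
      \<and> Mo ((1/4) *\<^sub>R w k) \<le> 1/2 * (1/2) ^ Suc k"
    and disj: "\<And>j k i. j \<noteq> k \<Longrightarrow> w j i = 0 \<or> w k i = 0"
    by (rule block_sequence[where b = 0
          and Q = "\<lambda>k w. w \<in> hM \<and> nm w = 1 \<and> close_to W (1/2 * (1/2) ^ Suc k) w
            \<and> Mo ((1/4) *\<^sub>R w) \<le> 1/2 * (1/2) ^ Suc k"]) (rule that)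
  have w: "\<And>k. w k \<in> hM" "\<And>k. nm (w k) = 1" "\<And>k. Mo ((1/4) *\<^sub>R w k) \<le> 1/2 * (1/2) ^ Suc k"
    using w' by auto
  obtain z where z: "\<And>k. z k \<in> W" "\<And>k. nm (w k - z k) \<le> 1/2 * (1/2) ^ Suc k"
    using w' unfolding close_to_def by metis
  have zh: "z k \<in> hM" for k using z Wh by blast
  have diff: "nm ((\<Sum>k\<in>I. a k *\<^sub>R w k) - (\<Sum>k\<in>I. a k *\<^sub>R z k)) \<le> c / 2"
    if "finite I" "0 \<le> c" "\<And>k. k \<in> I \<Longrightarrow> \<bar>a k\<bar> \<le> c" for I a c
  proof -
    have "(\<Sum>k\<in>I. a k *\<^sub>R w k) - (\<Sum>k\<in>I. a k *\<^sub>R z k) = (\<Sum>k\<in>I. a k *\<^sub>R (w k - z k))"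
      by (simp add: sum_subtractf scaleR_diff_right)
    hence "nm ((\<Sum>k\<in>I. a k *\<^sub>R w k) - (\<Sum>k\<in>I. a k *\<^sub>R z k)) \<le> (\<Sum>k\<in>I. nm (a k *\<^sub>R (w k - z k)))"
      using w(1) zh by (simp only:) (intro norm_sum mem)
    also have "\<dots> \<le> (\<Sum>k\<in>I. c * (1/2 * (1/2) ^ Suc k))"
    proof (rule sum_mono)
      fix k assume "k \<in> I"
      thus "nm (a k *\<^sub>R (w k - z k)) \<le> c * (1/2 * (1/2) ^ Suc k)"
        unfolding norm_scale[OF mem(3)[OF w(1) zh]]
        using that z(2)[of k] norm_ge_0[OF mem(3)[OF w(1) zh], of k k] by (intro mult_mono) auto
    qed
    also have "\<dots> = c / 2 * (\<Sum>k\<in>I. (1/2) ^ Suc k)" unfolding sum_distrib_left by (rule sum.cong) auto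
    also have "\<dots> \<le> c / 2 * 1" using that sum_half_powers_le by (intro mult_left_mono) auto
    finally show ?thesis by simp
  qed
  have wsum: "(\<Sum>k\<in>I. a k *\<^sub>R w k) \<in> hM" "(\<Sum>k\<in>I. a k *\<^sub>R z k) \<in> hM" for I and a :: "nat \<Rightarrow> real"
    using w zh by (auto intro!: sum_mem)
  show "\<exists>Z. subspace Z \<and> Z \<subseteq> W \<and> closedin mtopology Z \<and> isomorphic_on Z nm c0 sup_norm"
  \<comment> \<open>For \<open>w\<close> the constants are 1 and 4. Replacing \<open>w\<close> by
    \<open>z\<close> costs at most half of the largest coefficient, which leaves \<open>1/2\<close>
    below and at most 5 above.\<close>
  proof (rule c0_copy[OF W(1,2) z(1), where A = "1/2" and B = 5])
    fix a :: "nat \<Rightarrow> real" and I c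
    assume I: "finite I" and c: "0 \<le> c" "\<And>k. k \<in> I \<Longrightarrow> \<bar>a k\<bar> \<le> c"
    show "nm (\<Sum>k\<in>I. a k *\<^sub>R z k) \<le> 5 * c"
    proof (cases "c = 0")
      case True
      hence "(\<Sum>k\<in>I. a k *\<^sub>R z k) = 0" using c(2) by (intro sum.neutral) auto
      thus ?thesis using True by simp
    next
      case False
      hence c0: "c > 0" using c by simp
      have "(1 / (4 * c)) *\<^sub>R (\<Sum>k\<in>I. a k *\<^sub>R w k) = (\<Sum>k\<in>I. (a k / (4 * c)) *\<^sub>R w k)"
        by (simp add: scaleR_sum_right)
      hence "Mo ((1 / (4 * c)) *\<^sub>R (\<Sum>k\<in>I. a k *\<^sub>R w k)) = (\<Sum>k\<in>I. Mo ((a k / (4 * c)) *\<^sub>R w k))"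
        using w(1) I disj by (simp only:) (intro Mo_sum mem, auto)
      also have "\<dots> \<le> (\<Sum>k\<in>I. (1/2) ^ Suc k)"
      proof (rule sum_mono)
        fix k assume k: "k \<in> I"
        have "Mo ((a k / (4 * c)) *\<^sub>R w k) \<le> Mo ((1/4) *\<^sub>R w k)"
        proof (rule Mo_mono)
          fix i
          have "\<bar>a k\<bar> * \<bar>w k i\<bar> \<le> c * \<bar>w k i\<bar>" using c(2)[OF k] by (intro mult_right_mono) auto
          thus "\<bar>((a k / (4 * c)) *\<^sub>R w k) i\<bar> \<le> \<bar>((1/4) *\<^sub>R w k) i\<bar>"
            using c0 by (simp add: abs_mult divide_le_eq mult.commute)
        qed (use w in auto)
        also have "\<dots> \<le> 1/2 * (1/2) ^ Suc k" by (rule w(3))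
        also have "\<dots> \<le> (1/2) ^ Suc k" by simp
        finally show "Mo ((a k / (4 * c)) *\<^sub>R w k) \<le> (1/2) ^ Suc k" .
      qed
      also have "\<dots> \<le> 1" by (rule sum_half_powers_le[OF I])
      finally have "nm (\<Sum>k\<in>I. a k *\<^sub>R w k) \<le> 4 * c"
        using norm_le_iff[OF wsum(1), of "4 * c"] c0 by simp
      moreover have "nm ((\<Sum>k\<in>I. a k *\<^sub>R w k) - (\<Sum>k\<in>I. a k *\<^sub>R z k)) \<le> c / 2" using I c by (rule diff)
      ultimately show ?thesis
        using norm_triangle_diff[OF wsum(2)[of a I] wsum(1)[of a I]]
          norm_diff_commute[OF wsum(2)[of a I] wsum(1)[of a I]] c0 by linarith
    qed
  next
    fix a :: "nat \<Rightarrow> real" and n k :: nat assume k: "k < n"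
    have ne: "(\<lambda>j. \<bar>a j\<bar>) ` {..<n} \<noteq> {}" using k by auto
    define c where "c = Max ((\<lambda>j. \<bar>a j\<bar>) ` {..<n})"
    have c: "\<bar>a j\<bar> \<le> c" if "j < n" for j unfolding c_def using that by (intro Max_ge) auto
    have "c \<in> (\<lambda>j. \<bar>a j\<bar>) ` {..<n}" unfolding c_def using ne by (intro Max_in) auto
    then obtain l where l: "l < n" "c = \<bar>a l\<bar>" by auto
    have "c = nm (a l *\<^sub>R w l)" using l w by (simp add: norm_scale)
    also have "\<dots> \<le> nm (\<Sum>j<n. a j *\<^sub>R w j)"
    proof (rule norm_mono[OF wsum(1)])
      fix i
      have eval: "(\<Sum>j\<in>J. a j *\<^sub>R w j) i = (\<Sum>j\<in>J. a j * w j i)" if "finite J" for J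
        using that by (induction J rule: finite_induct) auto
      show "\<bar>(a l *\<^sub>R w l) i\<bar> \<le> \<bar>(\<Sum>j<n. a j *\<^sub>R w j) i\<bar>"
      proof (cases "w l i = 0")
        case False
        hence "\<And>j. j \<noteq> l \<Longrightarrow> w j i = 0" using disj by blast
        hence "(\<Sum>j<n. a j * w j i) = (\<Sum>j\<in>{l}. a j * w j i)"
          using l by (intro sum.mono_neutral_right) auto
        thus ?thesis unfolding eval[OF finite_lessThan] by simp
      qed simp
    qed (use w in auto)
    finally have "c \<le> nm (\<Sum>j<n. a j *\<^sub>R w j)" .
    moreover have "nm ((\<Sum>j<n. a j *\<^sub>R w j) - (\<Sum>j<n. a j *\<^sub>R z j)) \<le> c / 2"
      using c l by (intro diff) auto
    ultimately have "c / 2 \<le> nm (\<Sum>j<n. a j *\<^sub>R z j)"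
      using norm_triangle_diff[OF wsum(1)[of a "{..<n}"] wsum(2)[of a "{..<n}"]] by linarith
    thus "1/2 * \<bar>a k\<bar> \<le> nm (\<Sum>j<n. a j *\<^sub>R z j)" using c[OF k] by linarith
  qed simp
qed

end

section \<open>Orlicz sequence spaces without polyhedral renorming\<close>

context orlicz
begin

text \<open>
  If the functionals \<open>g n\<close> formed an attained norm, inflating \<open>g n\<close> by the factor \<open>1 + 1/(n+1)\<close> would
  give a norm \<open>P\<close> for which only finitely many functionals matter near any \<open>x \<noteq> 0\<close>, so that
  \<open>P (x + t e\<^sub>j) \<rightarrow> P x\<close> for small \<open>t\<close>. Adding greedily coordinates \<open>\<tau> n\<close>, with \<open>n\<close> minimal, that
  increase \<open>P\<close> by at most a quarter of the increase of the modular keeps \<open>P\<close> bounded, and the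
  condition on \<open>\<tau>\<close> makes the process converge; at its limit \<open>P\<close> is not flat.
\<close>

lemma no_attained_norm:
  fixes \<tau> :: "nat \<Rightarrow> real" and g :: "nat \<Rightarrow> (nat \<Rightarrow> real) \<Rightarrow> real"
  assumes gr: "growth 2 C"
    and \<tau>: "\<And>n. \<tau> n > 0" "\<And>n. M (\<tau> n) > 0" "\<tau> \<longlonglongrightarrow> 0"
    and \<tau>_doubling: "\<And>c. c > 0 \<Longrightarrow> \<exists>B. \<forall>n. M (c * \<tau> n) \<le> B * M (\<tau> n)"
    and lin: "\<And>n. linear_on hM (g n)"
    and bd: "\<And>n x. x \<in> hM \<Longrightarrow> \<bar>g n x\<bar> \<le> D * nm x"
    and att: "\<And>x. x \<in> hM \<Longrightarrow> \<exists>n. nm x \<le> \<bar>g n x\<bar> \<and> (\<forall>m. \<bar>g m x\<bar> \<le> \<bar>g n x\<bar>)"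
  shows False
proof -
  let ?u = "nm (unit_seq 0)"
  have D: "D \<ge> 1"
  proof -
    obtain n where "?u \<le> \<bar>g n (unit_seq 0)\<bar>" using att[of "unit_seq 0"] by auto
    also have "\<dots> \<le> D * ?u" by (rule bd) simp
    finally show ?thesis using norm_unit_pos by simp
  qed
  define q where "q = (\<lambda>n. 1 + 1 / real (Suc n))"
  have q: "1 \<le> q n" "q n \<le> 2" for n by (auto simp: q_def)
  define P where "P = (\<lambda>x. SUP n. q n * \<bar>g n x\<bar>)"
  have qg: "q n * \<bar>g n x\<bar> \<le> 2 * (D * nm x)" if "x \<in> hM" for n x
    using q[of n] bd[OF that, of n] by (intro mult_mono) auto
  have P_upper: "q n * \<bar>g n x\<bar> \<le> P x" if "x \<in> hM" for n x
    unfolding P_def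
    by (rule cSUP_upper) (use qg[OF that] in \<open>auto simp: bdd_above_def\<close>)
  have P_least: "P x \<le> c" if "\<And>n. q n * \<bar>g n x\<bar> \<le> c" for x c
    unfolding P_def using that by (intro cSUP_least) auto
  have P_le: "P x \<le> 2 * D * nm x" if "x \<in> hM" for x
    using qg[OF that] by (intro P_least) (simp add: mult.assoc)
  have P_ge: "nm x \<le> P x" if x: "x \<in> hM" for x
  proof -
    obtain n where "nm x \<le> \<bar>g n x\<bar>" using att[OF x] by blast
    also have "\<dots> \<le> q n * \<bar>g n x\<bar>" using mult_right_mono[OF q(1), of "\<bar>g n x\<bar>" n] by simp
    also have "\<dots> \<le> P x" by (rule P_upper[OF x])
    finally show ?thesis .
  qed
  have P_add: "P (x + y) \<le> P x + P y" if xy: "x \<in> hM" "y \<in> hM" for x y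
  proof (rule P_least)
    fix n
    have "q n * \<bar>g n (x + y)\<bar> \<le> q n * (\<bar>g n x\<bar> + \<bar>g n y\<bar>)"
      using linear_on_simps(1)[OF lin xy] q(1)[of n] by (intro mult_left_mono) auto
    also have "\<dots> \<le> P x + P y" using P_upper[OF xy(1), of n] P_upper[OF xy(2), of n] by (simp add: distrib_left)
    finally show "q n * \<bar>g n (x + y)\<bar> \<le> P x + P y" .
  qed
  have P_Lip: "P x \<le> P y + 2 * D * nm (x - y)" if xy: "x \<in> hM" "y \<in> hM" for x y
    using P_add[of y "x - y"] P_le[of "x - y"] xy by auto
  have flat: "\<exists>t0>0. \<forall>t. 0 < t \<longrightarrow> t \<le> t0 \<longrightarrow> (\<forall>\<delta>>0. \<exists>J. \<forall>j\<ge>J. P (x + t *\<^sub>R unit_seq j) \<le> P x + \<delta>)"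
    if x: "x \<in> hM" "x \<noteq> 0" for x
  proof -
    obtain m where m: "nm x \<le> \<bar>g m x\<bar>" "\<And>n. \<bar>g n x\<bar> \<le> \<bar>g m x\<bar>" using att[OF x(1)] by blast
    define \<mu> where "\<mu> = \<bar>g m x\<bar>"
    have \<mu>: "\<mu> > 0" using m(1) norm_ge_0[OF x(1)] norm_eq_0[OF x(1)] x(2) by (simp add: \<mu>_def)
    \<comment> \<open>For \<open>t\<close> up to \<open>t0\<close> a far coordinate changes each
      \<open>g n\<close> by at most \<open>\<mu> / (4 (m + 1))\<close>.\<close>
    define t0 where "t0 = \<mu> / (4 * D * ?u * real (Suc m))"
    have t0: "t0 > 0" using \<mu> D norm_unit_pos by (simp add: t0_def)
    have "\<exists>J. \<forall>j\<ge>J. P (x + t *\<^sub>R unit_seq j) \<le> P x + \<delta>" if t: "0 < t" "t \<le> t0" and \<delta>: "\<delta> > 0" for t \<delta>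
    proof -
      define e where "e = \<delta> / (2 * t * ?u)"
      have e: "e > 0" using \<delta> t norm_unit_pos by (simp add: e_def)
      have "\<exists>J. \<forall>y\<in>hM. (\<forall>i<J. y i = 0) \<longrightarrow> \<bar>g n y\<bar> \<le> e * nm y" for n
        by (rule functional_small_on_tails[OF gr lin bd e])
      then obtain J where J: "\<And>n y. y \<in> hM \<Longrightarrow> \<forall>i<J n. y i = 0 \<Longrightarrow> \<bar>g n y\<bar> \<le> e * nm y" by metis
      define J0 where "J0 = (\<Sum>n\<le>2 * m. J n)"
      have "P (x + t *\<^sub>R unit_seq j) \<le> P x + \<delta>" if j: "j \<ge> J0" for j
      proof (rule P_least)
        fix n
        have gn: "\<bar>g n (x + t *\<^sub>R unit_seq j)\<bar> \<le> \<bar>g n x\<bar> + t * \<bar>g n (unit_seq j)\<bar>"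
        proof -
          have "g n (x + t *\<^sub>R unit_seq j) = g n x + t * g n (unit_seq j)"
            using linear_on_simps(1)[OF lin x(1), of "t *\<^sub>R unit_seq j" n]
              linear_on_simps(2)[OF lin unit_seq_mem unit_seq_mem, of n t j] by simp
          also have "\<bar>\<dots>\<bar> \<le> \<bar>g n x\<bar> + \<bar>t * g n (unit_seq j)\<bar>" by (rule abs_triangle_ineq)
          finally show ?thesis using t by (simp add: abs_mult)
        qed
        show "q n * \<bar>g n (x + t *\<^sub>R unit_seq j)\<bar> \<le> P x + \<delta>"
        proof (cases "n \<le> 2 * m")
          case True
          have "J n \<le> J0" unfolding J0_def using True by (intro member_le_sum) auto
          hence "\<bar>g n (unit_seq j)\<bar> \<le> e * nm (unit_seq j)"
            using j by (intro J unit_seq_mem) (auto simp: unit_seq_def)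
          hence "t * \<bar>g n (unit_seq j)\<bar> \<le> t * (e * ?u)"
            using t norm_unit_eq[of j] by (intro mult_left_mono) auto
          also have "\<dots> = \<delta> / 2" using t norm_unit_pos by (simp add: e_def)
          finally have "\<bar>g n (x + t *\<^sub>R unit_seq j)\<bar> \<le> \<bar>g n x\<bar> + \<delta> / 2" using gn by linarith
          hence "q n * \<bar>g n (x + t *\<^sub>R unit_seq j)\<bar> \<le> q n * (\<bar>g n x\<bar> + \<delta> / 2)"
            using q(1)[of n] by (intro mult_left_mono) auto
          also have "\<dots> = q n * \<bar>g n x\<bar> + q n * (\<delta> / 2)" by (rule distrib_left)
          also have "\<dots> \<le> P x + 2 * (\<delta> / 2)"
            using q(2)[of n] \<delta> by (intro add_mono P_upper[OF x(1)] mult_right_mono) auto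
          finally show ?thesis by simp
        next
          case False
          have "t * \<bar>g n (unit_seq j)\<bar> \<le> t0 * (D * ?u)"
            using t D bd[of "unit_seq j" n] norm_unit_eq[of j] norm_unit_pos by (intro mult_mono) auto
          also have "\<dots> = \<mu> / (4 * real (Suc m))" using D norm_unit_pos by (simp add: t0_def)
          finally have "\<bar>g n (x + t *\<^sub>R unit_seq j)\<bar> \<le> \<mu> + \<mu> / (4 * real (Suc m))"
            using gn m(2)[of n] unfolding \<mu>_def by linarith
          hence "q n * \<bar>g n (x + t *\<^sub>R unit_seq j)\<bar> \<le> q n * (\<mu> + \<mu> / (4 * real (Suc m)))"
            using q(1)[of n] by (intro mult_left_mono) auto
          also have "\<dots> = q n * \<mu> + q n * (\<mu> / (4 * real (Suc m)))" by (rule distrib_left)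
          \<comment> \<open>Since \<open>n > 2 m\<close>, the excess of \<open>q n\<close> over 1 is
            at most half of that of \<open>q m\<close>. The other half pays for the perturbation,
            and the total is exactly \<open>q m * \<mu>\<close>.\<close>
          also have "\<dots> \<le> (1 + 1 / (2 * real (Suc m))) * \<mu> + 2 * (\<mu> / (4 * real (Suc m)))"
          proof (intro add_mono mult_right_mono q(2))
            have "2 * real (Suc m) \<le> real (Suc n)" using False by simp
            hence "1 / real (Suc n) \<le> 1 / (2 * real (Suc m))" by (intro divide_left_mono) auto
            thus "q n \<le> 1 + 1 / (2 * real (Suc m))" by (simp add: q_def)
          qed (use \<mu> in auto)
          also have "\<dots> = q m * \<mu>" by (simp add: q_def field_simps del: of_nat_Suc)
          also have "\<dots> \<le> P x" unfolding \<mu>_def by (rule P_upper[OF x(1)])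
          finally show ?thesis using \<delta> by simp
        qed
      qed
      thus ?thesis by blast
    qed
    thus ?thesis using t0 by blast
  qed
  have flat_\<tau>: "\<exists>n. M (\<tau> n) \<le> 1/2 \<and> (\<forall>\<delta>>0. \<exists>J. \<forall>j\<ge>J. P (x + \<tau> n *\<^sub>R unit_seq j) \<le> P x + \<delta>)"
    if x: "x \<in> hM" "x \<noteq> 0" for x
  proof -
    obtain t0 where t0: "t0 > 0" "\<And>t \<delta>. 0 < t \<Longrightarrow> t \<le> t0 \<Longrightarrow> \<delta> > 0 \<Longrightarrow> \<exists>J. \<forall>j\<ge>J. P (x + t *\<^sub>R unit_seq j) \<le> P x + \<delta>"
      using flat[OF x] by blast
    obtain s where s: "s > 0" "M s \<le> 1/2" using M_small[of "1/2"] by auto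
    obtain n where "norm (\<tau> n - 0) < min t0 s"
      using LIMSEQ_D[OF \<tau>(3), of "min t0 s"] t0(1) s(1) by auto
    hence n: "\<tau> n \<le> t0" "\<tau> n \<le> s" by auto
    have "M (\<tau> n) \<le> M s" using n \<tau>(1)[of n] by (intro M_mono) auto
    thus ?thesis using s(2) t0(2)[OF \<tau>(1) n(1)] by (intro exI[of _ n]) auto
  qed
  define ok where "ok = (\<lambda>x n. M (\<tau> n) \<le> 1/2 \<and>
    (\<forall>J. \<exists>j\<ge>J. P (x + \<tau> n *\<^sub>R unit_seq j) \<le> P x + M (\<tau> n) / 4))"
  \<comment> \<open>Freely chosen indices could make the steps summable without contradiction.
    Minimality prevents this: an index admissible at all late stages bounds the ones used
    there.\<close>
  define L where "L = (\<lambda>x. LEAST n. ok x n)"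
  have ok_L: "ok x (L x)" if x: "x \<in> hM" "x \<noteq> 0" for x
  proof -
    obtain n where n: "M (\<tau> n) \<le> 1/2" "\<And>\<delta>. \<delta> > 0 \<Longrightarrow> \<exists>J. \<forall>j\<ge>J. P (x + \<tau> n *\<^sub>R unit_seq j) \<le> P x + \<delta>"
      using flat_\<tau>[OF x] by blast
    obtain J where J: "\<forall>j\<ge>J. P (x + \<tau> n *\<^sub>R unit_seq j) \<le> P x + M (\<tau> n) / 4"
      using n(2)[of "M (\<tau> n) / 4"] \<tau>(2)[of n] by auto
    have "ok x n" unfolding ok_def using n(1) J by (metis nat_le_linear)
    thus ?thesis unfolding L_def by (rule LeastI)
  qed
  define a where "a = 1 / (8 * D * ?u)"
  have a: "a > 0" using D norm_unit_pos by (simp add: a_def)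
  \<comment> \<open>Coordinate 0 keeps the value \<open>a\<close>, so the limit is nonzero;
    \<open>a\<close> is chosen to make \<open>P\<close> at most \<open>1/4\<close> at the start.
    From there on \<open>P\<close> grows by at most a quarter of the growth of the modular.\<close>
  define Inv where "Inv = (\<lambda>(x, J). x \<in> hM \<and> 1 \<le> J \<and> (\<forall>i\<ge>J. x i = 0) \<and> x 0 = a \<and> Mo x \<le> 1/2 \<and> P x \<le> 1/4 + Mo x / 4)"
  define Rel where "Rel = (\<lambda>(x, J) (x', J'). \<exists>j\<ge>J. x' = x + \<tau> (L x) *\<^sub>R unit_seq j \<and> J' = Suc j \<and> Mo x' = Mo x + M (\<tau> (L x)))"
  have "\<exists>st. \<forall>k. Inv (st k) \<and> Rel (st k) (st (Suc k))"
  proof (rule dependent_nat_choice)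
    have "P (a *\<^sub>R unit_seq 0) \<le> 2 * D * (a * ?u)"
      using P_le[of "a *\<^sub>R unit_seq 0"] a by (simp add: norm_scale)
    also have "\<dots> = 1/4" using D norm_unit_pos by (simp add: a_def)
    finally have P0: "P (a *\<^sub>R unit_seq 0) \<le> 1/4" .
    hence "nm (a *\<^sub>R unit_seq 0) \<le> 1/4" using P_ge[of "a *\<^sub>R unit_seq 0"] by auto
    hence "Mo (a *\<^sub>R unit_seq 0) \<le> 1/4" by (intro Mo_le_norm) auto
    moreover have "0 \<le> Mo (a *\<^sub>R unit_seq 0)" by (intro Mo_nonneg mem unit_seq_mem)
    moreover have "a *\<^sub>R unit_seq 0 \<in> hM" by simp
    moreover have "(a *\<^sub>R unit_seq 0) 0 = a" "\<forall>i\<ge>1. (a *\<^sub>R unit_seq 0) i = 0"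
      by (auto simp: unit_seq_def)
    ultimately have "Inv (a *\<^sub>R unit_seq 0, 1)"
      using P0 by (simp add: Inv_def)
    thus "\<exists>s. Inv s" by blast
  next
    fix s and k :: nat assume Inv: "Inv s"
    obtain x J where s: "s = (x, J)" by (cases s)
    have x: "x \<in> hM" "1 \<le> J" "\<forall>i\<ge>J. x i = 0" "x 0 = a" "Mo x \<le> 1/2" "P x \<le> 1/4 + Mo x / 4"
      using Inv by (auto simp: Inv_def s)
    have "x \<noteq> 0" using x(4) a by auto
    hence "ok x (L x)" by (rule ok_L[OF x(1)])
    then obtain j where j: "j \<ge> J" "P (x + \<tau> (L x) *\<^sub>R unit_seq j) \<le> P x + M (\<tau> (L x)) / 4"
      and half: "M (\<tau> (L x)) \<le> 1/2" unfolding ok_def by blast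
    define x' where "x' = x + \<tau> (L x) *\<^sub>R unit_seq j"
    have x'h: "x' \<in> hM" using x(1) by (simp add: x'_def)
    have "x i = 0 \<or> (\<tau> (L x) *\<^sub>R unit_seq j) i = 0" for i
      using x(3) j(1) by (cases "i = j") (auto simp: unit_seq_def)
    hence Mo': "Mo x' = Mo x + M (\<tau> (L x))"
      unfolding x'_def using x(1) \<tau>(1)[of "L x"] by (subst Mo_add) (auto simp: Mo_unit)
    have P': "P x' \<le> 1/4 + Mo x' / 4" using j(2) x(6) unfolding x'_def[symmetric] Mo' add_divide_distrib by linarith
    \<comment> \<open>A step yields only the modular bound \<open>1/2 + 1/2 = 1\<close>. The budget
      turns it into norm at most \<open>1/4 + 1/4\<close>, and in the unit ball the modular is at
      most the norm, which restores the bound \<open>1/2\<close>.\<close>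
    have "nm x' \<le> 1/2" using P_ge[OF x'h] P' Mo' half x(5) by linarith
    hence "Mo x' \<le> 1/2" using x'h by (intro Mo_le_norm) auto
    moreover have "\<forall>i\<ge>Suc j. x' i = 0" using x(3) j(1) by (auto simp: x'_def unit_seq_def)
    moreover have "x' 0 = a" using x(2,4) j(1) by (simp add: x'_def unit_seq_def)
    ultimately have "Inv (x', Suc j) \<and> Rel s (x', Suc j)"
      using x'h P' Mo' j(1) by (auto simp: Inv_def Rel_def s x'_def)
    thus "\<exists>s'. Inv s' \<and> Rel s s'" by blast
  qed
  then obtain st where st: "\<And>k. Inv (st k)" "\<And>k. Rel (st k) (st (Suc k))" by blast
  define x where "x = (\<lambda>k. fst (st k))"
  define J where "J = (\<lambda>k. snd (st k))"
  define n where "n = (\<lambda>k. L (x k))"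
  have x: "x k \<in> hM" "x k 0 = a" "Mo (x k) \<le> 1/2" for k
    using st(1)[of k] by (auto simp: Inv_def x_def split: prod.splits)
  have "\<exists>j\<ge>J k. x (Suc k) = x k + \<tau> (n k) *\<^sub>R unit_seq j \<and> J (Suc k) = Suc j \<and> Mo (x (Suc k)) = Mo (x k) + M (\<tau> (n k))" for k
    using st(2)[of k] by (auto simp: Rel_def x_def J_def n_def split: prod.splits)
  then obtain j where j: "\<And>k. J k \<le> j k" "\<And>k. x (Suc k) = x k + \<tau> (n k) *\<^sub>R unit_seq (j k)"
    "\<And>k. J (Suc k) = Suc (j k)" "\<And>k. Mo (x (Suc k)) = Mo (x k) + M (\<tau> (n k))" by metis
  have "strict_mono j"
    unfolding strict_mono_Suc_iff using j(1)[of "Suc k" for k] j(3) by (simp add: Suc_le_eq)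
  hence j_inj: "j i \<noteq> j k" if "i \<noteq> k" for i k using that by (simp add: strict_mono_eq)
  have "(\<Sum>i<k. M (\<tau> (n i))) = Mo (x k) - Mo (x 0)" for k
    by (induction k) (auto simp: j(4))
  hence "(\<Sum>i<k. M (\<tau> (n i))) \<le> 1/2" for k using x(3)[of k] Mo_nonneg[OF x(1), of 0] by simp
  hence summ: "summable (\<lambda>i. M (\<tau> (n i)))"
    using \<tau>(2) by (intro summableI_nonneg_bounded[of _ "1/2"]) (auto intro: less_imp_le)
  have diff: "x l - x k = (\<Sum>i\<in>{k..<l}. \<tau> (n i) *\<^sub>R unit_seq (j i))" if "k \<le> l" for k l
    using that
  proof (induction l rule: dec_induct)
    case (step m)
    have "x (Suc m) - x k = (x m - x k) + \<tau> (n m) *\<^sub>R unit_seq (j m)"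
      unfolding j(2) by (simp only: diff_add_eq)
    thus ?case unfolding step.IH sum.atLeastLessThan_Suc[OF step.hyps(1)] .
  qed simp
  have "\<exists>X. limitin mtopology x X sequentially"
  proof (rule Cauchy_limit[OF x(1)])
    fix e :: real assume e: "e > 0"
    \<comment> \<open>The condition on \<open>\<tau>\<close> lets a small tail of the summable
      series of \<open>M (\<tau> (n i))\<close> control the modular after scaling by
      \<open>2 / e\<close>, that is, the norm of the tail.\<close>
    obtain B where B: "\<And>n. M (2 / e * \<tau> n) \<le> B * M (\<tau> n)" using \<tau>_doubling[of "2 / e"] e by auto
    have "1 / (\<bar>B\<bar> + 1) > 0" by simp
    then obtain n0 where n0: "\<forall>k\<ge>n0. \<forall>l. norm (\<Sum>i\<in>{k..<l}. M (\<tau> (n i))) < 1 / (\<bar>B\<bar> + 1)"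
      using summ unfolding summable_Cauchy by blast
    have "nm (x l - x k) < e" if k: "n0 \<le> k" "k \<le> l" for k l
    proof -
      have "(1 / (e / 2)) *\<^sub>R (x l - x k) = (\<Sum>i\<in>{k..<l}. (2 / e * \<tau> (n i)) *\<^sub>R unit_seq (j i))"
        unfolding diff[OF k(2)] by (simp add: scaleR_sum_right)
      hence "Mo ((1 / (e / 2)) *\<^sub>R (x l - x k)) = (\<Sum>i\<in>{k..<l}. Mo ((2 / e * \<tau> (n i)) *\<^sub>R unit_seq (j i)))"
      proof (simp only:, intro Mo_sum)
        fix i i' m :: nat assume "i \<noteq> i'"
        thus "((2 / e * \<tau> (n i)) *\<^sub>R unit_seq (j i)) m = 0 \<or> ((2 / e * \<tau> (n i')) *\<^sub>R unit_seq (j i')) m = 0"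
          using j_inj by (auto simp: unit_seq_def)
      qed (intro mem unit_seq_mem finite_atLeastLessThan)+
      also have "\<dots> = (\<Sum>i\<in>{k..<l}. M (2 / e * \<tau> (n i)))"
        using e \<tau>(1) by (intro sum.cong refl) (simp add: Mo_unit abs_mult abs_of_pos)
      also have "\<dots> \<le> (\<Sum>i\<in>{k..<l}. \<bar>B\<bar> * M (\<tau> (n i)))"
      proof (rule sum_mono)
        fix i
        have "M (2 / e * \<tau> (n i)) \<le> B * M (\<tau> (n i))" by (rule B)
        also have "\<dots> \<le> \<bar>B\<bar> * M (\<tau> (n i))" using \<tau>(2)[of "n i"] by (intro mult_right_mono) auto
        finally show "M (2 / e * \<tau> (n i)) \<le> \<bar>B\<bar> * M (\<tau> (n i))" .
      qed
      also have "\<dots> = \<bar>B\<bar> * (\<Sum>i\<in>{k..<l}. M (\<tau> (n i)))" by (simp add: sum_distrib_left)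
      also have "\<dots> \<le> \<bar>B\<bar> * (1 / (\<bar>B\<bar> + 1))"
        using n0 k(1) by (intro mult_left_mono) (auto intro: less_imp_le dest: abs_less_iff[THEN iffD1] spec)
      also have "\<dots> \<le> 1" by (simp add: divide_le_eq)
      finally have "nm (x l - x k) \<le> e / 2" using norm_le_iff[of "x l - x k" "e / 2"] x(1) e by simp
      thus ?thesis using e by simp
    qed
    thus "\<exists>n0. \<forall>m\<ge>n0. \<forall>n\<ge>m. nm (x n - x m) < e" by blast
  qed
  then obtain X where "limitin mtopology x X sequentially" ..
  hence X: "X \<in> hM" "\<And>e. e > 0 \<Longrightarrow> \<exists>k0. \<forall>k\<ge>k0. nm (x k - X) < e"
    unfolding limitin_iff by (blast, meson)
  have "X \<noteq> 0"
  proof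
    assume "X = 0"
    then obtain k where "nm (x k) < a * ?u" using X(2)[of "a * ?u"] a norm_unit_pos by auto
    thus False using coord_le[OF x(1), of k 0] x(2)[of k] a by simp
  qed
  then obtain N where N: "M (\<tau> N) \<le> 1/2" "\<And>\<delta>. \<delta> > 0 \<Longrightarrow> \<exists>J. \<forall>j\<ge>J. P (X + \<tau> N *\<^sub>R unit_seq j) \<le> P X + \<delta>"
    using flat_\<tau>[OF X(1)] by blast
  define \<eta> where "\<eta> = M (\<tau> N)"
  have \<eta>: "\<eta> > 0" unfolding \<eta>_def by (rule \<tau>(2))
  have "\<eta> / (32 * D) > 0" using \<eta> D by simp
  then obtain k0 where k0: "\<And>k. k \<ge> k0 \<Longrightarrow> nm (x k - X) < \<eta> / (32 * D)" using X(2) by blast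
  \<comment> \<open>The index \<open>N\<close> belongs to the limit \<open>X\<close>. Passing from
    \<open>x k\<close> to \<open>X\<close> and back costs \<open>\<eta> / 16\<close> each time and
    flatness at \<open>X\<close> costs \<open>\<eta> / 8\<close>, in total the quarter allowed by
    \<open>ok\<close>.\<close>
  have nN: "n k \<le> N" if k: "k \<ge> k0" for k
  proof -
    have "2 * D * nm (x k - X) \<le> 2 * D * (\<eta> / (32 * D))"
      using k0[OF k] D by (intro mult_left_mono) auto
    also have "\<dots> = \<eta> / 16" using D by simp
    finally have close: "2 * D * nm (x k - X) \<le> \<eta> / 16" .
    obtain J where J: "\<forall>j\<ge>J. P (X + \<tau> N *\<^sub>R unit_seq j) \<le> P X + \<eta> / 8" using N(2)[of "\<eta> / 8"] \<eta> by auto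
    have "P (x k + \<tau> N *\<^sub>R unit_seq j) \<le> P (x k) + M (\<tau> N) / 4" if "j \<ge> J" for j
    proof -
      have "P (x k + \<tau> N *\<^sub>R unit_seq j) \<le> P (X + \<tau> N *\<^sub>R unit_seq j) + 2 * D * nm (x k - X)"
        using P_Lip[of "x k + \<tau> N *\<^sub>R unit_seq j" "X + \<tau> N *\<^sub>R unit_seq j"] x(1) X(1) by simp
      moreover have "P X \<le> P (x k) + 2 * D * nm (x k - X)"
        using P_Lip[OF X(1) x(1)[of k]] norm_diff_commute[OF X(1) x(1)[of k]] by simp
      moreover have "P (X + \<tau> N *\<^sub>R unit_seq j) \<le> P X + \<eta> / 8" using J that by blast
      ultimately show ?thesis using close \<eta> unfolding \<eta>_def by linarith
    qed
    hence "ok (x k) N" unfolding ok_def using N(1) by (metis nat_le_linear)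
    thus ?thesis unfolding n_def L_def by (rule Least_le)
  qed
  \<comment> \<open>Late steps use only indices up to \<open>N\<close>, so their modular increments
    have a positive minimum, against summability.\<close>
  define \<mu> where "\<mu> = Min ((\<lambda>i. M (\<tau> i)) ` {..N})"
  have "\<mu> > 0" unfolding \<mu>_def using \<tau>(2) by (subst Min_gr_iff) auto
  then obtain k1 where "\<forall>k\<ge>k1. norm (M (\<tau> (n k)) - 0) < \<mu>"
    using LIMSEQ_D[OF summable_LIMSEQ_zero[OF summ]] by blast
  hence "\<bar>M (\<tau> (n (max k0 k1)))\<bar> < \<mu>" by simp
  moreover have "\<mu> \<le> M (\<tau> (n (max k0 k1)))"
    unfolding \<mu>_def using nN[of "max k0 k1"] by (intro Min_le) auto
  ultimately show False by linarith
qed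

text \<open>The countable boundary of the polyhedral space is pulled back along the isomorphism. It
  then attains an equivalent norm, which a constant factor lifts above the original norm.\<close>

theorem not_isomorphically_polyhedral:
  fixes \<tau> :: "nat \<Rightarrow> real"
  assumes gr: "growth 2 C"
    and \<tau>: "\<And>n. \<tau> n > 0" "\<And>n. M (\<tau> n) > 0" "\<tau> \<longlonglongrightarrow> 0"
    and \<tau>_doubling: "\<And>c. c > 0 \<Longrightarrow> \<exists>B. \<forall>n. M (c * \<tau> n) \<le> B * M (\<tau> n)"
  shows "\<not> isomorphically_polyhedral_on hM nm"
proof
  assume "isomorphically_polyhedral_on hM nm"
  then obtain W :: "(nat \<Rightarrow> real) set" and K T C1 C2 where W: "banach_on W K" "polyhedral_on W K"
    and T: "linear_on hM T" "bij_betw T hM W"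
    and C: "\<forall>x\<in>hM. K (T x) \<le> C1 * nm x" "\<forall>x\<in>hM. nm x \<le> C2 * K (T x)"
    unfolding isomorphically_polyhedral_on_def isomorphic_on_def by blast
  obtain d :: "nat \<Rightarrow> nat \<Rightarrow> real" where d: "\<And>n. d n \<in> hM" "\<And>x e. x \<in> hM \<Longrightarrow> e > 0 \<Longrightarrow> \<exists>n. nm (x - d n) < e"
    by (rule dense_sequence) (rule that)
  have TW: "T x \<in> W" if "x \<in> hM" for x using T(2) that by (auto simp: bij_betw_def)
  interpret W: normed_subspace W K
    by unfold_locales (use W in \<open>simp add: banach_on_def\<close>)
  interpret W: polyhedral_space W K "\<lambda>n. T (d n)"
  proof unfold_locales
    show "W.mcomplete" using W by (simp add: banach_on_def)
    show "polyhedral_on W K" by (rule W)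
    show "T (d n) \<in> W" for n using TW d by blast
    fix y and e :: real assume y: "y \<in> W" and e: "e > 0"
    obtain x where x: "x \<in> hM" "y = T x" using y T(2) by (auto simp: bij_betw_def)
    obtain n where n: "nm (x - d n) < e / (\<bar>C1\<bar> + 1)" using d(2)[OF x(1), of "e / (\<bar>C1\<bar> + 1)"] e by auto
    have "K (y - T (d n)) = K (T (x - d n))" using linear_on_simps(3)[OF T(1) x(1) d(1)] x(2) by simp
    also have "\<dots> \<le> C1 * nm (x - d n)" using C(1) x(1) d(1) by blast
    also have "\<dots> \<le> (\<bar>C1\<bar> + 1) * nm (x - d n)"
      using x(1) d(1) by (intro mult_right_mono norm_ge_0) auto
    also have "\<dots> < (\<bar>C1\<bar> + 1) * (e / (\<bar>C1\<bar> + 1))" using n by (intro mult_strict_left_mono) auto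
    also have "\<dots> = e" by simp
    finally show "\<exists>n. K (y - T (d n)) < e" by blast
  qed
  obtain f :: "nat \<Rightarrow> (nat \<Rightarrow> real) \<Rightarrow> real" where f: "\<And>n. linear_on W (f n)"
    "\<And>n x. x \<in> W \<Longrightarrow> \<bar>f n x\<bar> \<le> K x" "\<And>x. x \<in> W \<Longrightarrow> \<exists>n. f n x = K x"
    by (rule W.countable_boundary) (rule that)
  \<comment> \<open>The constant \<open>C2\<close> has no prescribed sign; the maximum makes the
    factor positive.\<close>
  define c where "c = max C2 1"
  have c: "c > 0" "C2 \<le> c" by (auto simp: c_def)
  show False
  proof (rule no_attained_norm[OF gr \<tau> \<tau>_doubling, where g = "\<lambda>n x. c * f n (T x)" and D = "c * C1"])
    fix n
    show "linear_on hM (\<lambda>x. c * f n (T x))"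
      unfolding linear_on_def
    proof (intro conjI ballI allI)
      fix x y assume "x \<in> hM" "y \<in> hM"
      thus "c * f n (T (x + y)) = c * f n (T x) + c * f n (T y)"
        using linear_on_simps(1)[OF T(1)] W.linear_on_simps(1)[OF f(1)] TW by (simp add: distrib_left)
    next
      fix b x assume x: "x \<in> hM"
      show "c * f n (T (b *\<^sub>R x)) = b *\<^sub>R (c * f n (T x))"
        using linear_on_simps(2)[OF T(1) x x, of b] W.linear_on_simps(2)[OF f(1) TW[OF x] TW[OF x], of n b]
        by simp
    qed
    fix x assume x: "x \<in> hM"
    have "\<bar>f n (T x)\<bar> \<le> C1 * nm x" using f(2)[OF TW[OF x], of n] C(1) x by fastforce
    thus "\<bar>c * f n (T x)\<bar> \<le> c * C1 * nm x" using c by (simp add: abs_mult mult.assoc)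
  next
    fix x assume x: "x \<in> hM"
    have K0: "K (T x) \<ge> 0" using W.norm_ge_0[OF TW[OF x]] .
    obtain n where n: "f n (T x) = K (T x)" using f(3)[OF TW[OF x]] by blast
    have "nm x \<le> C2 * K (T x)" using C(2) x by blast
    also have "\<dots> \<le> c * K (T x)" using c K0 by (intro mult_right_mono)
    finally have "nm x \<le> \<bar>c * f n (T x)\<bar>" using n K0 c by (simp add: abs_mult)
    moreover have "\<bar>c * f m (T x)\<bar> \<le> \<bar>c * f n (T x)\<bar>" for m
      using f(2)[OF TW[OF x], of m] n K0 c by (simp add: abs_mult)
    ultimately show "\<exists>n. nm x \<le> \<bar>c * f n (T x)\<bar> \<and> (\<forall>m. \<bar>c * f m (T x)\<bar> \<le> \<bar>c * f n (T x)\<bar>)" by blast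
  qed auto
qed

end

section \<open>The Orlicz function\<close>

definition hinge :: "real \<Rightarrow> real"
  where "hinge u = exp (max 0 (u - 1)) - 1"

lemma hinge_eq_0: "u \<le> 1 \<Longrightarrow> hinge u = 0"
  by (simp add: hinge_def)

lemma hinge_nonneg: "0 \<le> hinge u"
  by (simp add: hinge_def)

lemma hinge_mono: "u \<le> v \<Longrightarrow> hinge u \<le> hinge v"
  by (simp add: hinge_def)

lemma hinge_le_exp: "0 \<le> u \<Longrightarrow> hinge u \<le> exp u"
proof -
  assume "0 \<le> u"
  hence "exp (max 0 (u - 1)) \<le> exp u" by simp
  thus ?thesis unfolding hinge_def by linarith
qed

lemma hinge_convex:
  assumes "0 \<le> t" "t \<le> 1"
  shows "hinge ((1 - t) * x + t * y) \<le> (1 - t) * hinge x + t * hinge y"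
proof -
  define a where "a = max 0 (x - 1)"
  define b where "b = max 0 (y - 1)"
  have "(1 - t) * (x - 1) + t * (y - 1) \<le> (1 - t) * a + t * b"
    using assms by (intro add_mono mult_left_mono) (auto simp: a_def b_def)
  moreover have "0 \<le> (1 - t) * a + t * b" using assms by (simp add: a_def b_def)
  ultimately have "max 0 ((1 - t) * x + t * y - 1) \<le> (1 - t) * a + t * b" by (simp add: algebra_simps)
  hence "exp (max 0 ((1 - t) * x + t * y - 1)) \<le> exp ((1 - t) * a + t * b)" by simp
  also have "\<dots> \<le> (1 - t) * exp a + t * exp b"
    using convex_onD[OF exp_convex assms, of a b] by simp
  finally have "hinge ((1 - t) * x + t * y) \<le> (1 - t) * exp a + t * exp b - ((1 - t) + t)"
    by (simp add: hinge_def)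
  also have "\<dots> = (1 - t) * hinge x + t * hinge y"
    unfolding hinge_def a_def[symmetric] b_def[symmetric] by (simp add: algebra_simps)
  finally show ?thesis .
qed

text \<open>A single term of the exponential series.\<close>

lemma power_le_fact_exp:
  fixes y :: real
  assumes "0 \<le> y"
  shows "y ^ q \<le> fact q * exp y"
proof -
  have "(\<lambda>n. y ^ n /\<^sub>R fact n) sums exp y" by (rule exp_converges)
  hence s: "summable (\<lambda>n. y ^ n /\<^sub>R fact n)" "(\<Sum>n. y ^ n /\<^sub>R fact n) = exp y"
    by (auto simp: sums_iff)
  have "(\<Sum>n\<in>{q}. y ^ n /\<^sub>R fact n) \<le> (\<Sum>n. y ^ n /\<^sub>R fact n)"
    using assms by (intro sum_le_suminf[OF s(1)]) auto
  hence "y ^ q / fact q \<le> exp y" unfolding s(2) by (simp add: divide_inverse mult.commute)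
  thus ?thesis by (simp add: divide_le_eq mult.commute)
qed

text \<open>Let \<open>w = t u > 1\<close>. Then \<open>hinge u\<close> is at least
  \<open>exp (u - w)\<close> times \<open>hinge w\<close>, while \<open>1 / t = u / w\<close> is at
  most \<open>1 + (u - w)\<close>, so the exponential factor beats \<open>(1 / t)^q\<close> up to a
  constant.\<close>

lemma hinge_growth:
  assumes "0 \<le> t" "t \<le> 1" "0 \<le> u"
  shows "hinge (t * u) \<le> fact q * exp 1 * t ^ q * hinge u"
proof (cases "t * u \<le> 1")
  case True
  thus ?thesis using assms hinge_nonneg[of u] by (simp add: hinge_eq_0)
next
  case False
  define w where "w = t * u"
  have w: "w > 1" "w \<le> u" using False assms by (auto simp: w_def mult_left_le_one_le)
  have t: "t > 0" using False assms by (cases "t = 0") auto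
  have tu: "1 / t = u / w" using t w by (simp add: w_def)
  have "u / w = 1 + (u - w) / w" using w by (simp add: diff_divide_distrib)
  also have "\<dots> \<le> 1 + (u - w) / 1" using w by (intro add_left_mono divide_left_mono) auto
  finally have uw: "1 / t \<le> 1 + (u - w)" unfolding tu by simp
  have "(1 / t) ^ q \<le> (1 + (u - w)) ^ q" using uw t by (intro power_mono) auto
  also have "\<dots> \<le> fact q * exp (1 + (u - w))" using w by (intro power_le_fact_exp) auto
  finally have "1 \<le> fact q * exp (1 + (u - w)) * t ^ q"
    using t by (simp add: power_one_over divide_le_eq)
  hence 1: "1 \<le> fact q * exp 1 * t ^ q * exp (u - w)" by (simp add: exp_add mult_ac)
  have "exp (u - w) * hinge w \<le> hinge u"
  proof -
    have "exp (u - w) * hinge w = exp (u - w + (w - 1)) - exp (u - w)"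
      using w by (simp add: hinge_def algebra_simps exp_add[symmetric])
    also have "\<dots> \<le> exp (u - 1) - 1" using w by simp
    also have "\<dots> = hinge u" using w by (simp add: hinge_def)
    finally show ?thesis .
  qed
  hence 2: "(fact q * exp 1 * t ^ q) * (exp (u - w) * hinge w) \<le> (fact q * exp 1 * t ^ q) * hinge u"
    using t by (intro mult_left_mono) auto
  have "1 * hinge w \<le> (fact q * exp 1 * t ^ q * exp (u - w)) * hinge w"
    by (rule mult_right_mono[OF 1 hinge_nonneg])
  thus ?thesis using 2 unfolding w_def[symmetric] by (simp only: mult.assoc)
qed

text \<open>
  For every \<open>c\<close> and large \<open>n\<close> the sum below is comparable to \<open>wt n\<close> on \<open>[2/n!, c/n!]\<close>, with constants
  independent of \<open>n\<close>: smaller indices do not contribute there, and larger ones are made negligible by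
  the weights.
\<close>

definition wt :: "nat \<Rightarrow> real"
  where "wt n = exp (- fact (n + 2))"

definition MO :: "real \<Rightarrow> real"
  where "MO t = (\<Sum>n. wt n * hinge (t * fact n))"

lemma wt_pos: "wt n > 0"
  by (simp add: wt_def)

text \<open>The exponent \<open>(k+2)!\<close> of the weight exceeds the sum of three parts:
  \<open>k k!\<close> absorbs the exponential for \<open>t\<close> up to \<open>k\<close>,
  \<open>k\<close> leaves a geometric series, and \<open>(k+1)!\<close> makes the term small against
  the weights of smaller index.\<close>

lemma wt_exp_le:
  assumes "0 \<le> t" "t \<le> real k"
  shows "wt k * exp (t * fact k) \<le> exp (- fact (k + 1)) * exp (-1) ^ k"
proof -
  have "fact (k + 1) + k * fact k + k \<le> (fact (k + 2) :: nat)"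
  proof -
    have f: "1 \<le> (fact k :: nat)" by (simp add: Suc_leI)
    have "(fact (k + 2) :: nat) = fact (k + 1) + (k + 1) * ((k + 1) * fact k)"
      by (simp add: algebra_simps)
    moreover have "k * fact k + k \<le> (k + 1) * ((k + 1) * fact k)"
    proof -
      have "k \<le> k * fact k" using f by simp
      moreover have "(k + 1) * ((k + 1) * fact k) = k * (k * fact k) + 2 * (k * fact k) + fact k"
        by (simp add: algebra_simps)
      ultimately show ?thesis by linarith
    qed
    ultimately show ?thesis by linarith
  qed
  hence "real (fact (k + 1) + k * fact k + k) \<le> real (fact (k + 2))" by (rule of_nat_mono)
  hence "fact (k + 1) + real k * fact k + real k \<le> fact (k + 2)"
    by (simp only: of_nat_add of_nat_mult of_nat_fact)
  moreover have "t * fact k \<le> real k * fact k" using assms by (intro mult_right_mono) auto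
  ultimately have "- fact (k + 2) + t * fact k \<le> - fact (k + 1) + real k * (-1)" by linarith
  hence "exp (- fact (k + 2) + t * fact k) \<le> exp (- fact (k + 1) + real k * (-1))" by (simp only: exp_le_cancel_iff)
  thus ?thesis unfolding wt_def exp_add[symmetric] exp_of_nat_mult[symmetric] .
qed

lemma summable_exp_minus: "summable (\<lambda>n. exp (-1 :: real) ^ n)"
  by (rule summable_geometric) simp

lemma MO_summable: "summable (\<lambda>n. wt n * hinge (t * fact n))"
proof (rule summable_comparison_test'[OF summable_exp_minus])
  fix n assume n: "nat \<lceil>\<bar>t\<bar>\<rceil> \<le> n"
  have "norm (wt n * hinge (t * fact n)) = wt n * hinge (t * fact n)"
    using wt_pos[of n] hinge_nonneg[of "t * fact n"] by simp
  also have "\<dots> \<le> wt n * exp (\<bar>t\<bar> * fact n)"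
  proof (rule mult_left_mono)
    have "hinge (t * fact n) \<le> hinge (\<bar>t\<bar> * fact n)" by (intro hinge_mono mult_right_mono) auto
    also have "\<dots> \<le> exp (\<bar>t\<bar> * fact n)" by (rule hinge_le_exp) simp
    finally show "hinge (t * fact n) \<le> exp (\<bar>t\<bar> * fact n)" .
  qed (use wt_pos[of n] in simp)
  also have "\<dots> \<le> exp (- fact (n + 1)) * exp (-1) ^ n"
    using n by (intro wt_exp_le) linarith+
  also have "\<dots> \<le> 1 * exp (-1) ^ n" by (intro mult_right_mono) auto
  finally show "norm (wt n * hinge (t * fact n)) \<le> exp (-1) ^ n" by simp
qed

lemma MO_term_le: "wt n * hinge (t * fact n) \<le> MO t"
proof -
  have "(\<Sum>k\<in>{n}. wt k * hinge (t * fact k)) \<le> MO t"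
    unfolding MO_def using wt_pos hinge_nonneg
    by (intro sum_le_suminf[OF MO_summable]) (auto intro: mult_nonneg_nonneg less_imp_le)
  thus ?thesis by simp
qed

lemma MO_mono: "s \<le> t \<Longrightarrow> MO s \<le> MO t"
  unfolding MO_def
  by (intro suminf_le MO_summable mult_left_mono hinge_mono mult_right_mono) (auto intro: less_imp_le wt_pos)

lemma MO_convex: "convex_on UNIV MO"
proof (rule convex_onI)
  fix t x y :: real assume t: "0 < t" "t < 1"
  have s: "summable (\<lambda>n. c * (wt n * hinge (x * fact n)))" for c x by (rule summable_mult[OF MO_summable])
  have "MO ((1 - t) * x + t * y)
      \<le> (\<Sum>n. (1 - t) * (wt n * hinge (x * fact n)) + t * (wt n * hinge (y * fact n)))"
    unfolding MO_def
  proof (intro suminf_le MO_summable summable_add s)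
    fix n
    have "hinge (((1 - t) * x + t * y) * fact n) \<le> (1 - t) * hinge (x * fact n) + t * hinge (y * fact n)"
      using hinge_convex[of t "x * fact n" "y * fact n"] t by (simp add: algebra_simps)
    from mult_left_mono[OF this, of "wt n"] wt_pos[of n]
    show "wt n * hinge (((1 - t) * x + t * y) * fact n)
        \<le> (1 - t) * (wt n * hinge (x * fact n)) + t * (wt n * hinge (y * fact n))"
      by (simp add: algebra_simps)
  qed
  also have "\<dots> = (1 - t) * MO x + t * MO y"
    unfolding MO_def suminf_add[OF s s, symmetric] suminf_mult[OF MO_summable] ..
  finally show "MO ((1 - t) *\<^sub>R x + t *\<^sub>R y) \<le> (1 - t) * MO x + t * MO y" by simp
qed simp

lemma orlicz_MO: "orlicz_function MO"
  unfolding orlicz_function_def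
proof (intro conjI)
  have "continuous_on UNIV MO" using MO_convex by (intro convex_on_continuous) auto
  thus "continuous_on {0..} MO" by (rule continuous_on_subset) simp
  show "mono_on {0..} MO" by (auto intro: mono_onI MO_mono)
  show "convex_on {0..} MO" using MO_convex by (rule convex_on_subset) (auto)
  show "MO 0 = 0" by (simp add: MO_def hinge_eq_0)
  \<comment> \<open>The term of index 0 alone grows at least linearly.\<close>
  have "filterlim (\<lambda>t. wt 0 * (t - 1)) at_top at_top"
    using wt_pos[of 0] by real_asymp
  moreover have "\<forall>\<^sub>F t in at_top. wt 0 * (t - 1) \<le> MO t"
    unfolding eventually_at_top_linorder
  proof (intro exI[of _ 1] allI impI)
    fix t :: real assume "t \<ge> 1"
    have "t - 1 \<le> hinge t" using exp_ge_add_one_self[of "max 0 (t - 1)"] unfolding hinge_def by linarith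
    hence "wt 0 * (t - 1) \<le> wt 0 * hinge (t * fact 0)" using wt_pos[of 0] by (simp add: mult_left_mono)
    also have "\<dots> \<le> MO t" by (rule MO_term_le)
    finally show "wt 0 * (t - 1) \<le> MO t" .
  qed
  ultimately show "filterlim MO at_top at_top" by (rule filterlim_at_top_mono)
qed

section \<open>Growth and doubling of the concrete function\<close>

interpretation MO: orlicz MO
  by unfold_locales (rule orlicz_MO)

text \<open>The estimate for \<open>hinge\<close> is uniform in its argument, so it holds for all
  dilates and hence for the weighted sum with the same constant.\<close>

lemma MO_growth: "MO.growth q (fact q * exp 1)"
  unfolding MO.growth_def
proof (intro conjI allI impI)
  fix t x :: real assume t: "0 \<le> t" "t \<le> 1" and x: "0 \<le> x"
  have "MO (t * x) \<le> (\<Sum>n. fact q * exp 1 * t ^ q * (wt n * hinge (x * fact n)))"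
    unfolding MO_def
  proof (intro suminf_le MO_summable summable_mult)
    fix n
    have "hinge (t * (x * fact n)) \<le> fact q * exp 1 * t ^ q * hinge (x * fact n)"
      using t x by (intro hinge_growth) auto
    from mult_left_mono[OF this, of "wt n"] wt_pos[of n]
    show "wt n * hinge (t * x * fact n) \<le> fact q * exp 1 * t ^ q * (wt n * hinge (x * fact n))"
      by (simp add: mult_ac)
  qed
  also have "\<dots> = fact q * exp 1 * t ^ q * MO x" unfolding MO_def by (rule suminf_mult[OF MO_summable])
  finally show "MO (t * x) \<le> fact q * exp 1 * t ^ q * MO x" .
qed simp

text \<open>The numerator 2 places the \<open>n\<close>-th argument beyond the kink at 1, where
  \<open>hinge\<close> is already at least 1.\<close>

lemma MO_ge_wt: "wt n \<le> MO (2 / fact n)"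
proof -
  have "1 \<le> hinge (2 / fact n * fact n)" using exp_ge_add_one_self[of 1] by (simp add: hinge_def)
  hence "wt n * 1 \<le> wt n * hinge (2 / fact n * fact n)" using wt_pos[of n] by (intro mult_left_mono) auto
  also have "\<dots> \<le> MO (2 / fact n)" by (rule MO_term_le)
  finally show ?thesis by simp
qed

lemma MO_doubling_large:
  assumes c: "c > 0" and n: "2 * c \<le> real n"
  shows "MO (c * (2 / fact n)) \<le> wt n * (hinge (2 * c) + (\<Sum>k. exp (-1) ^ k))"
proof -
  let ?t = "c * (2 / fact n) :: real"
  have n0: "n > 0" using c n by (cases n) auto
  have s1: "summable (\<lambda>k. if k = n then hinge (2 * c) else 0)" by (rule summable_finite[of "{n}"]) auto
  have "MO ?t \<le> (\<Sum>k. wt n * ((if k = n then hinge (2 * c) else 0) + exp (-1) ^ k))"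
    unfolding MO_def
  proof (intro suminf_le MO_summable summable_mult summable_add s1 summable_exp_minus)
    fix k
    consider "k < n" | "k = n" | "k > n" by linarith
    thus "wt k * hinge (?t * fact k) \<le> wt n * ((if k = n then hinge (2 * c) else 0) + exp (-1) ^ k)"
    proof cases
      case 1
      \<comment> \<open>The gap between the scales \<open>k!\<close> and \<open>n!\<close> is at
        least \<open>n\<close>, hence at least \<open>2 c\<close>, which keeps the argument in the
        zero range of \<open>hinge\<close>.\<close>
      have "fact k * n \<le> (fact n :: nat)"
      proof -
        have "(fact k :: nat) \<le> fact (n - 1)" using 1 by (intro fact_mono) auto
        hence "fact k * n \<le> fact (n - 1) * (n::nat)" by simp
        also have "\<dots> = fact n" using n0 by (simp add: fact_reduce[of n] mult.commute)
        finally show ?thesis .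
      qed
      hence "real (fact k * n) \<le> real (fact n)" by (rule of_nat_mono)
      hence fk: "fact k * real n \<le> fact n" by simp
      have "2 * c * fact k \<le> real n * fact k" using n by (intro mult_right_mono) auto
      also have "\<dots> \<le> fact n" using fk by (simp add: mult.commute)
      finally have "?t * fact k \<le> 1" by (simp add: divide_le_eq mult_ac)
      thus ?thesis using wt_pos[of n] 1 by (simp add: hinge_eq_0)
    next
      case 2
      have "?t * fact k = 2 * c" using 2 by simp
      thus ?thesis using wt_pos[of n] 2 by (simp add: mult.commute)
    next
      case 3
      have "?t \<le> c * 2" using c fact_ge_1[of n, where 'a = real] by (intro mult_left_mono) (auto simp: divide_le_eq)
      hence tk: "?t \<le> real k" using n 3 by linarith
      have t0: "0 \<le> ?t" using c by simp
      have "wt k * hinge (?t * fact k) \<le> wt k * exp (?t * fact k)"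
        using wt_pos[of k] mult_nonneg_nonneg[OF t0 fact_ge_zero[of k]]
        by (intro mult_left_mono hinge_le_exp) (auto intro: less_imp_le)
      also have "\<dots> \<le> exp (- fact (k + 1)) * exp (-1) ^ k" using t0 tk by (rule wt_exp_le)
      also have "\<dots> \<le> wt n * exp (-1) ^ k"
      proof (rule mult_right_mono)
        \<comment> \<open>From \<open>k > n\<close> follows \<open>k + 1 \<ge> n + 2\<close>, so the
          factor left over by \<open>wt_exp_le\<close> is at most \<open>wt n\<close>.\<close>
        have "fact (n + 2) \<le> (fact (k + 1) :: real)" using 3 by (intro fact_mono) auto
        thus "exp (- fact (k + 1)) \<le> wt n" by (simp add: wt_def)
      qed simp
      finally show ?thesis using 3 by simp
    qed
  qed
  also have "\<dots> = wt n * (\<Sum>k. (if k = n then hinge (2 * c) else 0) + exp (-1) ^ k)"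
    by (intro suminf_mult summable_add s1 summable_exp_minus)
  also have "(\<Sum>k. (if k = n then hinge (2 * c) else 0) + exp (-1) ^ k) = hinge (2 * c) + (\<Sum>k. exp (-1) ^ k)"
    unfolding suminf_add[OF s1 summable_exp_minus, symmetric]
    using suminf_finite[of "{n}" "\<lambda>k. if k = n then hinge (2 * c) else 0"] by simp
  finally show ?thesis .
qed

text \<open>The finitely many \<open>n\<close> below \<open>2 c\<close> are covered by adding all
  their ratios to the bound.\<close>

lemma MO_doubling:
  assumes c: "c > 0"
  shows "\<exists>B. \<forall>n. MO (c * (2 / fact n)) \<le> B * MO (2 / fact n)"
proof -
  define E where "E = hinge (2 * c) + (\<Sum>k. exp (-1 :: real) ^ k)"
  define n0 where "n0 = nat \<lceil>2 * c\<rceil>"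
  define S where "S = (\<Sum>n<n0. MO (c * (2 / fact n)) / MO (2 / fact n))"
  have E: "E \<ge> 0" unfolding E_def
    by (intro add_nonneg_nonneg hinge_nonneg suminf_nonneg summable_exp_minus) auto
  have pos: "MO (2 / fact n) > 0" for n using MO_ge_wt[of n] wt_pos[of n] by linarith
  have nonneg: "0 \<le> MO (c * (2 / fact n))" for n
    using c by (intro MO.M_nonneg) auto
  have S: "S \<ge> 0" unfolding S_def by (intro sum_nonneg divide_nonneg_pos nonneg pos)
  have "MO (c * (2 / fact n)) \<le> (E + S) * MO (2 / fact n)" for n
  proof (cases "n < n0")
    case True
    have "MO (c * (2 / fact n)) / MO (2 / fact n) \<le> S"
      unfolding S_def using True by (intro member_le_sum divide_nonneg_pos nonneg pos) auto
    hence "MO (c * (2 / fact n)) \<le> S * MO (2 / fact n)" using pos[of n] by (simp add: divide_le_eq)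
    also have "\<dots> \<le> (E + S) * MO (2 / fact n)" using E pos[of n] by (intro mult_right_mono) auto
    finally show ?thesis .
  next
    case False
    hence "2 * c \<le> real n" unfolding n0_def by linarith
    hence "MO (c * (2 / fact n)) \<le> wt n * E" unfolding E_def by (rule MO_doubling_large[OF c])
    also have "\<dots> \<le> MO (2 / fact n) * E" using E MO_ge_wt[of n] by (intro mult_right_mono)
    also have "\<dots> \<le> (E + S) * MO (2 / fact n)" using S pos[of n] by (simp add: distrib_right mult.commute)
    finally show ?thesis .
  qed
  thus ?thesis by blast
qed

lemma two_over_fact_tendsto: "(\<lambda>n. 2 / fact n :: real) \<longlonglongrightarrow> 0"
proof (rule tendsto_sandwich[of "\<lambda>_. 0" _ _ "\<lambda>n. 2 * (1 / real n)"])
  have "(\<lambda>n. 2 * (1 / real n)) \<longlonglongrightarrow> 2 * 0" by (intro tendsto_intros lim_1_over_n)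
  thus "(\<lambda>n. 2 * (1 / real n)) \<longlonglongrightarrow> 0" by simp
  show "\<forall>\<^sub>F n in sequentially. 2 / fact n \<le> 2 * (1 / real n)"
    using eventually_gt_at_top[of 0]
  proof eventually_elim
    case (elim n)
    have "n \<le> fact n" by (rule fact_ge_self)
    hence "real n \<le> real (fact n)" by (rule of_nat_mono)
    hence "real n \<le> fact n" by simp
    thus "2 / fact n \<le> 2 * (1 / real n)" using elim by (simp add: frac_le)
  qed
qed auto

theorem theorem8:
  shows "(\<exists>M. orlicz_function M \<and>
            c0_saturated_on (orlicz_h M) (orlicz_norm M) \<and>
            \<not> isomorphically_polyhedral_on (orlicz_h M) (orlicz_norm M)) \<and>
         (\<exists>(V :: (nat \<Rightarrow> real) set) N.
            banach_on V N \<and> c0_saturated_on V N \<and> separable_dual_on V N \<and>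
            \<not> isomorphically_polyhedral_on V N)"
proof -
  have growth: "\<exists>C. MO.growth q C" for q
    using MO_growth by blast
  have c0: "c0_saturated_on (orlicz_h MO) (orlicz_norm MO)"
    by (rule MO.c0_saturated[OF growth])
  have "MO (2 / fact n) > 0" for n
    using MO_ge_wt[of n] wt_pos[of n] by linarith
  hence not_poly: "\<not> isomorphically_polyhedral_on (orlicz_h MO) (orlicz_norm MO)"
    by (intro MO.not_isomorphically_polyhedral[OF MO_growth[of 2], where \<tau> = "\<lambda>n. 2 / fact n"]
        two_over_fact_tendsto MO_doubling) auto
  have dual: "separable_dual_on (orlicz_h MO) (orlicz_norm MO)"
    by (rule MO.separable_dual[OF MO_growth])
  show ?thesis
    using orlicz_MO MO.banach c0 dual not_poly by blast
qed

end
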